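(* Let $f\in C^2([-1,1]^d)$ be such that $\int_{[-1,1]^d}f(y)\,\mu^d_{\alpha,\beta}(dy)=0$, and let $d_{\alpha,\beta}=\min\{\alpha_j+\beta_j+2:\ j=1,\dots,d\}$. Then there is a constant $C_{f,\alpha,\beta,d}$ such that for all $x\in[-1,1]^d$ and $t>0$, $$\left|\frac{\partial}{\partial t}P_t^{\alpha,\beta}f(x)\right|\le C_{f,\alpha,\beta,d}\,(1+|x|)\,e^{-d_{\alpha,\beta}^{1/2}t},$$ where $|x|$ is the Euclidean norm of $x\in\mathbb{R}^d$. As a consequence, the Poisson–Jacobi semigroup $\{P_t^{\alpha,\beta}\}_{t\ge0}$ has exponential decay on $(C_0^{\alpha,\beta})^\perp=\bigoplus_{n=1}^\infty C_n^{\alpha,\beta}$; more explicitly, if $f\in C^2([-1,1]^d)$ satisfies $\int_{[-1,1]^d}f(y)\,\mu^d_{\alpha,\beta}(dy)=0$, then there is a constant $C_{f,\alpha,\beta,d}$ such that for all $x\in[-1,1]^d$ and $t>0$, $$|P_t^{\alpha,\beta}f(x)|\le C_{f,\alpha,\beta,d}\,(1+|x|)\,e^{-d_{\alpha,\beta}^{1/2}t}.$$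
   Context: $\mathbb{N}=\{0,1,2,\dots\}$. Fix $d\ge 1$ and $\alpha=(\alpha_1,\dots,\alpha_d),\ \beta=(\beta_1,\dots,\beta_d)\in\mathbb{R}^d$ with $\alpha_i,\beta_i>-\frac12$ for all $i$. The normalized Jacobi measure on $[-1,1]^d$ is the probability measure $\mu^d_{\alpha,\beta}(dx)=\prod_{i=1}^d \frac{1}{2^{\alpha_i+\beta_i+1}B(\alpha_i+1,\beta_i+1)}(1-x_i)^{\alpha_i}(1+x_i)^{\beta_i}dx_i$, where $B$ is the Beta function. For $n\in\mathbb{N}$ and real $a,b>-1$, $p_n^{a,b}$ is the one-dimensional Jacobi polynomial of degree $n$, given by Rodrigues' formula $(1-x)^a(1+x)^b c_n p_n^{a,b}(x)=\frac{(-1)^n}{2^n n!}\frac{d^n}{dx^n}\{(1-x)^{a+n}(1+x)^{b+n}\}$, with constant $c_n>0$ chosen so that $p_n^{a,b}$ has $L^2$ norm $1$ with respect to the one-dimensional normalized Jacobi measure. For $\kappa=(\kappa_1,\dots,\kappa_d)\in\mathbb{N}^d$ put $|\kappa|=\sum_i\kappa_i$ and $\vec p_\kappa^{\,\alpha,\beta}(x)=\prod_{i=1}^d p_{\kappa_i}^{\alpha_i,\beta_i}(x_i)$; these form an orthonormal basis of $L^2([-1,1]^d,\mu^d_{\alpha,\beta})$. Put $\lambda_\kappa=\sum_{i=1}^d\kappa_i(\kappa_i+\alpha_i+\beta_i+1)$. $C_n^{\alpha,\beta}$ is the closed subspace of $L^2([-1,1]^d,\mu^d_{\alpha,\beta})$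 spanned by $\{\vec p_\kappa^{\,\alpha,\beta}:|\kappa|=n\}$. The Jacobi semigroup is $T_t^{\alpha,\beta}f(x)=\int_{[-1,1]^d}f(y)\,p_d^{\alpha,\beta}(t,x,y)\,\mu^d_{\alpha,\beta}(dy)$ with kernel $p_d^{\alpha,\beta}(t,x,y)=\sum_{\kappa\in\mathbb{N}^d}e^{-\lambda_\kappa t}\vec p_\kappa^{\,\alpha,\beta}(x)\vec p_\kappa^{\,\alpha,\beta}(y)$ for $t>0$. The Poisson–Jacobi semigroup is $P_t^{\alpha,\beta}f(x)=\frac{1}{\sqrt\pi}\int_0^\infty\frac{e^{-u}}{\sqrt u}T^{\alpha,\beta}_{t^2/4u}f(x)\,du$, so that $P_t^{\alpha,\beta}\vec p_\kappa^{\,\alpha,\beta}=e^{-\lambda_\kappa^{1/2}t}\vec p_\kappa^{\,\alpha,\beta}$. Constants $C_{f,\alpha,\beta,d}$ depend only on $f,\alpha,\beta,d$ and may differ between the two inequalities. "Exponential decay" has no meaning beyond the explicit bound on $|P_t^{\alpha,\beta}f(x)|$ in the claim. *)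

theory Defs
  imports "HOL-Analysis.Analysis"
begin

definition cube :: "(real^'d) set" where
  "cube = {x. \<forall>i. x $ i \<in> {-1..1}}"

text \<open>Twice continuously differentiable on \<open>S\<close>, boundary points included: gradient and Hessian are
  taken within \<open>S\<close>. They are unique when \<open>S\<close> is the cube, since a closed convex set with nonempty
  interior determines derivatives at all its points.\<close>

definition C2_on :: "(real^'d) set \<Rightarrow> (real^'d \<Rightarrow> real) \<Rightarrow> bool" where
  "C2_on S f \<longleftrightarrow> (\<exists>G :: real^'d \<Rightarrow> real^'d. \<exists>H :: real^'d \<Rightarrow> real^'d^'d.
     (\<forall>x\<in>S. (f has_derivative (\<lambda>h. G x \<bullet> h)) (at x within S)) \<and>
     (\<forall>x\<in>S. (G has_derivative (\<lambda>h. H x *v h)) (at x within S)) \<and>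
     continuous_on S H)"

text \<open>The convention \<open>0 powr a = 0\<close> only affects a null set (the boundary) in the measures below.
  The measures live on the restricted space, so values of functions outside it are irrelevant.\<close>

definition jacobi_density :: "real \<Rightarrow> real \<Rightarrow> real \<Rightarrow> real" where
  "jacobi_density a b x =
     (1 - x) powr a * (1 + x) powr b / (2 powr (a + b + 1) * Beta (a + 1) (b + 1))"

definition jacobi_measure_1 :: "real \<Rightarrow> real \<Rightarrow> real measure" where
  "jacobi_measure_1 a b =
     density (restrict_space lborel {-1..1}) (\<lambda>x. ennreal (jacobi_density a b x))"

definition jacobi_measure :: "real^'d \<Rightarrow> real^'d \<Rightarrow> (real^'d) measure" where
  "jacobi_measure \<alpha> \<beta> =
     density (restrict_space lborel cube) (\<lambda>x. ennreal (\<Prod>i\<in>UNIV. jacobi_density (\<alpha> $ i) (\<beta> $ i) (x $ i)))"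

text \<open>Rodrigues' formula is required on the open interval, where both sides are defined for all
  \<open>a, b > -1\<close>; as a polynomial, \<open>p\<close> is thereby determined also at the endpoints.\<close>

definition jacobi_poly :: "nat \<Rightarrow> real \<Rightarrow> real \<Rightarrow> real poly" where
  "jacobi_poly n a b = (THE p. \<exists>c>0.
     (\<forall>x\<in>{-1<..<1}. (1 - x) powr a * (1 + x) powr b * c * poly p x =
        (-1) ^ n / (2 ^ n * fact n) *
        (deriv ^^ n) (\<lambda>y. (1 - y) powr (a + real n) * (1 + y) powr (b + real n)) x) \<and>
     sqrt (\<integral>x. (poly p x)\<^sup>2 \<partial>jacobi_measure_1 a b) = 1)"

definition jacobi_multi :: "real^'d \<Rightarrow> real^'d \<Rightarrow> nat^'d \<Rightarrow> real^'d \<Rightarrow> real" where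
  "jacobi_multi \<alpha> \<beta> \<kappa> x = (\<Prod>i\<in>UNIV. poly (jacobi_poly (\<kappa> $ i) (\<alpha> $ i) (\<beta> $ i)) (x $ i))"

definition jacobi_eigenvalue :: "real^'d \<Rightarrow> real^'d \<Rightarrow> nat^'d \<Rightarrow> real" where
  "jacobi_eigenvalue \<alpha> \<beta> \<kappa> = (\<Sum>i\<in>UNIV. real (\<kappa> $ i) * (real (\<kappa> $ i) + \<alpha> $ i + \<beta> $ i + 1))"

definition jacobi_kernel :: "real^'d \<Rightarrow> real^'d \<Rightarrow> real \<Rightarrow> real^'d \<Rightarrow> real^'d \<Rightarrow> real" where
  "jacobi_kernel \<alpha> \<beta> t x y =
     (\<Sum>\<^sub>\<infinity>\<kappa>. exp (- jacobi_eigenvalue \<alpha> \<beta> \<kappa> * t) * jacobi_multi \<alpha> \<beta> \<kappa> x * jacobi_multi \<alpha> \<beta> \<kappa> y)"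

definition jacobi_semigroup ::
    "real^'d \<Rightarrow> real^'d \<Rightarrow> real \<Rightarrow> (real^'d \<Rightarrow> real) \<Rightarrow> real^'d \<Rightarrow> real" where
  "jacobi_semigroup \<alpha> \<beta> t f x = (\<integral>y. f y * jacobi_kernel \<alpha> \<beta> t x y \<partial>jacobi_measure \<alpha> \<beta>)"

definition poisson_jacobi ::
    "real^'d \<Rightarrow> real^'d \<Rightarrow> real \<Rightarrow> (real^'d \<Rightarrow> real) \<Rightarrow> real^'d \<Rightarrow> real" where
  "poisson_jacobi \<alpha> \<beta> t f x =
     1 / sqrt pi * (LINT u:{0<..}|lborel. exp (-u) / sqrt u * jacobi_semigroup \<alpha> \<beta> (t\<^sup>2 / (4 * u)) f x)"

definition min_eigenvalue :: "real^'d \<Rightarrow> real^'d \<Rightarrow> real" where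
  "min_eigenvalue \<alpha> \<beta> = Min {\<alpha> $ j + \<beta> $ j + 2 | j. True}"

text \<open>Real \<open>L\<^sup>2\<close> spaces are represented by functions rather than by classes modulo null sets. All
  subspaces below are closed under equality almost everywhere.\<close>

definition L2_space :: "'a measure \<Rightarrow> ('a \<Rightarrow> real) set" where
  "L2_space M = {f \<in> borel_measurable M. integrable M (\<lambda>x. (f x)\<^sup>2)}"

definition L2_norm :: "'a measure \<Rightarrow> ('a \<Rightarrow> real) \<Rightarrow> real" where
  "L2_norm M f = sqrt (\<integral>x. (f x)\<^sup>2 \<partial>M)"

definition L2_complement :: "'a measure \<Rightarrow> ('a \<Rightarrow> real) set \<Rightarrow> ('a \<Rightarrow> real) set" where
  "L2_complement M V = {f \<in> L2_space M. \<forall>g\<in>V. (\<integral>x. f x * g x \<partial>M) = 0}"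

definition L2_closed_span :: "'a measure \<Rightarrow> ('a \<Rightarrow> real) set \<Rightarrow> ('a \<Rightarrow> real) set" where
  "L2_closed_span M B = {f \<in> L2_space M. \<forall>\<epsilon>>0. \<exists>F c. finite F \<and> F \<subseteq> B \<and>
     L2_norm M (\<lambda>x. f x - (\<Sum>b\<in>F. c b * b x)) < \<epsilon>}"

text \<open>\<open>V\<close> is the orthogonal Hilbert space direct sum of the subspaces \<open>W 0, W 1, \<dots>\<close>.\<close>

definition is_hilbert_sum ::
    "'a measure \<Rightarrow> ('a \<Rightarrow> real) set \<Rightarrow> (nat \<Rightarrow> ('a \<Rightarrow> real) set) \<Rightarrow> bool" where
  "is_hilbert_sum M V W \<longleftrightarrow>
     (\<forall>m n. m \<noteq> n \<longrightarrow> W m \<subseteq> L2_complement M (W n)) \<and>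
     V = {f \<in> L2_space M. \<exists>g. (\<forall>n. g n \<in> W n) \<and>
            (\<lambda>N. L2_norm M (\<lambda>x. f x - (\<Sum>n<N. g n x))) \<longlonglongrightarrow> 0}"

definition jacobi_chaos :: "real^'d \<Rightarrow> real^'d \<Rightarrow> nat \<Rightarrow> (real^'d \<Rightarrow> real) set" where
  "jacobi_chaos \<alpha> \<beta> n =
     L2_closed_span (jacobi_measure \<alpha> \<beta>) {jacobi_multi \<alpha> \<beta> \<kappa> | \<kappa>. (\<Sum>i\<in>UNIV. \<kappa> $ i) = n}"

end

theory Submission
  imports Defs "HOL-Computational_Algebra.Polynomial" "HOL-Real_Asymp.Real_Asymp"
begin

text \<open>
  Write \<open>T\<^sub>s\<close> for the Jacobi semigroup, \<open>p\<^sub>\<kappa>\<close> for the orthonormal polynomials, \<open>\<lambda>\<^sub>\<kappa>\<close> for the eigenvalues,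
  \<open>\<L>\<close> for the Jacobi operator \<open>\<Sum>\<^sub>i (1 - x\<^sub>i\<^sup>2) \<partial>\<^sub>i\<^sup>2 + (\<beta>\<^sub>i - \<alpha>\<^sub>i - (\<alpha>\<^sub>i + \<beta>\<^sub>i + 2) x\<^sub>i) \<partial>\<^sub>i\<close>, whose eigenfunctions are
  the \<open>p\<^sub>\<kappa>\<close> with eigenvalues \<open>- \<lambda>\<^sub>\<kappa>\<close>, and \<open>d\<close> for the smallest nonzero \<open>\<lambda>\<^sub>\<kappa>\<close>.

  The Poisson semigroup is the average \<open>P\<^sub>t f = \<pi>\<^bsup>-1/2\<^esup> \<integral> e\<^bsup>-u\<^esup> u\<^bsup>-1/2\<^esup> T\<^bsub>t\<^sup>2/4u\<^esub> f du\<close>. For \<open>f\<close> of class \<open>C\<^sup>2\<close>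
  one has \<open>\<partial>\<^sub>s T\<^sub>s f = T\<^sub>s \<L>f\<close>, so differentiating under the integral expresses \<open>\<partial>\<^sub>t P\<^sub>t f\<close> by
  \<open>T\<^sub>s \<L>f\<close>. Both \<open>f\<close> and \<open>\<L>f\<close> are continuous and have mean zero, and for every such function
  \<open>g\<close> the bound \<open>\<bar>T\<^sub>s g\<bar> \<le> K e\<^bsup>-ds\<^esup>\<close> holds uniformly on the cube (\<open>heat_decay\<close>). The elementary
  estimate \<open>sub_majorant_integral\<close> turns \<open>e\<^bsup>-ds\<^esup>\<close> into \<open>e\<^bsup>-\<surd>d t\<^esup>\<close> (\<open>subordinate_DERIV\<close>,
  \<open>subordinate_decay\<close>).

  The bound on \<open>T\<^sub>s g\<close> has two regimes. For \<open>s \<ge> 1\<close> the eigenfunction series converges absolutely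
  and each of its terms decays at least like \<open>e\<^bsup>-ds\<^esup>\<close>. Since \<open>\<lambda>\<^sub>n\<close> grows quadratically, any bound of
  the form \<open>e\<^bsup>o(n\<^sup>2)\<^esup>\<close> on the sup norm of the one-dimensional polynomials suffices for this
  (\<open>summable_jsup\<close>), and a crude one comes from the coefficients in Rodrigues' formula. For
  \<open>s \<le> 1\<close> the series gives nothing uniform; there \<open>T\<^sub>s\<close> is a contraction for the sup norm
  (\<open>heat_contraction\<close>). For polynomials that is the parabolic maximum principle: the operator
  degenerates at the boundary of the cube and its drift points inward there, so the principle
  also holds at maxima on the boundary. The general case follows by Weierstrass approximation.

  The identity \<open>\<partial>\<^sub>s T\<^sub>s f = T\<^sub>s \<L>f\<close> amounts to \<open>\<langle>\<L>f, p\<^sub>\<kappa>\<rangle> = - \<lambda>\<^sub>\<kappa> \<langle>f, p\<^sub>\<kappa>\<rangle>\<close>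
  (\<open>fourier_generator\<close>), which is Green's formula \<open>jint_Green\<close> applied in one coordinate at a time.

  The decomposition of \<open>L\<^sup>2\<close> rests on the density of polynomials (\<open>L2_approx\<close>). Since Fourier
  partial sums are best approximations, density alone makes the Fourier series of any \<open>f\<close>
  converge to \<open>f\<close>; grouping its terms by \<open>\<bar>\<kappa>\<bar>\<close> gives the sum over the chaoses.
\<close>

section \<open>Weighted integrals on the interval\<close>

definition jweight :: "real \<Rightarrow> real \<Rightarrow> real \<Rightarrow> real" where
  "jweight a b x = (1 - x) powr a * (1 + x) powr b"

definition jint :: "real \<Rightarrow> real \<Rightarrow> (real \<Rightarrow> real) \<Rightarrow> real" where
  "jint a b f = (LINT x:{-1..1}|lborel. jweight a b x * f x)"

lemma jweight_nonneg: "0 \<le> jweight a b x"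
  by (simp add: jweight_def)

lemma jweight_pos: "x \<in> {-1<..<1} \<Longrightarrow> 0 < jweight a b x"
  by (simp add: jweight_def)

lemma jweight_measurable [measurable]: "jweight a b \<in> borel_measurable borel"
  unfolding jweight_def by measurable

text \<open>The substitution \<open>x = 2t - 1\<close> turns the weight into the integrand of the Beta integral.\<close>

lemma jweight_integrable:
  assumes "a > -1" "b > -1"
  shows "set_integrable lborel {-1..1} (jweight a b)"
proof -
  have "((\<lambda>t. t powr (b + 1 - 1) * (1 - t) powr (a + 1 - 1)) has_integral Beta (b + 1) (a + 1)) {0..1}"
    using assms by (intro has_integral_Beta_real) auto
  from has_integral_affinity[OF this[folded cbox_interval], of "1/2" "1/2", simplified]
  have "(\<lambda>x. (x / 2 + 1/2) powr b * (1 - (x / 2 + 1/2)) powr a) integrable_on {-1..1}"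
    by (auto simp: integrable_on_def image_affinity_atLeastAtMost_diff)
  hence "(\<lambda>x. 2 powr (a + b) * ((x / 2 + 1/2) powr b * (1 - (x / 2 + 1/2)) powr a)) integrable_on {-1..1}"
    by (intro integrable_on_mult_right)
  also have "?this \<longleftrightarrow> jweight a b integrable_on {-1..1}"
  proof (rule integrable_cong)
    fix x :: real assume x: "x \<in> {-1..1}"
    have "(x / 2 + 1/2) powr b = (1 + x) powr b / 2 powr b"
      using x by (simp add: powr_divide[symmetric] add_divide_distrib add.commute)
    moreover have "(1 - (x / 2 + 1/2)) powr a = (1 - x) powr a / 2 powr a"
      using x by (simp add: powr_divide[symmetric] field_simps)
    ultimately show "2 powr (a + b) * ((x / 2 + 1/2) powr b * (1 - (x / 2 + 1/2)) powr a) = jweight a b x"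
      by (simp add: jweight_def powr_add)
  qed
  finally have "jweight a b absolutely_integrable_on {-1..1}"
    by (rule nonnegative_absolutely_integrable_1) (simp add: jweight_nonneg)
  thus ?thesis
    by (simp add: absolutely_integrable_on_def set_integrable_def
      integrable_completion borel_measurable_indicator)
qed

lemma jint_integrable:
  assumes "a > -1" "b > -1" "continuous_on {-1..1} f"
  shows "set_integrable lborel {-1..1} (\<lambda>x. jweight a b x * f x)"
proof -
  have "compact (f ` {-1..1})"
    using assms by (intro compact_continuous_image) auto
  hence "bounded (f ` {-1..1})" by (rule compact_imp_bounded)
  then obtain B where B: "\<And>x. x \<in> {-1..1} \<Longrightarrow> \<bar>f x\<bar> \<le> B"
    unfolding bounded_real by blast
  have [measurable]: "(\<lambda>x. indicator {-1..1} x *\<^sub>R f x) \<in> borel_measurable borel"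
    using assms by (intro borel_measurable_continuous_on_indicator) auto
  show ?thesis
    unfolding set_integrable_def
  proof (rule Bochner_Integration.integrable_bound)
    show "integrable lborel (\<lambda>x. B * (indicator {-1..1} x *\<^sub>R jweight a b x))"
      using jweight_integrable[OF assms(1,2)] by (simp add: set_integrable_def)
    have "(\<lambda>x. indicator {-1..1} x *\<^sub>R (jweight a b x * f x)) =
      (\<lambda>x. jweight a b x * (indicator {-1..1} x *\<^sub>R f x))" by auto
    thus "(\<lambda>x. indicator {-1..1} x *\<^sub>R (jweight a b x * f x)) \<in> borel_measurable lborel"
      using borel_measurable_times[OF jweight_measurable \<open>_ \<in> borel_measurable borel\<close>] by simp
    show "AE x in lborel. norm (indicator {-1..1} x *\<^sub>R (jweight a b x * f x))
        \<le> norm (B * (indicator {-1..1} x *\<^sub>R jweight a b x))"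
    proof (intro AE_I2)
      fix x :: real
      show "norm (indicator {-1..1} x *\<^sub>R (jweight a b x * f x)) \<le> norm (B * (indicator {-1..1} x *\<^sub>R jweight a b x))"
      proof (cases "x \<in> {-1..1}")
        case True
        have "\<bar>f x\<bar> \<le> \<bar>B\<bar>" using B[OF True] by linarith
        hence "\<bar>f x\<bar> * \<bar>jweight a b x\<bar> \<le> \<bar>B\<bar> * \<bar>jweight a b x\<bar>"
          by (intro mult_right_mono) auto
        thus ?thesis using True by (simp add: abs_mult mult.commute)
      qed auto
    qed
  qed
qed

lemma jint_add:
  assumes "a > -1" "b > -1" "continuous_on {-1..1} f" "continuous_on {-1..1} g"
  shows "jint a b (\<lambda>x. f x + g x) = jint a b f + jint a b g"
  using set_integral_add(2)[OF jint_integrable[OF assms(1,2,3)] jint_integrable[OF assms(1,2,4)]]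
  by (simp add: jint_def distrib_left)

lemma jint_cmult: "jint a b (\<lambda>x. c * f x) = c * jint a b f"
  by (simp add: jint_def mult.left_commute)

lemma jint_diff:
  assumes "a > -1" "b > -1" "continuous_on {-1..1} f" "continuous_on {-1..1} g"
  shows "jint a b (\<lambda>x. f x - g x) = jint a b f - jint a b g"
  using set_integral_diff(2)[OF jint_integrable[OF assms(1,2,3)] jint_integrable[OF assms(1,2,4)]]
  by (simp add: jint_def right_diff_distrib)

lemma jint_cong:
  "(\<And>x. x \<in> {-1..1} \<Longrightarrow> f x = g x) \<Longrightarrow> jint a b f = jint a b g"
  unfolding jint_def by (intro set_lebesgue_integral_cong) auto

lemma jint_mono:
  assumes "a > -1" "b > -1" "continuous_on {-1..1} f" "continuous_on {-1..1} g"
    "\<And>x. x \<in> {-1..1} \<Longrightarrow> f x \<le> g x"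
  shows "jint a b f \<le> jint a b g"
  unfolding jint_def using assms
  by (intro set_integral_mono jint_integrable mult_left_mono jweight_nonneg)

text \<open>Every integration by parts below has this form: \<open>F\<close> vanishes at both endpoints because it
  carries a factor \<open>(1 - x)\<^bsup>a+1\<^esup> (1 + x)\<^bsup>b+1\<^esup>\<close>. The
  derivative is only asked for in the interior, as the weight may blow up at the endpoints.\<close>

lemma jint_derivative_zero:
  assumes ab: "a > -1" "b > -1" and k: "continuous_on {-1..1} k"
    and F: "continuous_on {-1..1} F" "F (-1) = F 1"
    and d: "\<And>x. x \<in> {-1<..<1} \<Longrightarrow> (F has_real_derivative jweight a b x * k x) (at x)"
  shows "jint a b k = 0"
proof -
  have "((\<lambda>x. jweight a b x * k x) has_integral (F 1 - F (-1))) {-1..1}"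
    using F d by (intro fundamental_theorem_of_calculus_interior)
      (auto simp: has_real_derivative_iff_has_vector_derivative)
  moreover have "((\<lambda>x. jweight a b x * k x) has_integral jint a b k) {-1..1}"
    using set_borel_integral_eq_integral[OF jint_integrable[OF ab k]]
    by (simp add: jint_def has_integral_iff)
  ultimately have "jint a b k = F 1 - F (-1)" by (rule has_integral_unique[symmetric])
  thus ?thesis using F(2) by simp
qed

text \<open>If the integral were zero, \<open>k\<close> would vanish almost everywhere, but it is positive on a whole
  interval around \<open>x\<^sub>0\<close>.\<close>

lemma jint_pos:
  assumes ab: "a > -1" "b > -1" and k: "continuous_on {-1..1} k"
    and nonneg: "\<And>x. x \<in> {-1..1} \<Longrightarrow> 0 \<le> k x"
    and x0: "x0 \<in> {-1<..<1}" "0 < k x0"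
  shows "0 < jint a b k"
proof (rule ccontr)
  let ?h = "\<lambda>x. indicator {-1..1} x *\<^sub>R (jweight a b x * k x)"
  have nn: "0 \<le> ?h x" for x
    using nonneg by (auto simp: indicator_def jweight_nonneg)
  assume "\<not> 0 < jint a b k"
  moreover have "0 \<le> jint a b k"
    unfolding jint_def set_lebesgue_integral_def by (intro integral_nonneg_AE AE_I2 nn)
  ultimately have "integral\<^sup>L lborel ?h = 0"
    unfolding jint_def set_lebesgue_integral_def by simp
  hence "AE x in lborel. ?h x = 0"
    using integral_nonneg_eq_0_iff_AE[OF jint_integrable[OF ab k, unfolded set_integrable_def]] nn by auto
  hence ae: "AE x in lborel. x \<in> {-1<..<1} \<longrightarrow> k x = 0"
  proof eventually_elim
    case (elim x)
    show ?case
    proof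
      assume x: "x \<in> {-1<..<1}"
      thus "k x = 0" using elim jweight_pos[OF x, of a b] by simp
    qed
  qed
  have "isCont k x0"
    using k x0 by (intro continuous_on_interior[OF k]) (simp add: interior_atLeastAtMost_real)
  hence "\<forall>\<^sub>F x in nhds x0. k x > 0"
    using x0(2) by (intro order_tendstoD(1)[of k "k x0"]) (simp_all add: continuous_at tendsto_at_iff_tendsto_nhds)
  then obtain d where d: "d > 0" "\<And>x. \<bar>x - x0\<bar> < d \<Longrightarrow> k x > 0"
    unfolding eventually_nhds_metric dist_real_def by blast
  define S where "S = {max (-1) (x0 - d)<..<min 1 (x0 + d)}"
  have "AE x in lborel. x \<notin> S"
    using ae
  proof eventually_elim
    case (elim x)
    thus ?case using d(2)[of x] by (fastforce simp: S_def abs_less_iff)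
  qed
  hence "S \<in> null_sets lborel"
    by (subst AE_iff_null_sets) (auto simp: S_def)
  hence "emeasure lborel S = 0" by blast
  moreover have "max (-1) (x0 - d) < min 1 (x0 + d)" using x0 d by auto
  ultimately show False unfolding S_def by (subst (asm) emeasure_lborel_Ioo) auto
qed

section \<open>Rodrigues polynomials\<close>

lemma jweight_Suc:
  assumes "x \<in> {-1..1}"
  shows "jweight (a + 1) (b + 1) x = (1 - x\<^sup>2) * jweight a b x"
proof -
  have eqs: "(1 - x) powr (a + 1) = (1 - x) * (1 - x) powr a" "(1 + x) powr (b + 1) = (1 + x) * (1 + x) powr b"
    using assms powr_mult_base[of "1 - x" a] powr_mult_base[of "1 + x" b] by (simp_all add: add.commute)
  show ?thesis unfolding jweight_def eqs by (simp add: power2_eq_square algebra_simps)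
qed

lemma jint_Suc: "jint (a + 1) (b + 1) f = jint a b (\<lambda>x. (1 - x\<^sup>2) * f x)"
  unfolding jint_def by (intro set_lebesgue_integral_cong) (auto simp: jweight_Suc)

lemma jweight_continuous:
  assumes "a > 0" "b > 0"
  shows "continuous_on {-1..1} (jweight a b)"
  unfolding jweight_def using assms
  by (intro continuous_intros continuous_on_powr') auto

text \<open>The weight of exponents \<open>a + 1, b + 1\<close> is the one of exponents \<open>a, b\<close> times \<open>1 - x\<^sup>2\<close>, so
  differentiation lowers both exponents by one and leaves a factor that is polynomial if \<open>q\<close> is.\<close>

lemma jweight_mult_deriv:
  assumes x: "x \<in> {-1<..<1}" and q: "(q has_real_derivative q') (at x)"
  shows "((\<lambda>y. jweight (a + 1) (b + 1) y * q y) has_real_derivative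
     jweight a b x * ((1 - x\<^sup>2) * q' + (b - a - (a + b + 2) * x) * q x)) (at x)"
proof -
  have d: "((\<lambda>y. jweight (a + 1) (b + 1) y * q y) has_real_derivative
      jweight (a + 1) (b + 1) x * q' +
      (-((a + 1) * (1 - x) powr a) * (1 + x) powr (b + 1) + (1 - x) powr (a + 1) * ((b + 1) * (1 + x) powr b)) * q x) (at x)"
    unfolding jweight_def using x
    by (auto intro!: derivative_eq_intros q simp: algebra_simps)
  have eqs: "(1 - x) powr (a + 1) = (1 - x) * (1 - x) powr a" "(1 + x) powr (b + 1) = (1 + x) * (1 + x) powr b"
    using x powr_mult_base[of "1 - x" a] powr_mult_base[of "1 + x" b] by (simp_all add: add.commute)
  have "jweight (a + 1) (b + 1) x * q' +
      (-((a + 1) * (1 - x) powr a) * (1 + x) powr (b + 1) + (1 - x) powr (a + 1) * ((b + 1) * (1 + x) powr b)) * q x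
      = jweight a b x * ((1 - x\<^sup>2) * q' + (b - a - (a + b + 2) * x) * q x)"
    unfolding jweight_def eqs by (simp add: power2_eq_square algebra_simps)
  with d show ?thesis by simp
qed

text \<open>The polynomial with \<open>D (jweight (a + 1) (b + 1) * q) = jweight a b * jstep a b q\<close>. It serves
  twice: iterated, it produces the Jacobi polynomials as in Rodrigues' formula; composed with
  \<open>pderiv\<close>, it is the one-dimensional Jacobi operator
  \<open>(1 - x\<^sup>2) q'' + (b - a - (a + b + 2) x) q'\<close>.\<close>

definition jstep :: "real \<Rightarrow> real \<Rightarrow> real poly \<Rightarrow> real poly" where
  "jstep a b q = [:1, 0, -1:] * pderiv q + [:b - a, - (a + b + 2):] * q"

lemma poly_jstep: "poly (jstep a b q) x = (1 - x\<^sup>2) * poly (pderiv q) x + (b - a - (a + b + 2) * x) * poly q x"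
  by (simp add: jstep_def power2_eq_square algebra_simps)

text \<open>Up to sign, \<open>jstep a b\<close> and \<open>pderiv\<close> are adjoint between the weights with exponents
  \<open>a, b\<close> and \<open>a + 1, b + 1\<close>.\<close>

lemma jint_by_parts:
  assumes ab: "a > -1" "b > -1"
  shows "jint a b (\<lambda>x. poly q x * poly (jstep a b r) x) =
    - jint (a + 1) (b + 1) (\<lambda>x. poly (pderiv q) x * poly r x)"
proof -
  have "jint a b (\<lambda>x. poly q x * poly (jstep a b r) x + (1 - x\<^sup>2) * (poly (pderiv q) x * poly r x)) = 0"
  proof (rule jint_derivative_zero[OF ab, where F = "\<lambda>x. jweight (a + 1) (b + 1) x * poly (q * r) x"])
    show "continuous_on {-1..1} (\<lambda>x. jweight (a + 1) (b + 1) x * poly (q * r) x)"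
      using ab by (intro continuous_intros jweight_continuous) auto
    show "((\<lambda>x. jweight (a + 1) (b + 1) x * poly (q * r) x) has_real_derivative
       jweight a b x * (poly q x * poly (jstep a b r) x + (1 - x\<^sup>2) * (poly (pderiv q) x * poly r x))) (at x)"
      if "x \<in> {-1<..<1}" for x
      using jweight_mult_deriv[OF that poly_DERIV[of "q * r" x], of a b]
      by (simp add: poly_jstep pderiv_mult algebra_simps)
  qed (auto simp: jweight_def intro!: continuous_intros)
  thus ?thesis
    by (subst (asm) jint_add[OF ab]) (auto simp: jint_Suc intro!: continuous_intros)
qed

text \<open>Symmetry of the Jacobi operator: the difference of the two integrands is the derivative of the
  weighted Wronskian of \<open>h\<close> and \<open>p\<close>, whose weight vanishes at both endpoints.\<close>

lemma jint_Green:
  assumes ab: "a > -1" "b > -1"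
    and h: "continuous_on {-1..1} h" "continuous_on {-1..1} h1" "continuous_on {-1..1} h2"
    and d: "\<And>x. x \<in> {-1<..<1} \<Longrightarrow> (h has_real_derivative h1 x) (at x)"
           "\<And>x. x \<in> {-1<..<1} \<Longrightarrow> (h1 has_real_derivative h2 x) (at x)"
  shows "jint a b (\<lambda>x. h x * poly (jstep a b (pderiv p)) x) =
     jint a b (\<lambda>x. ((1 - x\<^sup>2) * h2 x + (b - a - (a + b + 2) * x) * h1 x) * poly p x)"
proof -
  have "jint a b (\<lambda>x. h x * poly (jstep a b (pderiv p)) x
      - ((1 - x\<^sup>2) * h2 x + (b - a - (a + b + 2) * x) * h1 x) * poly p x) = 0"
  proof (rule jint_derivative_zero[OF ab,
        where F = "\<lambda>x. jweight (a + 1) (b + 1) x * (h x * poly (pderiv p) x - h1 x * poly p x)"])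
    show "continuous_on {-1..1} (\<lambda>x. jweight (a + 1) (b + 1) x * (h x * poly (pderiv p) x - h1 x * poly p x))"
      using ab by (intro continuous_intros jweight_continuous h) auto
    show "((\<lambda>x. jweight (a + 1) (b + 1) x * (h x * poly (pderiv p) x - h1 x * poly p x)) has_real_derivative
       jweight a b x * (h x * poly (jstep a b (pderiv p)) x
      - ((1 - x\<^sup>2) * h2 x + (b - a - (a + b + 2) * x) * h1 x) * poly p x)) (at x)"
      if x: "x \<in> {-1<..<1}" for x
    proof -
      have "((\<lambda>x. h x * poly (pderiv p) x - h1 x * poly p x) has_real_derivative
          (h x * poly (pderiv (pderiv p)) x - h2 x * poly p x)) (at x)"
        by (auto intro!: derivative_eq_intros d x simp: algebra_simps)
      from jweight_mult_deriv[OF x this, of a b] show ?thesis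
        by (simp add: poly_jstep algebra_simps)
    qed
  qed (auto simp: jweight_def intro!: continuous_intros h)
  thus ?thesis
    by (subst (asm) jint_diff[OF ab]) (auto intro!: continuous_intros h)
qed

text \<open>Shifting the exponents in the recursion lets the innermost weight stay \<open>jweight (a + n) (b + n)\<close>
  while each differentiation lowers its exponents by one.\<close>

primrec rodrigues :: "nat \<Rightarrow> real \<Rightarrow> real \<Rightarrow> real poly" where
  "rodrigues 0 a b = 1"
| "rodrigues (Suc n) a b = jstep a b (rodrigues n (a + 1) (b + 1))"

lemma funpow_deriv_jweight:
  assumes "x \<in> {-1<..<1}"
  shows "(deriv ^^ n) (jweight (a + real n) (b + real n)) x = jweight a b x * poly (rodrigues n a b) x"
  using assms
proof (induction n arbitrary: a b x)
  case (Suc n)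
  have eq: "(deriv ^^ n) (jweight (a + real (Suc n)) (b + real (Suc n))) y =
      jweight (a + 1) (b + 1) y * poly (rodrigues n (a + 1) (b + 1)) y" if "y \<in> {-1<..<1}" for y
    using Suc.IH[OF that, of "a + 1" "b + 1"] by (simp add: add_ac)
  have "((\<lambda>y. jweight (a + 1) (b + 1) y * poly (rodrigues n (a + 1) (b + 1)) y) has_real_derivative
      jweight a b x * poly (rodrigues (Suc n) a b) x) (at x)"
    using jweight_mult_deriv[OF Suc.prems poly_DERIV, of a b "rodrigues n (a + 1) (b + 1)"] by (simp add: poly_jstep)
  hence "((deriv ^^ n) (jweight (a + real (Suc n)) (b + real (Suc n))) has_real_derivative
      jweight a b x * poly (rodrigues (Suc n) a b) x) (at x)"
    by (rule has_field_derivative_transform_within_open[of _ _ _ "{-1<..<1}"]) (use Suc.prems eq in auto)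
  thus ?case by (simp add: DERIV_imp_deriv del: rodrigues.simps)
qed simp

text \<open>Moving all \<open>n\<close> derivatives of Rodrigues' formula onto \<open>q\<close>. This gives orthogonality to lower
  degrees, and with \<open>q = x\<^sup>n\<close> a lower bound for the norm.\<close>

lemma jint_rodrigues:
  assumes "a > -1" "b > -1"
  shows "jint a b (\<lambda>x. poly q x * poly (rodrigues n a b) x) =
     (-1) ^ n * jint (a + real n) (b + real n) (poly ((pderiv ^^ n) q))"
  using assms
proof (induction n arbitrary: a b q)
  case (Suc n)
  have "jint a b (\<lambda>x. poly q x * poly (rodrigues (Suc n) a b) x) =
     - jint (a + 1) (b + 1) (\<lambda>x. poly (pderiv q) x * poly (rodrigues n (a + 1) (b + 1)) x)"
    using jint_by_parts[OF Suc.prems] by simp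
  also have "\<dots> = - ((-1) ^ n * jint (a + 1 + real n) (b + 1 + real n) (poly ((pderiv ^^ n) (pderiv q))))"
    using Suc.prems by (subst Suc.IH) auto
  also have "\<dots> = (-1) ^ Suc n * jint (a + real (Suc n)) (b + real (Suc n)) (poly ((pderiv ^^ Suc n) q))"
    by (simp add: add_ac funpow_swap1)
  finally show ?case .
qed simp

lemma degree_jstep: "degree (jstep a b q) \<le> Suc (degree q)"
proof -
  have "degree ([:1, 0, -1:] * pderiv q) \<le> Suc (degree q)"
  proof (cases "degree q = 0")
    case True
    hence "pderiv q = 0" by (simp add: pderiv_eq_0_iff)
    thus ?thesis by simp
  next
    case False
    have "degree ([:1, 0, -1:] * pderiv q) \<le> 2 + degree (pderiv q)"
      by (rule order_trans[OF degree_mult_le]) simp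
    thus ?thesis using False by (simp add: degree_pderiv)
  qed
  moreover have "degree ([:b - a, - (a + b + 2):] * q) \<le> Suc (degree q)"
    by (rule order_trans[OF degree_mult_le]) simp
  ultimately show ?thesis unfolding jstep_def by (rule degree_add_le)
qed

text \<open>For \<open>a, b > -1\<close> the leading coefficient is multiplied by a nonzero number, so the degree grows by
  exactly one in each step.\<close>

lemma coeff_jstep_Suc:
  assumes "degree q \<le> n"
  shows "coeff (jstep a b q) (Suc n) = - (real n + a + b + 2) * coeff q n"
proof -
  have "coeff q (Suc n) = 0" "coeff q (Suc (Suc n)) = 0" using assms by (auto intro!: coeff_eq_0)
  thus ?thesis
    by (cases n) (auto simp: jstep_def coeff_pderiv coeff_pCons algebra_simps split: nat.splits)
qed

lemma degree_rodrigues_le: "degree (rodrigues n a b) \<le> n"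
proof (induction n arbitrary: a b)
  case (Suc n)
  show ?case using degree_jstep[of a b "rodrigues n (a + 1) (b + 1)"] Suc[of "a + 1" "b + 1"] by simp
qed simp

lemma coeff_rodrigues:
  assumes "a > -1" "b > -1"
  shows "coeff (rodrigues n a b) n \<noteq> 0"
  using assms
proof (induction n arbitrary: a b)
  case (Suc n)
  have "coeff (rodrigues (Suc n) a b) (Suc n) = - (real n + a + b + 2) * coeff (rodrigues n (a + 1) (b + 1)) n"
    by (simp add: coeff_jstep_Suc degree_rodrigues_le)
  moreover have "coeff (rodrigues n (a + 1) (b + 1)) n \<noteq> 0" using Suc by auto
  moreover have "real n + a + b + 2 > 0" using Suc.prems by linarith
  ultimately show ?case by simp
qed simp

lemma degree_rodrigues:
  assumes "a > -1" "b > -1"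
  shows "degree (rodrigues n a b) = n"
  using degree_rodrigues_le coeff_rodrigues[OF assms] by (simp add: le_antisym le_degree)

lemma pderiv_funpow_eq_0: "degree q < n \<Longrightarrow> (pderiv ^^ n) q = 0" for q :: "real poly"
proof (induction n arbitrary: q)
  case (Suc n)
  show ?case
  proof (cases "degree q = 0")
    case True
    hence "pderiv q = 0" by (simp add: pderiv_eq_0_iff)
    moreover have "(pderiv ^^ n) (0 :: real poly) = 0" by (induction n) auto
    ultimately show ?thesis by (simp add: funpow_swap1)
  next
    case False
    hence "degree (pderiv q) < n" using Suc.prems by (simp add: degree_pderiv)
    thus ?thesis using Suc.IH by (simp add: funpow_swap1)
  qed
qed simp

lemma jint_rodrigues_eq_0:
  assumes "a > -1" "b > -1" "degree q < n"
  shows "jint a b (\<lambda>x. poly q x * poly (rodrigues n a b) x) = 0"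
  using assms by (simp add: jint_rodrigues pderiv_funpow_eq_0) (simp add: jint_def)

text \<open>A nonzero polynomial has a point in the open interval where it does not vanish.\<close>

lemma jint_square_pos:
  assumes ab: "a > -1" "b > -1" and "q \<noteq> 0"
  shows "jint a b (\<lambda>x. poly q x * poly q x) > 0"
proof -
  have "infinite ({-1<..<1::real} - {x. poly q x = 0})"
    using assms(3) poly_roots_finite[of q] by (intro Diff_infinite_finite) (auto simp: infinite_Ioo)
  then obtain x0 where "x0 \<in> {-1<..<1::real} - {x. poly q x = 0}"
    using infinite_imp_nonempty by blast
  thus ?thesis
    by (intro jint_pos[OF ab, of _ x0]) (auto intro!: continuous_intros simp: zero_less_mult_iff linorder_neq_iff)
qed

definition jeigenvalue :: "real \<Rightarrow> real \<Rightarrow> nat \<Rightarrow> real" where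
  "jeigenvalue a b n = real n * (real n + a + b + 1)"

text \<open>The operator is symmetric and does not raise degrees. The difference \<open>r\<close> of the two sides has
  degree less than \<open>n\<close>, because the coefficients of \<open>x\<^sup>n\<close> agree; it is orthogonal to itself, because
  \<open>rodrigues n a b\<close> is orthogonal to all polynomials of lower degree.\<close>

lemma rodrigues_eigen:
  assumes ab: "a > -1" "b > -1"
  shows "jstep a b (pderiv (rodrigues n a b)) = smult (- jeigenvalue a b n) (rodrigues n a b)"
proof (cases n)
  case 0
  thus ?thesis by (simp add: jstep_def jeigenvalue_def)
next
  case (Suc m)
  define R where "R = rodrigues n a b"
  define r where "r = jstep a b (pderiv R) + smult (jeigenvalue a b n) R"
  have degR: "degree R = n" unfolding R_def by (rule degree_rodrigues[OF ab])
  have L: "degree (jstep a b (pderiv q)) \<le> degree q" if "degree q > 0" for q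
    using degree_jstep[of a b "pderiv q"] that by (simp add: degree_pderiv)
  have dr: "degree r \<le> n"
    unfolding r_def using L[of R] degR Suc by (intro degree_add_le) auto
  have "coeff r n = 0"
  proof -
    have "coeff (jstep a b (pderiv R)) n = - (real m + a + b + 2) * coeff (pderiv R) m"
      unfolding Suc by (rule coeff_jstep_Suc) (use degR Suc in \<open>simp add: degree_pderiv\<close>)
    also have "\<dots> = - jeigenvalue a b n * coeff R n"
      using Suc by (simp add: coeff_pderiv jeigenvalue_def algebra_simps)
    finally show ?thesis by (simp add: r_def)
  qed
  have small: "degree r < n"
  proof (cases "r = 0")
    case False
    thus ?thesis using dr \<open>coeff r n = 0\<close> leading_coeff_0_iff[of r] by (cases "degree r = n") auto
  qed (use Suc in simp)
  have "r = 0"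
  proof (rule ccontr)
    assume "r \<noteq> 0"
    have "jint a b (\<lambda>x. poly r x * poly r x) =
        jint a b (\<lambda>x. poly r x * poly (jstep a b (pderiv R)) x + jeigenvalue a b n * (poly r x * poly R x))"
      by (intro jint_cong) (simp add: r_def algebra_simps)
    also have "\<dots> = jint a b (\<lambda>x. poly r x * poly (jstep a b (pderiv R)) x) + jeigenvalue a b n * jint a b (\<lambda>x. poly r x * poly R x)"
      by (subst jint_add[OF ab]) (auto intro!: continuous_intros simp: jint_cmult)
    also have "jint a b (\<lambda>x. poly r x * poly R x) = 0"
      unfolding R_def by (rule jint_rodrigues_eq_0[OF ab small])
    also have "jint a b (\<lambda>x. poly r x * poly (jstep a b (pderiv R)) x) =
        jint a b (\<lambda>x. poly (jstep a b (pderiv r)) x * poly R x)"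
      by (subst jint_Green[OF ab, where ?h1.0 = "poly (pderiv r)" and ?h2.0 = "poly (pderiv (pderiv r))"])
         (auto intro!: continuous_intros poly_DERIV simp: poly_jstep)
    also have "\<dots> = 0"
    proof -
      have "degree (jstep a b (pderiv r)) < n"
      proof (cases "degree r = 0")
        case True
        hence "pderiv r = 0" by (simp add: pderiv_eq_0_iff)
        thus ?thesis using Suc by (simp add: jstep_def)
      next
        case False
        thus ?thesis using L[of r] small by auto
      qed
      thus ?thesis unfolding R_def by (rule jint_rodrigues_eq_0[OF ab])
    qed
    finally show False using jint_square_pos[OF ab \<open>r \<noteq> 0\<close>] by simp
  qed
  thus ?thesis by (simp add: r_def R_def add_eq_0_iff)
qed

section \<open>Normalised Jacobi polynomials and their size\<close>

text \<open>The normalising constant of the one-dimensional Jacobi measure.\<close>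

definition jmass :: "real \<Rightarrow> real \<Rightarrow> real" where
  "jmass a b = 2 powr (a + b + 1) * Beta (a + 1) (b + 1)"

lemma jmass_pos: "a > -1 \<Longrightarrow> b > -1 \<Longrightarrow> jmass a b > 0"
  by (simp add: jmass_def Beta_def Gamma_real_pos)

lemma jacobi_density_eq: "jacobi_density a b x = jweight a b x / jmass a b"
  by (simp add: jacobi_density_def jweight_def jmass_def)

lemma integral_jacobi_measure_1:
  assumes ab: "a > -1" "b > -1" and f: "continuous_on {-1..1} f"
  shows "(\<integral>x. f x \<partial>jacobi_measure_1 a b) = jint a b f / jmass a b"
proof -
  have [measurable]: "jacobi_density a b \<in> borel_measurable borel"
    unfolding jacobi_density_def by measurable
  have "f \<in> borel_measurable (restrict_space borel {-1..1})"
    using f by (rule borel_measurable_continuous_on_restrict)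
  hence f': "f \<in> borel_measurable (restrict_space lborel {-1..1})"
    by (simp cong: measurable_cong_sets)
  have "(\<integral>x. f x \<partial>jacobi_measure_1 a b) = (\<integral>x. jacobi_density a b x * f x \<partial>restrict_space lborel {-1..1})"
    unfolding jacobi_measure_1_def using jmass_pos[OF ab] jweight_nonneg[of a b]
    by (subst integral_density[OF f'])
       (auto intro!: measurable_restrict_space1 simp: jacobi_density_eq)
  also have "\<dots> = (LINT x:{-1..1}|lborel. jacobi_density a b x * f x)"
    by (simp add: integral_restrict_space set_lebesgue_integral_def)
  also have "\<dots> = jint a b f / jmass a b"
    unfolding jint_def jacobi_density_eq by simp
  finally show ?thesis .
qed

text \<open>The definite description is legitimate: on the open interval the weight cancels from Rodrigues'
  formula, so \<open>c p\<close> is a fixed nonzero polynomial, and the norm condition with \<open>c > 0\<close> determines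
  \<open>c\<close>. For everything that follows it is enough to know the polynomial up to a factor.\<close>

lemma jacobi_poly_rodrigues:
  assumes ab: "a > -1" "b > -1"
  obtains s where "s \<noteq> 0" "jacobi_poly n a b = smult s (rodrigues n a b)"
    "jint a b (\<lambda>x. (poly (jacobi_poly n a b) x)\<^sup>2) = jmass a b"
proof -
  define s0 :: real where "s0 = (-1) ^ n / (2 ^ n * fact n)"
  define R where "R = smult s0 (rodrigues n a b)"
  have s0: "s0 \<noteq> 0" by (simp add: s0_def)
  have R0: "R \<noteq> 0" using coeff_rodrigues[OF ab, of n] s0 by (auto simp: R_def)
  define N where "N = sqrt (jint a b (\<lambda>x. (poly R x)\<^sup>2) / jmass a b)"
  have sq: "jint a b (\<lambda>x. (poly R x)\<^sup>2) > 0"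
    using jint_square_pos[OF ab R0] by (simp add: power2_eq_square)
  have N: "N > 0" using sq jmass_pos[OF ab] by (simp add: N_def)
  have N2: "jint a b (\<lambda>x. (poly R x)\<^sup>2) = N\<^sup>2 * jmass a b"
    using sq jmass_pos[OF ab] by (simp add: N_def)
  have smult_norm: "jint a b (\<lambda>x. (poly (smult c R) x)\<^sup>2) = c\<^sup>2 * (N\<^sup>2 * jmass a b)" for c
    by (simp add: power_mult_distrib jint_cmult N2)
  have norm: "(\<integral>x. (poly q x)\<^sup>2 \<partial>jacobi_measure_1 a b) = jint a b (\<lambda>x. (poly q x)\<^sup>2) / jmass a b" for q
    by (rule integral_jacobi_measure_1[OF ab]) (auto intro!: continuous_intros)
  have rod: "(-1) ^ n / (2 ^ n * fact n) * (deriv ^^ n) (\<lambda>y. (1 - y) powr (a + real n) * (1 + y) powr (b + real n)) x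
      = jweight a b x * poly R x" if "x \<in> {-1<..<1}" for x
    using funpow_deriv_jweight[OF that, of n a b]
    by (simp add: R_def s0_def jweight_def[abs_def] mult_ac)
  have "jacobi_poly n a b = smult (1 / N) R"
    unfolding jacobi_poly_def
  proof (rule the_equality)
    show "\<exists>c>0. (\<forall>x\<in>{-1<..<1}. (1 - x) powr a * (1 + x) powr b * c * poly (smult (1 / N) R) x =
        (-1) ^ n / (2 ^ n * fact n) *
        (deriv ^^ n) (\<lambda>y. (1 - y) powr (a + real n) * (1 + y) powr (b + real n)) x) \<and>
     sqrt (\<integral>x. (poly (smult (1 / N) R) x)\<^sup>2 \<partial>jacobi_measure_1 a b) = 1"
    proof (intro exI[of _ N] conjI ballI N)
      show "sqrt (\<integral>x. (poly (smult (1 / N) R) x)\<^sup>2 \<partial>jacobi_measure_1 a b) = 1"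
        unfolding norm smult_norm using N jmass_pos[OF ab] by (simp add: power_divide)
    qed (use N rod in \<open>simp add: jweight_def\<close>)
  next
    fix p
    assume "\<exists>c>0. (\<forall>x\<in>{-1<..<1}. (1 - x) powr a * (1 + x) powr b * c * poly p x =
        (-1) ^ n / (2 ^ n * fact n) *
        (deriv ^^ n) (\<lambda>y. (1 - y) powr (a + real n) * (1 + y) powr (b + real n)) x) \<and>
     sqrt (\<integral>x. (poly p x)\<^sup>2 \<partial>jacobi_measure_1 a b) = 1"
    then obtain c where c: "c > 0" "\<And>x. x \<in> {-1<..<1} \<Longrightarrow> jweight a b x * c * poly p x = jweight a b x * poly R x"
      "(\<integral>x. (poly p x)\<^sup>2 \<partial>jacobi_measure_1 a b) = 1"
      using rod by (auto simp: jweight_def)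
    have "poly (smult c p - R) x = 0" if "x \<in> {-1<..<1}" for x
      using c(2)[OF that] jweight_pos[OF that, of a b] by (simp add: mult.assoc)
    hence "{-1<..<1} \<subseteq> {x. poly (smult c p - R) x = 0}" by blast
    hence "infinite {x. poly (smult c p - R) x = 0}"
      using infinite_Ioo[of "-1" "1::real"] by (simp add: infinite_super)
    hence "smult c p - R = 0" using poly_roots_finite by blast
    hence p: "p = smult (1 / c) R" using c(1) by auto
    have "(1 / c)\<^sup>2 * N\<^sup>2 = 1"
      using c(3) jmass_pos[OF ab] unfolding norm p smult_norm by simp
    hence "N\<^sup>2 = c\<^sup>2" using c(1) by (simp add: field_simps)
    hence "c = N" using c(1) N by (simp add: power2_eq_iff)
    thus "p = smult (1 / N) R" using p by simp
  qed
  moreover have "jint a b (\<lambda>x. (poly (smult (1 / N) R) x)\<^sup>2) = jmass a b"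
    unfolding smult_norm using N by (simp add: power_divide)
  ultimately show thesis
    using that[of "1 / N * s0"] N s0 by (simp add: R_def)
qed

lemma degree_jacobi_poly:
  assumes ab: "a > -1" "b > -1"
  shows "degree (jacobi_poly n a b) = n"
proof -
  from jacobi_poly_rodrigues[OF ab, of n] obtain s where "s \<noteq> 0" "jacobi_poly n a b = smult s (rodrigues n a b)"
    by blast
  thus ?thesis by (simp add: degree_rodrigues[OF ab])
qed

lemma jacobi_poly_eigen:
  assumes ab: "a > -1" "b > -1"
  shows "jstep a b (pderiv (jacobi_poly n a b)) = smult (- jeigenvalue a b n) (jacobi_poly n a b)"
proof -
  from jacobi_poly_rodrigues[OF ab, of n] obtain s where s: "jacobi_poly n a b = smult s (rodrigues n a b)"
    by blast
  have "jstep a b (pderiv (smult s q)) = smult s (jstep a b (pderiv q))" for q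
    by (simp add: jstep_def pderiv_smult smult_add_right)
  thus ?thesis by (simp add: s rodrigues_eigen[OF ab] mult.commute)
qed

lemma jacobi_poly_orthonormal:
  assumes ab: "a > -1" "b > -1"
  shows "jint a b (\<lambda>x. poly (jacobi_poly m a b) x * poly (jacobi_poly n a b) x) = (if m = n then jmass a b else 0)"
proof (cases "m = n")
  case True
  obtain s where "jint a b (\<lambda>x. (poly (jacobi_poly n a b) x)\<^sup>2) = jmass a b"
    using jacobi_poly_rodrigues[OF ab, of n] by blast
  thus ?thesis using True by (simp add: power2_eq_square)
next
  case False
  have *: "jint a b (\<lambda>x. poly (jacobi_poly m a b) x * poly (jacobi_poly n a b) x) = 0" if "m < n" for m n
  proof -
    obtain s where s: "jacobi_poly n a b = smult s (rodrigues n a b)"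
      using jacobi_poly_rodrigues[OF ab, of n] by blast
    have "jint a b (\<lambda>x. poly (jacobi_poly m a b) x * poly (rodrigues n a b) x) = 0"
      by (rule jint_rodrigues_eq_0[OF ab]) (simp add: degree_jacobi_poly[OF ab] that)
    thus ?thesis by (simp add: s mult.left_commute[of _ s] jint_cmult)
  qed
  show ?thesis using *[of m n] *[of n m] False by (cases "m < n") (auto simp: mult.commute)
qed

lemma jacobi_poly_expansion:
  assumes ab: "a > -1" "b > -1" and "degree q \<le> n"
  shows "\<exists>c. q = (\<Sum>k\<le>n. smult (c k) (jacobi_poly k a b))"
  using assms(3)
proof (induction n arbitrary: q)
  case 0
  obtain r where r: "r \<noteq> 0" "jacobi_poly 0 a b = smult r (rodrigues 0 a b)"
    using jacobi_poly_rodrigues[OF ab, of 0] by blast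
  obtain u where "q = [:u:]" using 0 by (auto elim: degree_eq_zeroE)
  hence "q = smult (u / r) (jacobi_poly 0 a b)" using r by (simp add: one_pCons)
  thus ?case by (intro exI[of _ "\<lambda>_. u / r"]) simp
next
  case (Suc n)
  define p where "p = jacobi_poly (Suc n) a b"
  have degp: "degree p = Suc n" by (simp add: p_def degree_jacobi_poly[OF ab])
  hence lc: "coeff p (Suc n) \<noteq> 0" using leading_coeff_0_iff[of p] by auto
  define u where "u = coeff q (Suc n) / coeff p (Suc n)"
  have "degree (q - smult u p) \<le> n"
  proof (rule degree_le, intro allI impI)
    fix i assume "n < i"
    show "coeff (q - smult u p) i = 0"
    proof (cases "i = Suc n")
      case False
      hence "degree q < i" "degree p < i" using \<open>n < i\<close> Suc.prems degp by auto
      thus ?thesis by (simp add: coeff_eq_0)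
    qed (simp add: u_def lc)
  qed
  from Suc.IH[OF this] obtain c where c: "q - smult u p = (\<Sum>k\<le>n. smult (c k) (jacobi_poly k a b))" ..
  have "q = (\<Sum>k\<le>Suc n. smult ((c(Suc n := u)) k) (jacobi_poly k a b))"
    using c by (simp add: p_def algebra_simps)
  thus ?case by blast
qed

text \<open>On polynomials of degree at most \<open>n\<close> this norm dominates the sup norm on \<open>[-1, 1]\<close> and, in contrast
  to it, is easily controlled under differentiation.\<close>

definition coeff_norm :: "nat \<Rightarrow> real poly \<Rightarrow> real" where
  "coeff_norm n q = (\<Sum>i\<le>n. \<bar>coeff q i\<bar>)"

lemma coeff_norm_Suc: "degree q \<le> n \<Longrightarrow> coeff_norm (Suc n) q = coeff_norm n q"
  by (simp add: coeff_norm_def coeff_eq_0)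

lemma coeff_norm_add: "coeff_norm n (p + q) \<le> coeff_norm n p + coeff_norm n q"
  by (simp add: coeff_norm_def sum.distrib[symmetric] sum_mono)

lemma coeff_norm_smult: "coeff_norm n (smult c q) = \<bar>c\<bar> * coeff_norm n q"
  by (simp add: coeff_norm_def abs_mult sum_distrib_left)

lemma coeff_norm_pCons_0: "coeff_norm (Suc n) (pCons 0 q) = coeff_norm n q"
  unfolding coeff_norm_def by (subst sum.atMost_Suc_shift) simp

lemma coeff_norm_mono: "m \<le> n \<Longrightarrow> coeff_norm m q \<le> coeff_norm n q"
  unfolding coeff_norm_def by (intro sum_mono2) auto

lemma coeff_norm_nonneg: "0 \<le> coeff_norm n q"
  by (simp add: coeff_norm_def sum_nonneg)

lemma coeff_norm_pderiv:
  assumes "degree q \<le> n"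
  shows "coeff_norm n (pderiv q) \<le> real n * coeff_norm n q"
proof -
  have "coeff_norm n (pderiv q) = (\<Sum>i\<le>n. real (Suc i) * \<bar>coeff q (Suc i)\<bar>)"
    by (simp add: coeff_norm_def coeff_pderiv abs_mult)
  also have "\<dots> = (\<Sum>i\<le>Suc n. real i * \<bar>coeff q i\<bar>)"
    by (subst sum.atMost_Suc_shift) simp
  also have "\<dots> = (\<Sum>i\<le>n. real i * \<bar>coeff q i\<bar>)"
    using assms by (simp add: coeff_eq_0)
  also have "\<dots> \<le> (\<Sum>i\<le>n. real n * \<bar>coeff q i\<bar>)"
    by (intro sum_mono mult_right_mono) auto
  finally show ?thesis by (simp add: coeff_norm_def sum_distrib_left)
qed

lemma coeff_norm_jstep:
  assumes q: "degree q \<le> n"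
  shows "coeff_norm (Suc n) (jstep a b q) \<le> (2 * real n + \<bar>b - a\<bar> + \<bar>a + b + 2\<bar>) * coeff_norm n q"
proof -
  have dp: "degree (pderiv q) \<le> n" using q by (simp add: degree_pderiv)
  have eq: "jstep a b q = (pderiv q + pCons 0 (pCons 0 (smult (-1) (pderiv q))))
      + (smult (b - a) q + pCons 0 (smult (- (a + b + 2)) q))"
    by (simp add: jstep_def)
  have "coeff_norm (Suc n) (pCons 0 (pCons 0 (smult (-1) (pderiv q)))) = coeff_norm n (pCons 0 (smult (-1) (pderiv q)))"
    by (rule coeff_norm_pCons_0)
  also have "\<dots> \<le> coeff_norm (Suc n) (pCons 0 (smult (-1) (pderiv q)))" by (rule coeff_norm_mono) simp
  also have "\<dots> = coeff_norm n (pderiv q)"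
    unfolding coeff_norm_pCons_0 coeff_norm_smult by simp
  finally have 1: "coeff_norm (Suc n) (pCons 0 (pCons 0 (smult (-1) (pderiv q)))) \<le> coeff_norm n (pderiv q)" .
  have 2: "coeff_norm (Suc n) (pderiv q) = coeff_norm n (pderiv q)" by (rule coeff_norm_Suc[OF dp])
  have 3: "coeff_norm (Suc n) (smult (b - a) q) = \<bar>b - a\<bar> * coeff_norm n q"
    unfolding coeff_norm_smult coeff_norm_Suc[OF q] ..
  have 4: "coeff_norm (Suc n) (pCons 0 (smult (- (a + b + 2)) q)) = \<bar>a + b + 2\<bar> * coeff_norm n q"
    unfolding coeff_norm_pCons_0 coeff_norm_smult by (simp only: abs_minus_cancel)
  have "coeff_norm (Suc n) (jstep a b q) \<le> (coeff_norm n (pderiv q) + coeff_norm n (pderiv q)) +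
      (\<bar>b - a\<bar> * coeff_norm n q + \<bar>a + b + 2\<bar> * coeff_norm n q)"
    unfolding eq using 1 2 3 4
    by (intro order_trans[OF coeff_norm_add] add_mono) auto
  thus ?thesis using coeff_norm_pderiv[OF q] by (simp add: algebra_simps)
qed

lemma coeff_norm_rodrigues:
  "coeff_norm n (rodrigues n a b) \<le> (2 * (\<bar>a\<bar> + \<bar>b\<bar>) + 4 * real n) ^ n"
proof (induction n arbitrary: a b)
  case (Suc n)
  let ?B = "2 * (\<bar>a\<bar> + \<bar>b\<bar>) + 4 * real (Suc n)"
  have "2 * real n + \<bar>b - a\<bar> + \<bar>a + b + 2\<bar> \<le> ?B"
    using abs_triangle_ineq4[of b a] abs_triangle_ineq[of "a + b" 2] abs_triangle_ineq[of a b] by simp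
  hence "(2 * real n + \<bar>b - a\<bar> + \<bar>a + b + 2\<bar>) * coeff_norm n (rodrigues n (a + 1) (b + 1)) \<le>
      ?B * coeff_norm n (rodrigues n (a + 1) (b + 1))"
    by (intro mult_right_mono coeff_norm_nonneg)
  hence "coeff_norm (Suc n) (rodrigues (Suc n) a b) \<le> ?B * coeff_norm n (rodrigues n (a + 1) (b + 1))"
    using coeff_norm_jstep[OF degree_rodrigues_le, of n a b "a + 1" "b + 1"] by simp
  also have "?B * coeff_norm n (rodrigues n (a + 1) (b + 1)) \<le> ?B * (2 * (\<bar>a + 1\<bar> + \<bar>b + 1\<bar>) + 4 * real n) ^ n"
    by (intro mult_left_mono Suc.IH) simp
  also have "\<dots> \<le> ?B * ?B ^ n"
    using abs_triangle_ineq[of a 1] abs_triangle_ineq[of b 1]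
    by (intro mult_left_mono power_mono) auto
  finally show ?case by simp
qed (simp add: coeff_norm_def)

lemma poly_le_coeff_norm:
  assumes "degree q \<le> n" "x \<in> {-1..1}"
  shows "\<bar>poly q x\<bar> \<le> coeff_norm n q"
proof -
  have "poly q x = (\<Sum>i\<le>n. coeff q i * x ^ i)"
    unfolding poly_altdef using assms(1)
    by (intro sum.mono_neutral_left) (auto simp: coeff_eq_0)
  also have "\<bar>\<dots>\<bar> \<le> (\<Sum>i\<le>n. \<bar>coeff q i\<bar> * 1)"
  proof (intro order_trans[OF sum_abs] sum_mono)
    fix i
    have "\<bar>x\<bar> ^ i \<le> 1" using assms(2) by (intro power_le_one) auto
    thus "\<bar>coeff q i * x ^ i\<bar> \<le> \<bar>coeff q i\<bar> * 1"
      unfolding abs_mult power_abs by (rule mult_left_mono) simp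
  qed
  finally show ?thesis by (simp add: coeff_norm_def)
qed

lemma pderiv_funpow_monom: "(pderiv ^^ n) (monom (1::real) n) = [:fact n:]"
proof -
  have "k \<le> n \<Longrightarrow> (pderiv ^^ k) (monom (1::real) n) = monom (fact n / fact (n - k)) (n - k)" for k
  proof (induction k)
    case (Suc k)
    have "(fact (n - k) :: real) = real (n - k) * fact (n - Suc k)"
      using Suc.prems by (subst fact_reduce) auto
    thus ?case using Suc by (simp add: pderiv_monom)
  qed simp
  from this[of n] show ?thesis by (simp add: monom_0)
qed

lemma jint_shift: "jint (a + real n) (b + real n) f = jint a b (\<lambda>x. (1 - x\<^sup>2) ^ n * f x)"
proof (induction n arbitrary: f)
  case (Suc n)
  have "jint (a + real (Suc n)) (b + real (Suc n)) f = jint (a + real n + 1) (b + real n + 1) f"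
    by (simp add: add_ac)
  thus ?case by (simp add: jint_Suc Suc mult_ac)
qed simp

text \<open>Let \<open>R\<close> be the unnormalised polynomial and \<open>s R\<close> the normalised one. The bound on the coefficients
  of \<open>R\<close> leaves \<open>s\<close> to be estimated. Testing \<open>s R\<close>, which has norm one, against \<open>x\<^sup>n\<close> gives a quantity
  that is bounded above independently of \<open>n\<close>, while by \<open>jint_rodrigues\<close> it equals \<open>s n!\<close> times the
  integral of \<open>(1 - x\<^sup>2)\<^sup>n\<close>, up to sign; that integral is at least of order \<open>(3/4)\<^sup>n\<close>.\<close>

lemma jacobi_poly_bound:
  assumes ab: "a > -1" "b > -1"
  shows "\<exists>C D. C > 0 \<and> D > 0 \<and> (\<forall>n. \<forall>x\<in>{-1..1}. \<bar>poly (jacobi_poly n a b) x\<bar> \<le> C * (D * real (n + 1)) ^ n)"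
proof -
  define w where "w = jint a b (\<lambda>x. max 0 (1 - 4 * x\<^sup>2))"
  have w: "w > 0" unfolding w_def
    by (rule jint_pos[OF ab, where ?x0.0 = 0]) (auto intro!: continuous_intros)
  define D where "D = 4 / 3 * (2 * (\<bar>a\<bar> + \<bar>b\<bar>) + 4)"
  define C where "C = (jint a b (\<lambda>_. 1) + jmass a b) / (2 * w)"
  have J1: "jint a b (\<lambda>_. 1) > 0" by (rule jint_pos[OF ab, where ?x0.0 = 0]) auto
  have C: "C > 0" using J1 jmass_pos[OF ab] w by (simp add: C_def)
  have "\<bar>poly (jacobi_poly n a b) x\<bar> \<le> C * (D * real (n + 1)) ^ n" if x: "x \<in> {-1..1}" for n x
  proof -
    obtain s where s: "jacobi_poly n a b = smult s (rodrigues n a b)"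
       "jint a b (\<lambda>x. (poly (jacobi_poly n a b) x)\<^sup>2) = jmass a b"
      using jacobi_poly_rodrigues[OF ab, of n] by blast
    let ?p = "poly (jacobi_poly n a b)"
    have "jint a b (\<lambda>x. x ^ n * ?p x) = s * jint a b (\<lambda>x. poly (monom 1 n) x * poly (rodrigues n a b) x)"
      by (simp add: s poly_monom mult.left_commute jint_cmult)
    also have "jint a b (\<lambda>x. poly (monom 1 n) x * poly (rodrigues n a b) x)
        = (-1) ^ n * fact n * jint a b (\<lambda>x. (1 - x\<^sup>2) ^ n)"
      using jint_cmult[of a b "fact n" "\<lambda>x. (1 - x\<^sup>2) ^ n"]
      by (simp add: jint_rodrigues[OF ab] pderiv_funpow_monom jint_shift mult_ac)
    finally have eq: "\<bar>jint a b (\<lambda>x. x ^ n * ?p x)\<bar> = \<bar>s\<bar> * (fact n * \<bar>jint a b (\<lambda>x. (1 - x\<^sup>2) ^ n)\<bar>)"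
      by (simp add: abs_mult)
    have "(3/4) ^ n * w = jint a b (\<lambda>x. (3/4) ^ n * max 0 (1 - 4 * x\<^sup>2))"
      unfolding w_def jint_cmult ..
    also have "\<dots> \<le> jint a b (\<lambda>x. (1 - x\<^sup>2) ^ n)"
    proof (rule jint_mono[OF ab])
      fix x :: real assume x: "x \<in> {-1..1}"
      show "(3/4) ^ n * max 0 (1 - 4 * x\<^sup>2) \<le> (1 - x\<^sup>2) ^ n"
      proof (cases "4 * x\<^sup>2 \<le> 1")
        case True
        hence "(3/4) ^ n \<le> (1 - x\<^sup>2) ^ n" by (intro power_mono) auto
        moreover have "max 0 (1 - 4 * x\<^sup>2) \<le> 1" by simp
        ultimately have "(3/4) ^ n * max 0 (1 - 4 * x\<^sup>2) \<le> (1 - x\<^sup>2) ^ n * 1"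
          by (intro mult_mono) (use True in auto)
        thus ?thesis by simp
      next
        case False
        moreover have "x\<^sup>2 \<le> 1" using x by (simp add: abs_square_le_1 abs_le_iff)
        ultimately show ?thesis by simp
      qed
    qed (auto intro!: continuous_intros)
    finally have lo: "(3/4) ^ n * w \<le> jint a b (\<lambda>x. (1 - x\<^sup>2) ^ n)" .
    have cp: "continuous_on {-1..1} (\<lambda>x. x ^ n * ?p x)" "continuous_on {-1..1} (\<lambda>x. (1 + (?p x)\<^sup>2) / 2)"
      by (auto intro!: continuous_intros)
    have ub: "jint a b (\<lambda>x. (1 + (?p x)\<^sup>2) / 2) = (jint a b (\<lambda>_. 1) + jmass a b) / 2"
    proof -
      have "continuous_on {-1..1} (\<lambda>x. (?p x)\<^sup>2)" by (intro continuous_intros)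
      hence "jint a b (\<lambda>x. 1 + (?p x)\<^sup>2) = jint a b (\<lambda>_. 1) + jmass a b"
        using jint_add[OF ab, of "\<lambda>_. 1" "\<lambda>x. (?p x)\<^sup>2"] s(2) by simp
      thus ?thesis using jint_cmult[of a b "1/2" "\<lambda>x. 1 + (?p x)\<^sup>2"] by simp
    qed
    \<comment> \<open>replaces the Cauchy--Schwarz inequality: the normalised polynomial has fixed norm, so a sum of squares is as good\<close>
    have young: "\<bar>x ^ n * y\<bar> \<le> (1 + y\<^sup>2) / 2" if "x \<in> {-1..1}" for x y :: real
    proof -
      have "\<bar>x ^ n\<bar> \<le> 1" using that by (auto simp: power_abs abs_le_iff intro!: power_le_one)
      hence "\<bar>x ^ n * y\<bar> \<le> 1 * \<bar>y\<bar>" unfolding abs_mult by (intro mult_right_mono) auto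
      moreover have "0 \<le> (1 - \<bar>y\<bar>)\<^sup>2" by simp
      ultimately show ?thesis by (simp add: power2_eq_square algebra_simps)
    qed
    have "jint a b (\<lambda>x. x ^ n * ?p x) \<le> jint a b (\<lambda>x. (1 + (?p x)\<^sup>2) / 2)"
      by (intro jint_mono[OF ab] cp) (rule order_trans[OF abs_ge_self young])
    moreover have "jint a b (\<lambda>x. (-1) * ((1 + (?p x)\<^sup>2) / 2)) \<le> jint a b (\<lambda>x. x ^ n * ?p x)"
    proof (rule jint_mono[OF ab _ cp(1)])
      show "continuous_on {-1..1} (\<lambda>x. (-1) * ((1 + (?p x)\<^sup>2) / 2))" by (auto intro!: continuous_intros)
      show "(-1) * ((1 + (?p x)\<^sup>2) / 2) \<le> x ^ n * ?p x" if "x \<in> {-1..1}" for x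
        using young[OF that, of "?p x"] by (simp add: abs_le_iff)
    qed
    ultimately have "\<bar>jint a b (\<lambda>x. x ^ n * ?p x)\<bar> \<le> (jint a b (\<lambda>_. 1) + jmass a b) / 2"
      unfolding jint_cmult ub by (simp add: abs_le_iff)
    moreover have "\<bar>s\<bar> * (1 * ((3/4) ^ n * w)) \<le> \<bar>s\<bar> * (fact n * \<bar>jint a b (\<lambda>x. (1 - x\<^sup>2) ^ n)\<bar>)"
      using lo w by (intro mult_left_mono mult_mono) auto
    ultimately have "\<bar>s\<bar> * ((3/4) ^ n * w) \<le> (jint a b (\<lambda>_. 1) + jmass a b) / 2"
      unfolding eq by simp
    hence "\<bar>s\<bar> \<le> C * (4/3) ^ n"
      using w by (simp add: C_def field_simps power_divide)
    moreover have "\<bar>poly (rodrigues n a b) x\<bar> \<le> ((2 * (\<bar>a\<bar> + \<bar>b\<bar>) + 4) * real (n + 1)) ^ n"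
    proof -
      have "\<bar>poly (rodrigues n a b) x\<bar> \<le> (2 * (\<bar>a\<bar> + \<bar>b\<bar>) + 4 * real n) ^ n"
        using poly_le_coeff_norm[OF degree_rodrigues_le x] coeff_norm_rodrigues by (rule order_trans)
      also have "\<dots> \<le> ((2 * (\<bar>a\<bar> + \<bar>b\<bar>) + 4) * real (n + 1)) ^ n"
        by (intro power_mono) (auto simp: algebra_simps)
      finally show ?thesis .
    qed
    ultimately have "\<bar>s\<bar> * \<bar>poly (rodrigues n a b) x\<bar> \<le> C * (4/3) ^ n * ((2 * (\<bar>a\<bar> + \<bar>b\<bar>) + 4) * real (n + 1)) ^ n"
      using C by (intro mult_mono) auto
    also have "C * (4/3) ^ n * ((2 * (\<bar>a\<bar> + \<bar>b\<bar>) + 4) * real (n + 1)) ^ n = C * (D * real (n + 1)) ^ n"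
      unfolding D_def by (simp only: power_mult_distrib mult.assoc)
    finally show ?thesis by (simp add: s(1) abs_mult)
  qed
  moreover have "D > 0" by (simp add: D_def add_nonneg_pos)
  ultimately show ?thesis using C by blast
qed

definition jsup :: "nat \<Rightarrow> real \<Rightarrow> real \<Rightarrow> real" where
  "jsup n a b = (SUP x\<in>{-1..1}. \<bar>poly (jacobi_poly n a b) x\<bar>)"

lemma jacobi_poly_le_jsup:
  assumes "x \<in> {-1..1}"
  shows "\<bar>poly (jacobi_poly n a b) x\<bar> \<le> jsup n a b"
  unfolding jsup_def
proof (rule cSUP_upper[OF assms])
  have "compact ((\<lambda>x. \<bar>poly (jacobi_poly n a b) x\<bar>) ` {-1..1})"
    by (intro compact_continuous_image) (auto intro!: continuous_intros)
  thus "bdd_above ((\<lambda>x. \<bar>poly (jacobi_poly n a b) x\<bar>) ` {-1..1})"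
    by (intro bounded_imp_bdd_above compact_imp_bounded)
qed

lemma jsup_nonneg: "0 \<le> jsup n a b"
  using jacobi_poly_le_jsup[of 0 n a b] by simp

text \<open>The eigenvalues grow like \<open>n\<^sup>2\<close> but the logarithm of the sup norm only like \<open>n log n\<close>.\<close>

lemma summable_jsup:
  assumes ab: "a > -1" "b > -1" and s: "s > 0"
  shows "summable (\<lambda>n. exp (- jeigenvalue a b n * s) * (jsup n a b)\<^sup>2)"
proof -
  obtain C D where CD: "C > 0" "D > 0"
    "\<And>n x. x \<in> {-1..1} \<Longrightarrow> \<bar>poly (jacobi_poly n a b) x\<bar> \<le> C * (D * real (n + 1)) ^ n"
    using jacobi_poly_bound[OF ab] by blast
  have sup: "jsup n a b \<le> C * (D * real (n + 1)) ^ n" for n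
    unfolding jsup_def by (rule cSUP_least) (use CD(3) in auto)
  have "(\<lambda>n. exp (- (real n - 1) * s) * (D * real (n + 1))\<^sup>2) \<longlonglongrightarrow> 0"
    using s CD(2) by real_asymp
  hence "eventually (\<lambda>n. exp (- (real n - 1) * s) * (D * real (n + 1))\<^sup>2 < 1/2) sequentially"
    by (rule order_tendstoD) simp
  hence "eventually (\<lambda>n. norm (exp (- jeigenvalue a b n * s) * (jsup n a b)\<^sup>2) \<le> C\<^sup>2 * (1/2) ^ n) sequentially"
  proof eventually_elim
    case (elim n)
    have "real n * (real n - 1) \<le> jeigenvalue a b n"
      unfolding jeigenvalue_def using ab by (intro mult_left_mono) auto
    hence "exp (- jeigenvalue a b n * s) \<le> exp (- (real n * (real n - 1)) * s)"
      using s by simp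
    also have "\<dots> = exp (- (real n - 1) * s) ^ n"
      by (simp add: exp_of_nat_mult[symmetric] algebra_simps)
    finally have "exp (- jeigenvalue a b n * s) * (jsup n a b)\<^sup>2 \<le>
        exp (- (real n - 1) * s) ^ n * (C * (D * real (n + 1)) ^ n)\<^sup>2"
      using sup jsup_nonneg by (intro mult_mono power_mono) auto
    also have "\<dots> = C\<^sup>2 * (exp (- (real n - 1) * s) * (D * real (n + 1))\<^sup>2) ^ n"
      by (simp add: power_mult_distrib power_mult[symmetric] mult_ac)
    also have "\<dots> \<le> C\<^sup>2 * (1/2) ^ n"
      using elim by (intro mult_left_mono power_mono) auto
    finally show ?case by simp
  qed
  moreover have "summable (\<lambda>n. C\<^sup>2 * (1/2::real) ^ n)"
    by (intro summable_mult summable_geometric) simp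
  ultimately show ?thesis by (rule summable_comparison_test_ev)
qed

section \<open>The Jacobi measure as a product measure\<close>

lemma prod_Basis_vec:
  fixes f :: "real^'d \<Rightarrow> 'b::comm_monoid_mult"
  shows "(\<Prod>b\<in>Basis. f b) = (\<Prod>i\<in>UNIV. f (axis i 1))"
proof -
  have B: "Basis = range (\<lambda>i. axis i 1 :: real^'d)" by (auto simp: Basis_vec_def)
  moreover have "inj (\<lambda>i. axis i 1 :: real^'d)" by (auto simp: inj_on_def axis_eq_axis)
  ultimately show ?thesis unfolding B by (subst prod.reindex) simp_all
qed

lemma measurable_vec_lambda [measurable]:
  assumes "\<And>i. sets (M i) = sets (borel :: real measure)"
  shows "(\<lambda>g. \<chi> i. g i) \<in> measurable (PiM (UNIV :: 'd::finite set) M) (borel :: (real^'d) measure)"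
proof -
  have [measurable]: "(\<lambda>g. g i) \<in> borel_measurable (PiM UNIV M)" for i :: 'd
    using measurable_component_singleton[of i UNIV M] assms[of i] by (simp cong: measurable_cong_sets)
  show ?thesis
    by (subst borel_measurable_euclidean_space) (auto simp: Basis_vec_def inner_axis)
qed

text \<open>Lebesgue measure on \<open>real^'d\<close> as a product indexed by the coordinates, which is the form in which
  Fubini's theorem and products of one-dimensional functions can be used.\<close>

lemma lborel_vec:
  "distr (PiM UNIV (\<lambda>_. lborel)) borel (\<lambda>g. \<chi> i. g i) = (lborel :: (real^'d::finite) measure)"
proof (rule lborel_eqI[symmetric])
  interpret product_sigma_finite "\<lambda>_::'d. lborel :: real measure"
    by (simp add: product_sigma_finite_def lborel.sigma_finite_measure_axioms)
  fix l u :: "real^'d"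
  assume lu: "\<And>b. b \<in> Basis \<Longrightarrow> l \<bullet> b \<le> u \<bullet> b"
  have lu': "l $ i \<le> u $ i" for i using lu[of "axis i 1"] by (simp add: inner_axis axis_in_Basis_iff)
  have "emeasure (distr (PiM UNIV (\<lambda>_. lborel)) borel (\<lambda>g. \<chi> i. g i)) (box l u) =
      emeasure (PiM UNIV (\<lambda>_. lborel)) ((\<lambda>g. \<chi> i. g i) -` box l u \<inter> space (PiM UNIV (\<lambda>_. lborel)))"
    by (intro emeasure_distr) auto
  also have "(\<lambda>g. \<chi> i. g i) -` box l u \<inter> space (PiM UNIV (\<lambda>_. lborel)) = PiE UNIV (\<lambda>i. {l $ i<..<u $ i})"
    by (auto simp: space_PiM mem_box_cart PiE_def extensional_def Pi_iff)
  also have "emeasure (PiM UNIV (\<lambda>_. lborel)) \<dots> = (\<Prod>i\<in>UNIV. emeasure lborel {l $ i<..<u $ i})"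
    by (intro emeasure_PiM) auto
  also have "\<dots> = ennreal (\<Prod>i\<in>UNIV. u $ i - l $ i)"
    using lu' by (simp add: prod_ennreal)
  also have "(\<Prod>i\<in>UNIV. u $ i - l $ i) = (\<Prod>b\<in>Basis. (u - l) \<bullet> b)"
    by (simp add: prod_Basis_vec inner_axis)
  finally show "emeasure (distr (PiM UNIV (\<lambda>_. lborel)) borel (\<lambda>g. \<chi> i. g i)) (box l u) = (\<Prod>b\<in>Basis. (u - l) \<bullet> b)" .
qed simp

lemma density_PiM:
  assumes "finite I" "\<And>i. sigma_finite_measure (M i)" "\<And>i. sigma_finite_measure (density (M i) (w i))"
    and w: "\<And>i. w i \<in> borel_measurable (M i)"
  shows "density (PiM I M) (\<lambda>g. \<Prod>i\<in>I. w i (g i)) = PiM I (\<lambda>i. density (M i) (w i))"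
proof -
  interpret M: product_sigma_finite M
    using assms(2) by (simp add: product_sigma_finite_def)
  interpret D: product_sigma_finite "\<lambda>i. density (M i) (w i)"
    using assms(3) by (simp add: product_sigma_finite_def)
  note [measurable] = w
  have [measurable]: "(\<lambda>g. \<Prod>i\<in>I. w i (g i)) \<in> borel_measurable (PiM I M)"
    by (intro borel_measurable_prod_ennreal) auto
  show ?thesis
  proof (rule D.PiM_eqI[OF assms(1)])
    show "sets (density (PiM I M) (\<lambda>g. \<Prod>i\<in>I. w i (g i))) = sets (PiM I (\<lambda>i. density (M i) (w i)))"
      by (simp cong: sets_PiM_cong)
    fix A assume A: "\<And>i. i \<in> I \<Longrightarrow> A i \<in> sets (density (M i) (w i))"
    hence A': "\<And>i. i \<in> I \<Longrightarrow> A i \<in> sets (M i)" by simp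
    have [measurable]: "Pi\<^sub>E I A \<in> sets (PiM I M)" using A' assms(1) by (intro sets_PiM_I_finite) auto
    have "emeasure (density (PiM I M) (\<lambda>g. \<Prod>i\<in>I. w i (g i))) (Pi\<^sub>E I A) =
        (\<integral>\<^sup>+g. (\<Prod>i\<in>I. w i (g i)) * indicator (Pi\<^sub>E I A) g \<partial>PiM I M)"
      by (subst emeasure_density) auto
    also have "\<dots> = (\<integral>\<^sup>+g. (\<Prod>i\<in>I. w i (g i) * indicator (A i) (g i)) \<partial>PiM I M)"
    proof (rule nn_integral_cong)
      fix g assume "g \<in> space (PiM I M)"
      hence "indicator (Pi\<^sub>E I A) g = (\<Prod>i\<in>I. indicator (A i) (g i) :: ennreal)"
        using assms(1) by (auto simp: indicator_def space_PiM PiE_def prod_zero_iff intro!: prod.neutral)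
      thus "(\<Prod>i\<in>I. w i (g i)) * indicator (Pi\<^sub>E I A) g = (\<Prod>i\<in>I. w i (g i) * indicator (A i) (g i))"
        by (simp add: prod.distrib)
    qed
    also have "\<dots> = (\<Prod>i\<in>I. \<integral>\<^sup>+x. w i x * indicator (A i) x \<partial>M i)"
      using A' assms(1) by (intro M.product_nn_integral_prod) auto
    also have "\<dots> = (\<Prod>i\<in>I. emeasure (density (M i) (w i)) (A i))"
      using A' by (intro prod.cong refl) (simp add: emeasure_density)
    finally show "emeasure (density (PiM I M) (\<lambda>g. \<Prod>i\<in>I. w i (g i))) (Pi\<^sub>E I A) =
        (\<Prod>i\<in>I. emeasure (density (M i) (w i)) (A i))" .
  qed
qed

text \<open>The one-dimensional Jacobi measure as a measure on the whole line: products of measures are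
  easier to handle when all factors live on the full Borel space.\<close>

definition jacobi_line_measure :: "real \<Rightarrow> real \<Rightarrow> real measure" where
  "jacobi_line_measure a b = density lborel (\<lambda>x. ennreal (indicator {-1..1} x * jacobi_density a b x))"

lemma jacobi_density_nonneg: "a > -1 \<Longrightarrow> b > -1 \<Longrightarrow> 0 \<le> jacobi_density a b x"
  using jmass_pos[of a b] jweight_nonneg[of a b x] by (simp add: jacobi_density_eq)

lemma jacobi_density_measurable [measurable]: "jacobi_density a b \<in> borel_measurable borel"
  unfolding jacobi_density_def by measurable

lemma sets_jacobi_line_measure [simp, measurable_cong]: "sets (jacobi_line_measure a b) = sets borel"
  by (simp add: jacobi_line_measure_def)

lemma space_jacobi_line_measure [simp]: "space (jacobi_line_measure a b) = UNIV"
  by (simp add: jacobi_line_measure_def)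

lemma integral_jacobi_line_measure:
  assumes "a > -1" "b > -1" and [measurable]: "f \<in> borel_measurable borel"
  shows "(\<integral>x. f x \<partial>jacobi_line_measure a b) = jint a b f / jmass a b"
proof -
  have "(\<integral>x. f x \<partial>jacobi_line_measure a b) = (\<integral>x. (indicator {-1..1} x * jacobi_density a b x) * f x \<partial>lborel)"
    unfolding jacobi_line_measure_def using jacobi_density_nonneg[OF assms(1,2)]
    by (subst integral_density) auto
  also have "(\<lambda>x. (indicator {-1..1} x * jacobi_density a b x) * f x) =
      (\<lambda>x. 1 / jmass a b * (indicator {-1..1} x *\<^sub>R (jweight a b x * f x)))"
    by (simp add: fun_eq_iff jacobi_density_eq)
  also have "(\<integral>x. 1 / jmass a b * (indicator {-1..1} x *\<^sub>R (jweight a b x * f x)) \<partial>lborel) = 1 / jmass a b * jint a b f"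
    unfolding jint_def set_lebesgue_integral_def by (rule integral_mult_right_zero)
  finally show ?thesis by simp
qed

lemma finite_measure_jacobi_line_measure:
  assumes "a > -1" "b > -1"
  shows "finite_measure (jacobi_line_measure a b)"
proof
  have i: "integrable lborel (\<lambda>x. indicator {-1..1} x * jacobi_density a b x)"
    using integrable_divide[OF jweight_integrable[OF assms, unfolded set_integrable_def], of "jmass a b"]
    by (simp add: jacobi_density_eq)
  have "emeasure (jacobi_line_measure a b) (space (jacobi_line_measure a b)) =
      (\<integral>\<^sup>+x. ennreal (indicator {-1..1} x * jacobi_density a b x) \<partial>lborel)"
    by (simp add: jacobi_line_measure_def emeasure_density)
  also have "\<dots> = ennreal (\<integral>x. indicator {-1..1} x * jacobi_density a b x \<partial>lborel)"
    using jacobi_density_nonneg[OF assms] by (intro nn_integral_eq_integral i) auto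
  finally show "emeasure (jacobi_line_measure a b) (space (jacobi_line_measure a b)) \<noteq> \<infinity>" by simp
qed

lemma mem_cube: "x \<in> cube \<longleftrightarrow> (\<forall>i. x $ i \<in> {-1..1})"
  by (simp add: cube_def)

lemma cube_eq_cbox: "(cube :: (real^'d) set) = cbox (-1) 1"
  by (auto simp: cube_def mem_box_cart)

lemma compact_cube: "compact (cube :: (real^'d) set)"
  by (simp add: cube_eq_cbox)

lemma cube_borel [measurable]: "(cube :: (real^'d) set) \<in> sets borel"
  by (simp add: cube_eq_cbox)

locale jacobi =
  fixes \<alpha> \<beta> :: "real^'d"
  assumes \<alpha>: "\<alpha> $ i > -1" and \<beta>: "\<beta> $ i > -1"
begin

abbreviation \<mu> :: "(real^'d) measure" where
  "\<mu> \<equiv> jacobi_measure \<alpha> \<beta>"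

abbreviation \<nu> :: "'d \<Rightarrow> real measure" where
  "\<nu> i \<equiv> jacobi_line_measure (\<alpha> $ i) (\<beta> $ i)"

abbreviation heat :: "real \<Rightarrow> (real^'d \<Rightarrow> real) \<Rightarrow> real^'d \<Rightarrow> real" where
  "heat \<equiv> jacobi_semigroup \<alpha> \<beta>"

abbreviation poisson :: "real \<Rightarrow> (real^'d \<Rightarrow> real) \<Rightarrow> real^'d \<Rightarrow> real" where
  "poisson \<equiv> poisson_jacobi \<alpha> \<beta>"

abbreviation chaos :: "nat \<Rightarrow> (real^'d \<Rightarrow> real) set" where
  "chaos \<equiv> jacobi_chaos \<alpha> \<beta>"

abbreviation gap :: real where
  "gap \<equiv> min_eigenvalue \<alpha> \<beta>"

text \<open>The Jacobi measure, extended by zero outside the cube.\<close>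

definition extended_measure :: "(real^'d) measure" where
  "extended_measure = distr (PiM UNIV \<nu>) borel (\<lambda>g. \<chi> i. g i)"

sublocale \<nu>: finite_measure "\<nu> i" for i
  by (rule finite_measure_jacobi_line_measure[OF \<alpha> \<beta>])

sublocale product_sigma_finite \<nu>
  by (simp add: product_sigma_finite_def \<nu>.sigma_finite_measure_axioms)

lemma extended_measure_density:
  "extended_measure = density lborel (\<lambda>x. ennreal (indicator cube x * (\<Prod>i\<in>UNIV. jacobi_density (\<alpha> $ i) (\<beta> $ i) (x $ i))))"
proof -
  let ?w = "\<lambda>i x. ennreal (indicator {-1..1} x * jacobi_density (\<alpha> $ i) (\<beta> $ i) x)"
  have nn: "0 \<le> jacobi_density (\<alpha> $ i) (\<beta> $ i) x" for i x
    by (rule jacobi_density_nonneg[OF \<alpha> \<beta>])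
  have W: "(\<Prod>i\<in>UNIV. ?w i (x $ i)) = ennreal (indicator cube x * (\<Prod>i\<in>UNIV. jacobi_density (\<alpha> $ i) (\<beta> $ i) (x $ i)))"
    for x :: "real^'d"
  proof -
    have "(indicator cube x :: real) = (\<Prod>i\<in>UNIV. indicator {-1..1} (x $ i))"
      by (auto simp: indicator_def mem_cube intro!: prod.neutral[symmetric])
    thus ?thesis using nn by (subst prod_ennreal) (auto simp: prod.distrib)
  qed
  have [measurable]: "(\<lambda>x. \<Prod>i\<in>UNIV. ?w i (x $ i)) \<in> borel_measurable (borel :: (real^'d) measure)"
    by (intro borel_measurable_prod_ennreal) measurable
  have "extended_measure = distr (density (PiM UNIV (\<lambda>_. lborel)) (\<lambda>g. \<Prod>i\<in>UNIV. ?w i (g i))) borel (\<lambda>g. \<chi> i. g i)"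
    unfolding extended_measure_def jacobi_line_measure_def
    by (subst density_PiM) (auto intro: lborel.sigma_finite_measure_axioms
        simp: \<nu>.sigma_finite_measure_axioms[unfolded jacobi_line_measure_def])
  also have "\<dots> = density (distr (PiM UNIV (\<lambda>_. lborel)) borel (\<lambda>g. \<chi> i. g i)) (\<lambda>x::real^'d. \<Prod>i\<in>UNIV. ?w i (x $ i))"
    by (subst density_distr) auto
  finally show ?thesis by (simp add: lborel_vec W)
qed

lemma sets_extended_measure [simp, measurable_cong]: "sets extended_measure = sets borel"
  by (simp add: extended_measure_def)

lemma space_extended_measure [simp]: "space extended_measure = UNIV"
  by (simp add: extended_measure_def)

lemma jacobi_measure_eq_restrict: "\<mu> = restrict_space extended_measure cube"
proof (rule measure_eqI)
  show "sets \<mu> = sets (restrict_space extended_measure cube)"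
    by (simp add: jacobi_measure_def sets_restrict_space)
  fix A assume "A \<in> sets \<mu>"
  hence "A \<in> sets (restrict_space lborel cube)" by (simp add: jacobi_measure_def)
  hence A: "A \<subseteq> cube" "A \<in> sets borel"
    by (auto simp: sets_restrict_space_iff)
  have [measurable]: "(\<lambda>x. ennreal (\<Prod>i\<in>UNIV. jacobi_density (\<alpha> $ i) (\<beta> $ i) (x $ i))) \<in> borel_measurable (borel :: (real^'d) measure)"
    by measurable
  note [measurable] = A(2)
  have "emeasure \<mu> A = (\<integral>\<^sup>+x. ennreal (\<Prod>i\<in>UNIV. jacobi_density (\<alpha> $ i) (\<beta> $ i) (x $ i)) * indicator A x \<partial>restrict_space lborel cube)"
    unfolding jacobi_measure_def using A
    by (subst emeasure_density) (auto simp: sets_restrict_space_iff intro!: measurable_restrict_space1)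
  also have "\<dots> = (\<integral>\<^sup>+x. ennreal (indicator cube x * (\<Prod>i\<in>UNIV. jacobi_density (\<alpha> $ i) (\<beta> $ i) (x $ i))) * indicator A x \<partial>lborel)"
    using A by (subst nn_integral_restrict_space) (auto intro!: nn_integral_cong simp: indicator_def)
  also have "\<dots> = emeasure extended_measure A"
    unfolding extended_measure_density by (subst emeasure_density) auto
  also have "\<dots> = emeasure (restrict_space extended_measure cube) A"
    using A by (subst emeasure_restrict_space) auto
  finally show "emeasure \<mu> A = emeasure (restrict_space extended_measure cube) A" .
qed

sublocale P: finite_product_sigma_finite \<nu> UNIV
  by standard simp

lemma finite_measure_PiM: "finite_measure (PiM UNIV \<nu>)"
proof
  have "emeasure (PiM UNIV \<nu>) (space (PiM UNIV \<nu>)) = (\<Prod>i\<in>UNIV. emeasure (\<nu> i) (space (\<nu> i)))"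
    unfolding space_PiM by (rule emeasure_PiM) auto
  also have "\<dots> = ennreal (\<Prod>i\<in>UNIV. measure (\<nu> i) (space (\<nu> i)))"
    by (simp add: \<nu>.emeasure_eq_measure prod_ennreal)
  finally show "emeasure (PiM UNIV \<nu>) (space (PiM UNIV \<nu>)) \<noteq> \<infinity>" by simp
qed

sublocale E: finite_measure extended_measure
  unfolding extended_measure_def by (rule finite_measure.finite_measure_distr[OF finite_measure_PiM]) auto

sublocale M: finite_measure \<mu>
  unfolding jacobi_measure_eq_restrict by (rule finite_measure_restrict_space[OF E.finite_measure_axioms]) auto

lemma space_\<mu> [simp]: "space \<mu> = cube"
  by (simp add: jacobi_measure_eq_restrict space_restrict_space)

lemma integral_\<mu>: "(\<integral>x. F x \<partial>\<mu>) = (\<integral>x. indicator cube x * F x \<partial>extended_measure)" for F :: "real^'d \<Rightarrow> real"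
  unfolding jacobi_measure_eq_restrict by (subst integral_restrict_space) auto

lemma integrable_\<mu>: "integrable \<mu> F \<longleftrightarrow> integrable extended_measure (\<lambda>x. indicator cube x * F x)" for F :: "real^'d \<Rightarrow> real"
  unfolding jacobi_measure_eq_restrict by (subst integrable_restrict_space) auto

lemma borel_measurable_\<mu>_iff:
  "F \<in> borel_measurable \<mu> \<longleftrightarrow> (\<lambda>x. indicator cube x * F x) \<in> borel_measurable borel" for F :: "real^'d \<Rightarrow> real"
proof -
  have "F \<in> borel_measurable \<mu> \<longleftrightarrow> (\<lambda>x. indicator cube x *\<^sub>R F x) \<in> borel_measurable extended_measure"
    unfolding jacobi_measure_eq_restrict by (rule borel_measurable_restrict_space_iff) auto
  thus ?thesis by (simp cong: measurable_cong_sets)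
qed

lemma borel_measurable_\<mu>_continuous:
  "continuous_on cube F \<Longrightarrow> F \<in> borel_measurable \<mu>" for F :: "real^'d \<Rightarrow> real"
  using borel_measurable_continuous_on_indicator[of cube F]
  by (simp add: borel_measurable_\<mu>_iff)

lemma continuous_on_cube_bounded:
  assumes "continuous_on cube (F :: real^'d \<Rightarrow> real)"
  obtains B where "B > 0" "\<And>x. x \<in> cube \<Longrightarrow> \<bar>F x\<bar> \<le> B"
proof -
  have "bounded (F ` cube)"
    by (intro compact_imp_bounded compact_continuous_image assms compact_cube)
  thus thesis using that by (auto simp: bounded_pos)
qed

lemma integrable_\<mu>_continuous:
  assumes "continuous_on cube F"
  shows "integrable \<mu> (F :: real^'d \<Rightarrow> real)"
proof -
  obtain B where "\<And>x. x \<in> cube \<Longrightarrow> \<bar>F x\<bar> \<le> B" using continuous_on_cube_bounded[OF assms] by blast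
  thus ?thesis
    by (intro M.integrable_const_bound[where B = B] AE_I2 borel_measurable_\<mu>_continuous assms) auto
qed

lemma integral_\<mu>_PiM:
  fixes F :: "real^'d \<Rightarrow> real"
  assumes "F \<in> borel_measurable \<mu>"
  shows "(\<integral>x. F x \<partial>\<mu>) = (\<integral>g. indicator cube (\<chi> i. g i) * F (\<chi> i. g i) \<partial>PiM UNIV \<nu>)"
    and "integrable \<mu> F \<longleftrightarrow> integrable (PiM UNIV \<nu>) (\<lambda>g. indicator cube (\<chi> i. g i) * F (\<chi> i. g i))"
proof -
  have [measurable]: "(\<lambda>x. indicator cube x * F x) \<in> borel_measurable borel"
    using assms by (simp add: borel_measurable_\<mu>_iff)
  have [measurable]: "(\<lambda>g. \<chi> i. g i) \<in> measurable (PiM UNIV \<nu>) (borel :: (real^'d) measure)"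
    by (rule measurable_vec_lambda) simp
  show "(\<integral>x. F x \<partial>\<mu>) = (\<integral>g. indicator cube (\<chi> i. g i) * F (\<chi> i. g i) \<partial>PiM UNIV \<nu>)"
    unfolding integral_\<mu> extended_measure_def by (subst integral_distr) auto
  show "integrable \<mu> F \<longleftrightarrow> integrable (PiM UNIV \<nu>) (\<lambda>g. indicator cube (\<chi> i. g i) * F (\<chi> i. g i))"
    unfolding integrable_\<mu> extended_measure_def by (subst integrable_distr_eq) auto
qed

lemma integral_\<mu>_prod:
  assumes f: "\<And>i. continuous_on UNIV (f i)"
  shows "(\<integral>x. (\<Prod>i\<in>UNIV. f i (x $ i)) \<partial>\<mu>) = (\<Prod>i\<in>UNIV. jint (\<alpha> $ i) (\<beta> $ i) (f i) / jmass (\<alpha> $ i) (\<beta> $ i))"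
proof -
  have [measurable]: "f i \<in> borel_measurable borel" for i
    using f by (simp add: borel_measurable_continuous_onI)
  have c: "continuous_on cube (\<lambda>x. \<Prod>i\<in>UNIV. f i (x $ i))"
    by (intro continuous_intros continuous_on_compose2[OF f]) auto
  have "(\<integral>x. (\<Prod>i\<in>UNIV. f i (x $ i)) \<partial>\<mu>) = (\<integral>g. (\<Prod>i\<in>UNIV. indicator {-1..1} (g i) * f i (g i)) \<partial>PiM UNIV \<nu>)"
  proof (subst integral_\<mu>_PiM(1)[OF borel_measurable_\<mu>_continuous[OF c]], intro Bochner_Integration.integral_cong refl)
    fix g :: "'d \<Rightarrow> real"
    have "(indicator cube (\<chi> i. g i) :: real) = (\<Prod>i\<in>UNIV. indicator {-1..1} (g i))"
      by (auto simp: indicator_def mem_cube intro!: prod.neutral[symmetric])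
    thus "indicator cube (\<chi> i. g i) * (\<Prod>i\<in>UNIV. f i ((\<chi> i. g i) $ i)) = (\<Prod>i\<in>UNIV. indicator {-1..1} (g i) * f i (g i))"
      by (simp add: prod.distrib)
  qed
  also have "\<dots> = (\<Prod>i\<in>UNIV. \<integral>x. indicator {-1..1} x * f i x \<partial>\<nu> i)"
  proof (rule product_integral_prod)
    fix i :: 'd
    have "bounded (f i ` {-1..1})"
      by (intro compact_imp_bounded compact_continuous_image continuous_on_subset[OF f]) auto
    then obtain B where "B > 0" "\<And>x. x \<in> {-1..1} \<Longrightarrow> \<bar>f i x\<bar> \<le> B" by (auto simp: bounded_pos)
    thus "integrable (\<nu> i) (\<lambda>x. indicator {-1..1} x * f i x)"
      by (intro \<nu>.integrable_const_bound[where B = B] AE_I2) (auto simp: indicator_def)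
  qed simp
  also have "\<dots> = (\<Prod>i\<in>UNIV. jint (\<alpha> $ i) (\<beta> $ i) (f i) / jmass (\<alpha> $ i) (\<beta> $ i))"
    by (intro prod.cong refl, subst integral_jacobi_line_measure[OF \<alpha> \<beta>])
       (auto intro!: jint_cong arg_cong2[where f = "(/)"])
  finally show ?thesis .
qed

definition slice :: "real^'d \<Rightarrow> 'd \<Rightarrow> real \<Rightarrow> real^'d" where
  "slice x i z = (\<chi> j. if j = i then z else x $ j)"

lemma slice_nth [simp]: "slice x i z $ j = (if j = i then z else x $ j)"
  by (simp add: slice_def)

lemma slice_same [simp]: "slice x i (x $ i) = x"
  by (simp add: vec_eq_iff)

lemma slice_in_cube: "x \<in> cube \<Longrightarrow> z \<in> {-1..1} \<Longrightarrow> slice x i z \<in> cube"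
  by (simp add: mem_cube)

text \<open>Fubini in one coordinate: integrating the \<open>i\<close>-th variable first already gives zero.\<close>

lemma integral_\<mu>_slice_zero:
  assumes F: "continuous_on cube F"
    and z: "\<And>x. x \<in> cube \<Longrightarrow> jint (\<alpha> $ i) (\<beta> $ i) (\<lambda>z. F (slice x i z)) = 0"
  shows "(\<integral>x. F x \<partial>\<mu>) = 0"
proof -
  let ?G = "\<lambda>g. indicator cube (\<chi> i. g i) * F (\<chi> i. g i)"
  have m: "F \<in> borel_measurable \<mu>" by (rule borel_measurable_\<mu>_continuous[OF F])
  have UN: "insert i (UNIV - {i}) = UNIV" by blast
  have "integrable (PiM (insert i (UNIV - {i})) \<nu>) ?G"
    using integrable_\<mu>_continuous[OF F] integral_\<mu>_PiM(2)[OF m] by (simp add: UN)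
  from product_integral_insert[OF _ _ this]
  have "(\<integral>x. F x \<partial>\<mu>) = (\<integral>g. (\<integral>z. ?G (g(i := z)) \<partial>\<nu> i) \<partial>PiM (UNIV - {i}) \<nu>)"
    unfolding integral_\<mu>_PiM(1)[OF m] by (simp add: UN)
  moreover have "(\<integral>z. ?G (g(i := z)) \<partial>\<nu> i) = 0" for g
  proof (cases "\<forall>j. j \<noteq> i \<longrightarrow> g j \<in> {-1..1}")
    case True
    define x :: "real^'d" where "x = (\<chi> j. (g(i := 0)) j)"
    have x: "x \<in> cube" using True by (auto simp: x_def mem_cube)
    have c: "continuous_on {-1..1} (\<lambda>z. F (slice x i z))"
    proof (rule continuous_on_compose2[OF F])
      have "continuous_on {-1..1} (\<lambda>z. if j = i then z else x $ j)" for j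
        by (cases "j = i") (simp_all add: continuous_intros)
      thus "continuous_on {-1..1} (slice x i)"
        unfolding slice_def[abs_def] by (rule continuous_on_vec_lambda)
    qed (auto intro!: slice_in_cube[OF x])
    have [measurable]: "(\<lambda>z. indicator {-1..1} z * F (slice x i z)) \<in> borel_measurable borel"
      using borel_measurable_continuous_on_indicator[OF _ c] by simp
    have "?G (g(i := z)) = indicator {-1..1} z * F (slice x i z)" for z
    proof -
      have "(\<chi> j. (g(i := z)) j) = slice x i z" by (simp add: x_def vec_eq_iff)
      moreover have "slice x i z \<in> cube \<longleftrightarrow> z \<in> {-1..1}"
        using x by (auto simp: mem_cube)
      ultimately show ?thesis by (simp add: indicator_def)
    qed
    hence "(\<integral>z. ?G (g(i := z)) \<partial>\<nu> i) = (\<integral>z. indicator {-1..1} z * F (slice x i z) \<partial>\<nu> i)" by simp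
    also have "\<dots> = jint (\<alpha> $ i) (\<beta> $ i) (\<lambda>z. indicator {-1..1} z * F (slice x i z)) / jmass (\<alpha> $ i) (\<beta> $ i)"
      by (rule integral_jacobi_line_measure[OF \<alpha> \<beta>]) measurable
    also have "jint (\<alpha> $ i) (\<beta> $ i) (\<lambda>z. indicator {-1..1} z * F (slice x i z)) = jint (\<alpha> $ i) (\<beta> $ i) (\<lambda>z. F (slice x i z))"
      by (intro jint_cong) simp
    finally show ?thesis using z[OF x] by simp
  next
    case False
    then obtain j where "j \<noteq> i" "g j \<notin> {-1..1}" by blast
    hence "(\<chi> j. (g(i := z)) j) \<notin> cube" for z by (auto simp: mem_cube intro!: exI[of _ j])
    thus ?thesis by simp
  qed
  ultimately show ?thesis by simp
qed

end

section \<open>Spectral theory on the cube\<close>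

lemma prod_sum_vec:
  fixes f :: "'d::finite \<Rightarrow> 'k \<Rightarrow> 'b::comm_semiring_1"
  assumes "\<And>i. finite (A i)"
  shows "(\<Prod>i\<in>UNIV. \<Sum>k\<in>A i. f i k) = (\<Sum>\<kappa>\<in>{\<kappa>. \<forall>i. \<kappa> $ i \<in> A i}. \<Prod>i\<in>UNIV. f i (\<kappa> $ i))"
    and "finite {\<kappa>::'k^'d. \<forall>i. \<kappa> $ i \<in> A i}"
proof -
  have eq: "{\<kappa>::'k^'d. \<forall>i. \<kappa> $ i \<in> A i} = vec_lambda ` PiE UNIV A"
  proof (intro equalityI subsetI)
    fix \<kappa> :: "'k^'d" assume "\<kappa> \<in> {\<kappa>. \<forall>i. \<kappa> $ i \<in> A i}"
    hence "vec_nth \<kappa> \<in> PiE UNIV A" by auto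
    moreover have "\<kappa> = vec_lambda (vec_nth \<kappa>)" by simp
    ultimately show "\<kappa> \<in> vec_lambda ` PiE UNIV A" by blast
  qed auto
  have inj: "inj_on vec_lambda (PiE UNIV A)"
    by (auto simp: inj_on_def vec_lambda_inject)
  have fin: "finite (PiE UNIV A)" using assms by (intro finite_PiE) auto
  show "finite {\<kappa>::'k^'d. \<forall>i. \<kappa> $ i \<in> A i}" unfolding eq by (rule finite_imageI[OF fin])
  have "(\<Prod>i\<in>UNIV. \<Sum>k\<in>A i. f i k) = (\<Sum>g\<in>PiE UNIV A. \<Prod>i\<in>UNIV. f i (g i))"
    by (rule prod_sum_PiE) (use assms in auto)
  also have "\<dots> = (\<Sum>\<kappa>\<in>vec_lambda ` PiE UNIV A. \<Prod>i\<in>UNIV. f i (\<kappa> $ i))"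
    by (subst sum.reindex[OF inj]) simp
  finally show "(\<Prod>i\<in>UNIV. \<Sum>k\<in>A i. f i k) = (\<Sum>\<kappa>\<in>{\<kappa>. \<forall>i. \<kappa> $ i \<in> A i}. \<Prod>i\<in>UNIV. f i (\<kappa> $ i))"
    unfolding eq .
qed

text \<open>The partial sum over any finite set of indices is dominated by one over a box, which factorises.\<close>

lemma summable_on_prod_vec:
  fixes a :: "'d::finite \<Rightarrow> nat \<Rightarrow> real"
  assumes nn: "\<And>i k. 0 \<le> a i k" and sm: "\<And>i. summable (a i)"
  shows "(\<lambda>\<kappa>::nat^'d. \<Prod>i\<in>UNIV. a i (\<kappa> $ i)) summable_on UNIV"
proof (rule nonneg_bdd_above_summable_on)
  show "0 \<le> (\<Prod>i\<in>UNIV. a i (\<kappa> $ i))" for \<kappa> :: "nat^'d" by (intro prod_nonneg nn)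
  show "bdd_above (sum (\<lambda>\<kappa>::nat^'d. \<Prod>i\<in>UNIV. a i (\<kappa> $ i)) ` {F. F \<subseteq> UNIV \<and> finite F})"
  proof (rule bdd_aboveI2)
    fix F :: "(nat^'d) set" assume "F \<in> {F. F \<subseteq> UNIV \<and> finite F}"
    hence fin: "finite F" by simp
    have "finite ((\<lambda>(\<kappa>, i). \<kappa> $ i) ` (F \<times> (UNIV :: 'd set)))" using fin by simp
    then obtain n where n: "\<forall>m\<in>(\<lambda>(\<kappa>, i). \<kappa> $ i) ` (F \<times> (UNIV :: 'd set)). m \<le> n"
      unfolding finite_nat_set_iff_bounded_le by blast
    have n: "\<kappa> $ i \<le> n" if "\<kappa> \<in> F" for \<kappa> i
      using n[rule_format, of "\<kappa> $ i"] that by force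
    have "(\<Sum>\<kappa>\<in>F. \<Prod>i\<in>UNIV. a i (\<kappa> $ i)) \<le> (\<Sum>\<kappa>\<in>{\<kappa>::nat^'d. \<forall>i. \<kappa> $ i \<in> {..n}}. \<Prod>i\<in>UNIV. a i (\<kappa> $ i))"
      by (intro sum_mono2 prod_sum_vec(2) prod_nonneg nn) (use n in auto)
    also have "\<dots> = (\<Prod>i\<in>UNIV. \<Sum>k\<in>{..n}. a i k)"
      by (rule prod_sum_vec(1)[symmetric]) simp
    also have "\<dots> \<le> (\<Prod>i\<in>UNIV. suminf (a i))"
      by (intro prod_mono conjI sum_nonneg nn sum_le_suminf sm) auto
    finally show "(\<Sum>\<kappa>\<in>F. \<Prod>i\<in>UNIV. a i (\<kappa> $ i)) \<le> (\<Prod>i\<in>UNIV. suminf (a i))" .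
  qed
qed

context jacobi
begin

abbreviation p :: "nat^'d \<Rightarrow> real^'d \<Rightarrow> real" where
  "p \<equiv> jacobi_multi \<alpha> \<beta>"

abbreviation ev :: "nat^'d \<Rightarrow> real" where
  "ev \<equiv> jacobi_eigenvalue \<alpha> \<beta>"

abbreviation p1 :: "'d \<Rightarrow> nat \<Rightarrow> real poly" where
  "p1 i n \<equiv> jacobi_poly n (\<alpha> $ i) (\<beta> $ i)"

definition fourier :: "(real^'d \<Rightarrow> real) \<Rightarrow> nat^'d \<Rightarrow> real" where
  "fourier f \<kappa> = (\<integral>x. f x * p \<kappa> x \<partial>\<mu>)"

definition psup :: "nat^'d \<Rightarrow> real" where
  "psup \<kappa> = (\<Prod>i\<in>UNIV. jsup (\<kappa> $ i) (\<alpha> $ i) (\<beta> $ i))"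

lemma continuous_p [continuous_intros]: "continuous_on A (p \<kappa>)"
  unfolding jacobi_multi_def by (intro continuous_intros)

lemma ev_eq: "ev \<kappa> = (\<Sum>i\<in>UNIV. jeigenvalue (\<alpha> $ i) (\<beta> $ i) (\<kappa> $ i))"
  by (simp add: jacobi_eigenvalue_def jeigenvalue_def)

lemma p_orthonormal: "(\<integral>x. p \<kappa> x * p \<iota> x \<partial>\<mu>) = (if \<kappa> = \<iota> then 1 else 0)"
proof -
  have "(\<integral>x. p \<kappa> x * p \<iota> x \<partial>\<mu>) = (\<integral>x. (\<Prod>i\<in>UNIV. poly (p1 i (\<kappa> $ i)) (x $ i) * poly (p1 i (\<iota> $ i)) (x $ i)) \<partial>\<mu>)"
    by (simp add: jacobi_multi_def prod.distrib)
  also have "\<dots> = (\<Prod>i\<in>UNIV. jint (\<alpha> $ i) (\<beta> $ i) (\<lambda>z. poly (p1 i (\<kappa> $ i)) z * poly (p1 i (\<iota> $ i)) z) / jmass (\<alpha> $ i) (\<beta> $ i))"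
    by (rule integral_\<mu>_prod) (intro continuous_intros)
  also have "\<dots> = (\<Prod>i\<in>UNIV. if \<kappa> $ i = \<iota> $ i then 1 else 0)"
    using jmass_pos[OF \<alpha> \<beta>] by (intro prod.cong refl) (simp add: jacobi_poly_orthonormal[OF \<alpha> \<beta>] less_imp_neq[symmetric])
  also have "\<dots> = (if \<kappa> = \<iota> then 1 else 0)"
    by (auto simp: vec_eq_iff prod_zero_iff)
  finally show ?thesis .
qed

lemma p_le_psup: "x \<in> cube \<Longrightarrow> \<bar>p \<kappa> x\<bar> \<le> psup \<kappa>"
  unfolding jacobi_multi_def psup_def abs_prod
  by (intro prod_mono conjI jacobi_poly_le_jsup) (auto simp: mem_cube)

lemma psup_nonneg: "0 \<le> psup \<kappa>"
  unfolding psup_def by (intro prod_nonneg jsup_nonneg)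

lemma ev_nonneg: "0 \<le> ev \<kappa>"
proof -
  have "0 \<le> real n * (real n + \<alpha> $ i + \<beta> $ i + 1)" for i n
    using \<alpha>[of i] \<beta>[of i] by (cases n) auto
  thus ?thesis unfolding jacobi_eigenvalue_def by (intro sum_nonneg)
qed

lemma ev_0: "ev 0 = 0"
  by (simp add: jacobi_eigenvalue_def)

lemma min_eigenvalue_le: "gap \<le> \<alpha> $ i + \<beta> $ i + 2"
proof -
  have "{\<alpha> $ j + \<beta> $ j + 2 | j. True} = range (\<lambda>j. \<alpha> $ j + \<beta> $ j + 2)" by auto
  thus ?thesis unfolding min_eigenvalue_def by (intro Min_le) auto
qed

lemma min_eigenvalue_pos: "0 < gap"
proof -
  have "{\<alpha> $ j + \<beta> $ j + 2 | j. True} = range (\<lambda>j. \<alpha> $ j + \<beta> $ j + 2)" by auto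
  moreover have "0 < \<alpha> $ j + \<beta> $ j + 2" for j using \<alpha>[of j] \<beta>[of j] by simp
  ultimately show ?thesis unfolding min_eigenvalue_def by (subst Min_gr_iff) auto
qed

text \<open>If \<open>\<kappa>\<^sub>i = n \<ge> 1\<close> then already \<open>n (n + \<alpha>\<^sub>i + \<beta>\<^sub>i + 1) \<ge> \<alpha>\<^sub>i + \<beta>\<^sub>i + 2\<close>.\<close>

lemma min_eigenvalue_le_ev:
  assumes "\<kappa> \<noteq> 0"
  shows "gap \<le> ev \<kappa>"
proof -
  obtain i where i: "\<kappa> $ i \<noteq> 0" using assms by (auto simp: vec_eq_iff)
  have nn: "0 \<le> real n * (real n + \<alpha> $ i + \<beta> $ i + 1)" for i n
    using \<alpha>[of i] \<beta>[of i] by (cases n) auto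
  have "1 * (\<alpha> $ i + \<beta> $ i + 2) \<le> real (\<kappa> $ i) * (real (\<kappa> $ i) + \<alpha> $ i + \<beta> $ i + 1)"
    using i \<alpha>[of i] \<beta>[of i] by (intro mult_mono) auto
  also have "\<dots> \<le> ev \<kappa>"
    unfolding jacobi_eigenvalue_def
    by (rule member_le_sum[of i UNIV "\<lambda>i. real (\<kappa> $ i) * (real (\<kappa> $ i) + \<alpha> $ i + \<beta> $ i + 1)"]) (auto intro: nn)
  finally show ?thesis using min_eigenvalue_le[of i] by simp
qed

text \<open>Uniform absolute convergence of the kernel series: eigenvalues add up over the coordinates and sup
  norms multiply, so the series is a product of one-dimensional ones.\<close>

lemma summable_heat:
  assumes "s > 0"
  shows "(\<lambda>\<kappa>. exp (- ev \<kappa> * s) * (psup \<kappa>)\<^sup>2) summable_on UNIV"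
proof -
  have "(\<lambda>\<kappa>::nat^'d. \<Prod>i\<in>UNIV. exp (- jeigenvalue (\<alpha> $ i) (\<beta> $ i) (\<kappa> $ i) * s) * (jsup (\<kappa> $ i) (\<alpha> $ i) (\<beta> $ i))\<^sup>2) summable_on UNIV"
    by (rule summable_on_prod_vec[where a = "\<lambda>i n. exp (- jeigenvalue (\<alpha> $ i) (\<beta> $ i) n * s) * (jsup n (\<alpha> $ i) (\<beta> $ i))\<^sup>2"])
       (simp, rule summable_jsup[OF \<alpha> \<beta> assms])
  also have "(\<lambda>\<kappa>::nat^'d. \<Prod>i\<in>UNIV. exp (- jeigenvalue (\<alpha> $ i) (\<beta> $ i) (\<kappa> $ i) * s) * (jsup (\<kappa> $ i) (\<alpha> $ i) (\<beta> $ i))\<^sup>2)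
      = (\<lambda>\<kappa>. exp (- ev \<kappa> * s) * (psup \<kappa>)\<^sup>2)"
    by (simp add: fun_eq_iff ev_eq psup_def prod.distrib exp_sum[symmetric] prod_power_distrib[symmetric] sum_negf sum_distrib_right)
  finally show ?thesis .
qed

text \<open>The Jacobi operator applied to a function with gradient \<open>G\<close> and Hessian \<open>H\<close>. Taking these as
  arguments avoids choosing derivatives at the boundary of the cube.\<close>

definition generator :: "(real^'d \<Rightarrow> real^'d) \<Rightarrow> (real^'d \<Rightarrow> real^'d^'d) \<Rightarrow> real^'d \<Rightarrow> real" where
  "generator G H x = (\<Sum>i\<in>UNIV. (1 - (x $ i)\<^sup>2) * H x $ i $ i
     + (\<beta> $ i - \<alpha> $ i - (\<alpha> $ i + \<beta> $ i + 2) * x $ i) * G x $ i)"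

lemma p_slice: "p \<kappa> (slice x i z) = poly (p1 i (\<kappa> $ i)) z * (\<Prod>j\<in>UNIV - {i}. poly (p1 j (\<kappa> $ j)) (x $ j))"
  unfolding jacobi_multi_def by (subst prod.remove[of UNIV i]) auto

lemma slice_eq: "slice x i z = slice x i 0 + z *\<^sub>R axis i 1"
  by (simp add: vec_eq_iff axis_def)

lemma has_derivative_slice: "(slice x i has_derivative (\<lambda>h. h *\<^sub>R axis i 1)) (at z within S)"
proof -
  have "((\<lambda>z. slice x i 0 + z *\<^sub>R axis i 1) has_derivative (\<lambda>h. h *\<^sub>R axis i 1)) (at z within S)"
    by (auto intro!: derivative_eq_intros)
  moreover have "(\<lambda>z. slice x i 0 + z *\<^sub>R axis i 1) = slice x i" by (rule ext) (rule slice_eq[symmetric])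
  ultimately show ?thesis by simp
qed

lemma continuous_slice: "continuous_on S (slice x i)"
  by (rule has_derivative_continuous_on[where f' = "\<lambda>_ h. h *\<^sub>R axis i 1"]) (rule has_derivative_slice)

lemma DERIV_slice:
  assumes f: "\<And>x. x \<in> cube \<Longrightarrow> (f has_derivative f' x) (at x within cube)"
    and x: "x \<in> cube" and z: "z \<in> {-1<..<1}"
  shows "((\<lambda>z. f (slice x i z)) has_real_derivative f' (slice x i z) (axis i 1)) (at z)"
proof -
  have zc: "slice x i z \<in> cube" using slice_in_cube[OF x] z by auto
  have "((\<lambda>z. f (slice x i z)) has_derivative (\<lambda>h. f' (slice x i z) (h *\<^sub>R axis i 1))) (at z within {-1<..<1})"
    by (rule has_derivative_in_compose[OF has_derivative_slice has_derivative_subset[OF f[OF zc]]])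
       (use slice_in_cube[OF x] in auto)
  moreover have "linear (f' (slice x i z))" using f[OF zc] by (rule has_derivative_linear)
  ultimately have "((\<lambda>z. f (slice x i z)) has_derivative (\<lambda>h. f' (slice x i z) (axis i 1) * h)) (at z within {-1<..<1})"
    by (simp add: linear_cmul mult.commute)
  thus ?thesis
    using z by (simp add: has_field_derivative_def at_within_open[of z "{-1<..<1}"])
qed

text \<open>Green's formula in the \<open>i\<close>-th variable shows that the \<open>i\<close>-th part of the operator contributes the
  \<open>i\<close>-th summand of the eigenvalue; the other variables are parameters.\<close>

lemma fourier_generator:
  assumes f: "\<And>x. x \<in> cube \<Longrightarrow> (f has_derivative (\<lambda>h. G x \<bullet> h)) (at x within cube)"
    and G: "\<And>x. x \<in> cube \<Longrightarrow> (G has_derivative (\<lambda>h. H x *v h)) (at x within cube)"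
    and H: "continuous_on cube H"
  shows "fourier (generator G H) \<kappa> = - ev \<kappa> * fourier f \<kappa>"
    and "continuous_on cube (generator G H)" and "continuous_on cube f"
proof -
  show cf: "continuous_on cube f" using f by (rule has_derivative_continuous_on)
  have cG: "continuous_on cube G" using G by (rule has_derivative_continuous_on)
  show cL: "continuous_on cube (generator G H)"
    unfolding generator_def by (intro continuous_intros cG H)
  define T where "T = (\<lambda>i x. (1 - (x $ i)\<^sup>2) * H x $ i $ i
     + (\<beta> $ i - \<alpha> $ i - (\<alpha> $ i + \<beta> $ i + 2) * x $ i) * G x $ i)"
  define F where "F = (\<lambda>i x. (T i x + jeigenvalue (\<alpha> $ i) (\<beta> $ i) (\<kappa> $ i) * f x) * p \<kappa> x)"
  have cT: "continuous_on cube (T i)" for i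
    unfolding T_def by (intro continuous_intros cG H)
  have cF: "continuous_on cube (F i)" for i
    unfolding F_def by (intro continuous_intros cT cf)
  have zero: "(\<integral>x. F i x \<partial>\<mu>) = 0" for i
  proof (rule integral_\<mu>_slice_zero[OF cF])
    fix x :: "real^'d" assume x: "x \<in> cube"
    let ?a = "\<alpha> $ i" and ?b = "\<beta> $ i" and ?q = "p1 i (\<kappa> $ i)" and ?s = "slice x i"
    define c where "c = (\<Prod>j\<in>UNIV - {i}. poly (p1 j (\<kappa> $ j)) (x $ j))"
    have s: "?s ` {-1..1} \<subseteq> cube" using slice_in_cube[OF x] by auto
    have c0: "continuous_on {-1..1} (\<lambda>z. f (?s z))"
      by (rule continuous_on_compose2[OF cf continuous_slice s])
    have c1: "continuous_on {-1..1} (\<lambda>z. G (?s z) $ i)"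
      by (intro continuous_intros continuous_on_compose2[OF cG continuous_slice s])
    have c2: "continuous_on {-1..1} (\<lambda>z. H (?s z) $ i $ i)"
      by (intro continuous_intros continuous_on_compose2[OF H continuous_slice s])
    have d1: "((\<lambda>z. f (?s z)) has_real_derivative G (?s z) $ i) (at z)" if "z \<in> {-1<..<1}" for z
      using DERIV_slice[OF f x that, of i] by (simp add: inner_axis)
    have "((\<lambda>x. G x $ i) has_derivative (\<lambda>h. (H x *v h) $ i)) (at x within cube)" if "x \<in> cube" for x
      by (rule bounded_linear.has_derivative[OF bounded_linear_vec_nth G[OF that]])
    hence d2: "((\<lambda>z. G (?s z) $ i) has_real_derivative H (?s z) $ i $ i) (at z)" if "z \<in> {-1<..<1}" for z
      using DERIV_slice[where f = "\<lambda>x. G x $ i" and f' = "\<lambda>x h. (H x *v h) $ i", OF _ x that, of i]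
      by (simp add: matrix_vector_mult_basis column_def)
    have "jint ?a ?b (\<lambda>z. T i (?s z) * poly ?q z) = jint ?a ?b (\<lambda>z. f (?s z) * poly (jstep ?a ?b (pderiv ?q)) z)"
      using jint_Green[OF \<alpha> \<beta> c0 c1 c2 d1 d2, where p = ?q] by (simp add: T_def)
    also have "\<dots> = - jeigenvalue ?a ?b (\<kappa> $ i) * jint ?a ?b (\<lambda>z. f (?s z) * poly ?q z)"
      by (subst jint_cmult[symmetric]) (simp add: jacobi_poly_eigen[OF \<alpha> \<beta>] mult_ac)
    finally have "jint ?a ?b (\<lambda>z. T i (?s z) * poly ?q z + jeigenvalue ?a ?b (\<kappa> $ i) * (f (?s z) * poly ?q z)) = 0"
      by (subst jint_add[OF \<alpha> \<beta>])
         (auto simp: jint_cmult intro!: continuous_intros c0 continuous_on_compose2[OF cT continuous_slice s])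
    hence "c * jint ?a ?b (\<lambda>z. T i (?s z) * poly ?q z + jeigenvalue ?a ?b (\<kappa> $ i) * (f (?s z) * poly ?q z)) = 0"
      by simp
    thus "jint ?a ?b (\<lambda>z. F i (?s z)) = 0"
      unfolding jint_cmult[symmetric] by (simp add: F_def p_slice c_def algebra_simps)
  qed
  have "(\<integral>x. generator G H x * p \<kappa> x + ev \<kappa> * (f x * p \<kappa> x) \<partial>\<mu>) = (\<integral>x. (\<Sum>i\<in>UNIV. F i x) \<partial>\<mu>)"
  proof (intro Bochner_Integration.integral_cong refl)
    fix x
    have gen: "generator G H x = (\<Sum>i\<in>UNIV. T i x)" by (simp add: generator_def T_def)
    show "generator G H x * p \<kappa> x + ev \<kappa> * (f x * p \<kappa> x) = (\<Sum>i\<in>UNIV. F i x)"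
      unfolding gen ev_eq F_def by (simp add: distrib_right sum.distrib sum_distrib_right mult.assoc)
  qed
  also have "\<dots> = 0"
    by (subst Bochner_Integration.integral_sum) (auto intro: integrable_\<mu>_continuous[OF cF] simp: zero)
  also have "(\<integral>x. generator G H x * p \<kappa> x + ev \<kappa> * (f x * p \<kappa> x) \<partial>\<mu>) = fourier (generator G H) \<kappa> + ev \<kappa> * fourier f \<kappa>"
    unfolding fourier_def
    by (subst Bochner_Integration.integral_add) (auto intro!: integrable_\<mu>_continuous continuous_intros cL cf)
  finally show "fourier (generator G H) \<kappa> = - ev \<kappa> * fourier f \<kappa>" by simp
qed

definition p_span :: "(real^'d \<Rightarrow> real) set" where
  "p_span = {F. \<exists>S c. finite S \<and> F = (\<lambda>x. \<Sum>\<kappa>\<in>S. c \<kappa> * p \<kappa> x)}"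

lemma p_spanI: "finite S \<Longrightarrow> (\<lambda>x. \<Sum>\<kappa>\<in>S. c \<kappa> * p \<kappa> x) \<in> p_span"
  unfolding p_span_def by blast

lemma p_span_0: "(\<lambda>x. 0) \<in> p_span"
  using p_spanI[of "{}"] by simp

lemma p_span_scale:
  assumes "F \<in> p_span"
  shows "(\<lambda>x. a * F x) \<in> p_span"
proof -
  obtain S c where "finite S" "F = (\<lambda>x. \<Sum>\<kappa>\<in>S. c \<kappa> * p \<kappa> x)" using assms unfolding p_span_def by blast
  hence "(\<lambda>x. a * F x) = (\<lambda>x. \<Sum>\<kappa>\<in>S. (a * c \<kappa>) * p \<kappa> x)" by (simp add: sum_distrib_left mult.assoc)
  also have "\<dots> \<in> p_span" by (rule p_spanI[OF \<open>finite S\<close>])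
  finally show ?thesis .
qed

lemma p_span_add:
  assumes "F \<in> p_span" "F' \<in> p_span"
  shows "(\<lambda>x. F x + F' x) \<in> p_span"
proof -
  obtain S c where S: "finite S" "F = (\<lambda>x. \<Sum>\<kappa>\<in>S. c \<kappa> * p \<kappa> x)" using assms(1) unfolding p_span_def by blast
  obtain S' c' where S': "finite S'" "F' = (\<lambda>x. \<Sum>\<kappa>\<in>S'. c' \<kappa> * p \<kappa> x)" using assms(2) unfolding p_span_def by blast
  have eq: "(\<lambda>x. F x + F' x) = (\<lambda>x. \<Sum>\<kappa>\<in>S \<union> S'. ((if \<kappa> \<in> S then c \<kappa> else 0) + (if \<kappa> \<in> S' then c' \<kappa> else 0)) * p \<kappa> x)"
  proof
    fix x
    have "F x = (\<Sum>\<kappa>\<in>S \<union> S'. (if \<kappa> \<in> S then c \<kappa> else 0) * p \<kappa> x)"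
      unfolding S(2) using S(1) S'(1) by (intro sum.mono_neutral_cong_left) auto
    moreover have "F' x = (\<Sum>\<kappa>\<in>S \<union> S'. (if \<kappa> \<in> S' then c' \<kappa> else 0) * p \<kappa> x)"
      unfolding S'(2) using S(1) S'(1) by (intro sum.mono_neutral_cong_left) auto
    ultimately show "F x + F' x = (\<Sum>\<kappa>\<in>S \<union> S'. ((if \<kappa> \<in> S then c \<kappa> else 0) + (if \<kappa> \<in> S' then c' \<kappa> else 0)) * p \<kappa> x)"
      by (simp add: sum.distrib distrib_right)
  qed
  show ?thesis unfolding eq by (rule p_spanI) (use S(1) S'(1) in simp)
qed

lemma p_span_sum: "(\<And>i. i \<in> I \<Longrightarrow> F i \<in> p_span) \<Longrightarrow> (\<lambda>x. \<Sum>i\<in>I. F i x) \<in> p_span"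
  by (induction I rule: infinite_finite_induct) (auto intro: p_span_0 p_span_add)

text \<open>Expand each factor in the one-dimensional Jacobi polynomials and multiply out.\<close>

lemma p_span_prod:
  fixes q :: "'d \<Rightarrow> real poly"
  shows "(\<lambda>x. \<Prod>i\<in>UNIV. poly (q i) (x $ i)) \<in> p_span"
proof -
  have "\<exists>c. q i = (\<Sum>k\<le>degree (q i). smult (c k) (p1 i k))" for i
    by (rule jacobi_poly_expansion[OF \<alpha> \<beta>]) simp
  hence "\<exists>c. \<forall>i. q i = (\<Sum>k\<le>degree (q i). smult (c i k) (p1 i k))" by (intro choice allI)
  then obtain c where c: "\<And>i. q i = (\<Sum>k\<le>degree (q i). smult (c i k) (p1 i k))" by blast
  have q: "poly (q i) z = (\<Sum>k\<le>degree (q i). c i k * poly (p1 i k) z)" for i z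
  proof -
    have "poly (q i) z = poly (\<Sum>k\<le>degree (q i). smult (c i k) (p1 i k)) z" by (subst c) (rule refl)
    thus ?thesis by (simp add: poly_sum)
  qed
  have "(\<lambda>x. \<Prod>i\<in>UNIV. poly (q i) (x $ i)) =
      (\<lambda>x. \<Sum>\<kappa>\<in>{\<kappa>::nat^'d. \<forall>i. \<kappa> $ i \<in> {..degree (q i)}}. (\<Prod>i\<in>UNIV. c i (\<kappa> $ i)) * p \<kappa> x)"
    unfolding q by (subst prod_sum_vec) (auto simp: jacobi_multi_def prod.distrib)
  also have "\<dots> \<in> p_span" by (intro p_spanI prod_sum_vec) auto
  finally show ?thesis .
qed

lemma p_span_mult:
  assumes "F \<in> p_span" "F' \<in> p_span"
  shows "(\<lambda>x. F x * F' x) \<in> p_span"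
proof -
  obtain S c where S: "F = (\<lambda>x. \<Sum>\<kappa>\<in>S. c \<kappa> * p \<kappa> x)" using assms(1) unfolding p_span_def by blast
  obtain S' c' where S': "F' = (\<lambda>x. \<Sum>\<kappa>\<in>S'. c' \<kappa> * p \<kappa> x)" using assms(2) unfolding p_span_def by blast
  have "(\<lambda>x. p \<kappa> x * p \<iota> x) \<in> p_span" for \<kappa> \<iota>
    using p_span_prod[of "\<lambda>i. p1 i (\<kappa> $ i) * p1 i (\<iota> $ i)"] by (simp add: jacobi_multi_def prod.distrib)
  hence "(\<lambda>x. \<Sum>\<kappa>\<in>S. \<Sum>\<iota>\<in>S'. (c \<kappa> * c' \<iota>) * (p \<kappa> x * p \<iota> x)) \<in> p_span"
    by (intro p_span_sum p_span_scale)
  also have "(\<lambda>x. \<Sum>\<kappa>\<in>S. \<Sum>\<iota>\<in>S'. (c \<kappa> * c' \<iota>) * (p \<kappa> x * p \<iota> x)) = (\<lambda>x. F x * F' x)"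
    unfolding S S' sum_product by (simp add: mult_ac)
  finally show ?thesis .
qed

lemma real_polynomial_function_in_p_span:
  assumes "real_polynomial_function F"
  shows "F \<in> p_span"
  using assms
proof induction
  case (linear f)
  have coord: "(\<lambda>x. x $ i) \<in> p_span" for i
  proof -
    have "(\<lambda>x. x $ i) = (\<lambda>x::real^'d. \<Prod>j\<in>UNIV. poly (if j = i then [:0, 1:] else 1) (x $ j))"
    proof
      fix x :: "real^'d"
      have "(\<Prod>j\<in>UNIV. poly (if j = i then [:0, 1:] else 1) (x $ j)) = (\<Prod>j\<in>UNIV. if j = i then x $ j else 1)"
        by (intro prod.cong) auto
      thus "x $ i = (\<Prod>j\<in>UNIV. poly (if j = i then [:0, 1:] else 1) (x $ j))" by simp
    qed
    thus ?thesis using p_span_prod[of "\<lambda>j. if j = i then [:0, 1:] else 1"] by simp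
  qed
  interpret bounded_linear f by fact
  have "f x = (\<Sum>i\<in>UNIV. f (axis i 1) * x $ i)" for x
  proof -
    have "f x = f (\<Sum>i\<in>UNIV. x $ i *\<^sub>R axis i 1)" by (simp add: basis_expansion scalar_mult_eq_scaleR[symmetric])
    thus ?thesis by (simp add: sum scaleR mult.commute)
  qed
  hence "f = (\<lambda>x. \<Sum>i\<in>UNIV. f (axis i 1) * x $ i)" by (rule ext)
  also have "(\<lambda>x. \<Sum>i\<in>UNIV. f (axis i 1) * x $ i) \<in> p_span"
    by (intro p_span_sum p_span_scale coord)
  finally show ?case .
next
  case (const c)
  show ?case using p_span_scale[OF p_span_prod[of "\<lambda>_. 1"], of c] by simp
qed (auto intro: p_span_add p_span_mult)

lemma p_span_approx:
  assumes "continuous_on cube f" "e > 0"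
  obtains q where "q \<in> p_span" "\<And>x. x \<in> cube \<Longrightarrow> \<bar>f x - q x\<bar> < e"
proof (rule Stone_Weierstrass_real_polynomial_function[OF compact_cube assms])
  fix q :: "real^'d \<Rightarrow> real"
  assume "real_polynomial_function q" and q: "\<And>x. x \<in> cube \<Longrightarrow> \<bar>f x - q x\<bar> < e"
  thus thesis by (intro that[OF real_polynomial_function_in_p_span q])
qed

end

section \<open>The Jacobi semigroup\<close>

text \<open>Termwise differentiation is justified since \<open>l e\<^bsup>-ls\<^esup>\<close> is bounded by a constant times
  \<open>e\<^bsup>-ls'\<^esup>\<close> for any \<open>s' < s\<close>: the convergence at smaller times absorbs the factor \<open>l\<close>.\<close>

lemma exp_series_DERIV:
  fixes l a :: "nat \<Rightarrow> real"
  assumes l: "\<And>n. 0 \<le> l n" and sm: "\<And>s. s > 0 \<Longrightarrow> summable (\<lambda>n. exp (- l n * s) * \<bar>a n\<bar>)" and s: "s > 0"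
  shows "((\<lambda>s. \<Sum>n. exp (- l n * s) * a n) has_real_derivative (\<Sum>n. exp (- l n * s) * (- l n * a n))) (at s)"
proof (rule has_field_derivative_series'(2))
  show "convex {s / 2<..}" by (rule convex_real_interval)
  show "s \<in> {s / 2<..}" "s \<in> interior {s / 2<..}" using s by (auto simp: interior_open)
  show "((\<lambda>s. exp (- l n * s) * a n) has_real_derivative exp (- l n * x) * (- l n * a n)) (at x within {s / 2<..})" for n x
    by (auto intro!: derivative_eq_intros)
  have "summable (\<lambda>n. \<bar>exp (- l n * s) * a n\<bar>)" using sm[OF s] by (simp add: abs_mult)
  thus "summable (\<lambda>n. exp (- l n * s) * a n)" by (rule summable_rabs_cancel)
  show "uniformly_convergent_on {s / 2<..} (\<lambda>n x. \<Sum>i<n. exp (- l i * x) * (- l i * a i))"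
  proof (rule Weierstrass_m_test')
    show "summable (\<lambda>n. 4 / s * (exp (- l n * (s / 4)) * \<bar>a n\<bar>))"
      using s by (intro summable_mult sm) simp
    fix n x assume x: "x \<in> {s / 2<..}"
    \<comment> \<open>near \<open>s\<close> the time stays above \<open>s / 2\<close>; half of that pays for \<open>l n\<close>, the rest gives the summable majorant\<close>
    have "l n * (s / 4) \<le> exp (l n * (s / 4))" using exp_ge_add_one_self[of "l n * (s / 4)"] by linarith
    hence "l n \<le> 4 / s * exp (l n * (s / 4))" using s by (simp add: field_simps)
    moreover have "exp (- l n * x) \<le> exp (- l n * (s / 2))"
      using mult_left_mono[OF _ l[of n], of "s / 2" x] x by simp
    ultimately have "exp (- l n * x) * (l n * \<bar>a n\<bar>) \<le> exp (- l n * (s / 2)) * (4 / s * exp (l n * (s / 4)) * \<bar>a n\<bar>)"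
      using l[of n] s by (intro mult_mono mult_nonneg_nonneg) auto
    also have "\<dots> = 4 / s * ((exp (- l n * (s / 2)) * exp (l n * (s / 4))) * \<bar>a n\<bar>)" by simp
    also have "exp (- l n * (s / 2)) * exp (l n * (s / 4)) = exp (- l n * (s / 4))"
      by (simp add: exp_add[symmetric])
    finally show "norm (exp (- l n * x) * (- l n * a n)) \<le> 4 / s * (exp (- l n * (s / 4)) * \<bar>a n\<bar>)"
      using l[of n] by (simp add: abs_mult)
  qed
qed

text \<open>At an interior maximum the first derivative vanishes and the second is nonpositive. At an endpoint
  the second-order term degenerates and the coefficient of the first derivative is \<open>- 2 (a + 1)\<close> at
  \<open>1\<close> and \<open>2 (b + 1)\<close> at \<open>- 1\<close>: the drift points inward, against the direction in which \<open>q\<close> can grow.\<close>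

lemma jstep_pderiv_nonpos_at_max:
  assumes ab: "a > -1" "b > -1" and z: "z \<in> {-1..1}"
    and max: "\<And>y. y \<in> {-1..1} \<Longrightarrow> poly q y \<le> poly q z"
  shows "poly (jstep a b (pderiv q)) z \<le> 0"
proof -
  consider "z = 1" | "z = -1" | "z \<in> {-1<..<1}" using z by force
  thus ?thesis
  proof cases
    case 1
    have "poly (pderiv q) 1 \<ge> 0"
    proof (rule ccontr)
      assume "\<not> 0 \<le> poly (pderiv q) 1"
      then obtain d where d: "d > 0" "\<And>h. 0 < h \<Longrightarrow> h < d \<Longrightarrow> poly q 1 < poly q (1 - h)"
        using DERIV_neg_dec_left[OF poly_DERIV[of q 1]] by auto
      have "poly q 1 < poly q (1 - min (d / 2) 1)" using d(1) by (intro d(2)) auto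
      moreover have "1 - min (d / 2) 1 \<in> {-1..1}" using d(1) by auto
      ultimately show False using max[of "1 - min (d / 2) 1"] 1 by simp
    qed
    hence "(a + 1) * poly (pderiv q) 1 \<ge> 0" using ab by simp
    moreover have "poly (jstep a b (pderiv q)) z = - (2 * ((a + 1) * poly (pderiv q) 1))"
      unfolding 1 poly_jstep by (simp add: algebra_simps)
    ultimately show ?thesis by linarith
  next
    case 2
    have "poly (pderiv q) (-1) \<le> 0"
    proof (rule ccontr)
      assume "\<not> poly (pderiv q) (-1) \<le> 0"
      then obtain d where d: "d > 0" "\<And>h. 0 < h \<Longrightarrow> h < d \<Longrightarrow> poly q (-1) < poly q (-1 + h)"
        using DERIV_pos_inc_right[OF poly_DERIV[of q "-1"]] by auto
      have "poly q (-1) < poly q (-1 + min (d / 2) 1)" using d(1) by (intro d(2)) auto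
      moreover have "-1 + min (d / 2) 1 \<in> {-1..1}" using d(1) by auto
      ultimately show False using max[of "-1 + min (d / 2) 1"] 2 by simp
    qed
    hence "(b + 1) * poly (pderiv q) (-1) \<le> 0" using ab by (simp add: mult_nonneg_nonpos)
    moreover have "poly (jstep a b (pderiv q)) z = 2 * ((b + 1) * poly (pderiv q) (-1))"
      unfolding 2 poly_jstep by (simp add: algebra_simps)
    ultimately show ?thesis by linarith
  next
    case 3
    define e where "e = min (1 - z) (1 + z)"
    have e: "e > 0" "\<And>y. \<bar>z - y\<bar> < e \<Longrightarrow> y \<in> {-1..1}" using 3 by (auto simp: e_def)
    have q': "poly (pderiv q) z = 0"
      by (rule DERIV_local_max[OF poly_DERIV e(1)]) (use max e(2) in blast)
    have "poly (pderiv (pderiv q)) z \<le> 0"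
    proof (rule ccontr)
      assume "\<not> poly (pderiv (pderiv q)) z \<le> 0"
      then obtain d where d: "d > 0" "\<And>h. 0 < h \<Longrightarrow> h < d \<Longrightarrow> 0 < poly (pderiv q) (z + h)"
        using DERIV_pos_inc_right[OF poly_DERIV[of "pderiv q" z]] q' by auto
      define h where "h = min (d / 2) (e / 2)"
      have h: "0 < h" "h < d" "h < e" using d(1) e(1) by (auto simp: h_def)
      obtain y where y: "z < y" "y < z + h" "poly q (z + h) - poly q z = (z + h - z) * poly (pderiv q) y"
        using MVT2[of z "z + h" "poly q" "poly (pderiv q)"] h poly_DERIV by auto
      have "0 < poly (pderiv q) y" using d(2)[of "y - z"] y h by auto
      hence "0 < (z + h - z) * poly (pderiv q) y" using h(1) by simp
      hence "poly q (z + h) > poly q z" unfolding y(3)[symmetric] by simp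
      moreover have "z + h \<in> {-1..1}" using h by (intro e(2)) auto
      ultimately show False using max[of "z + h"] by simp
    qed
    moreover have "z\<^sup>2 \<le> 1" using 3 by (simp add: abs_square_le_1 abs_le_iff)
    ultimately show ?thesis by (simp add: poly_jstep q' mult_nonneg_nonpos)
  qed
qed

lemma jstep_pderiv_sum:
  "jstep a b (pderiv (\<Sum>k\<in>S. smult (c k) (q k))) = (\<Sum>k\<in>S. smult (c k) (jstep a b (pderiv (q k))))"
proof (induction S rule: infinite_finite_induct)
  case (insert k S)
  thus ?case by (simp add: jstep_def pderiv_add pderiv_smult smult_add_right distrib_left)
qed (simp_all add: jstep_def)

lemma ex_bij_nat_vec: "\<exists>e :: nat \<Rightarrow> nat^'d::finite. bij e"
proof -
  have "inj (\<lambda>n. vec n :: nat^'d)" by (auto simp: inj_on_def vec_eq_iff)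
  hence "infinite (range (\<lambda>n. vec n :: nat^'d))" by (rule range_inj_infinite)
  hence "infinite (UNIV :: (nat^'d) set)" by (rule infinite_super[OF subset_UNIV])
  thus ?thesis using bij_betw_from_nat_into[of "UNIV :: (nat^'d) set"] by blast
qed

context jacobi
begin

lemma fourier_bound:
  assumes g: "continuous_on cube g" and B: "\<And>x. x \<in> cube \<Longrightarrow> \<bar>g x\<bar> \<le> B"
  shows "\<bar>fourier g \<kappa>\<bar> \<le> B * measure \<mu> cube * psup \<kappa>"
proof -
  have i: "integrable \<mu> (\<lambda>x. g x * p \<kappa> x)" by (intro integrable_\<mu>_continuous continuous_intros g)
  have "0 \<le> B" using B[of 0] by (auto simp: mem_cube intro: order_trans[OF abs_ge_zero])
  have "\<bar>fourier g \<kappa>\<bar> \<le> (\<integral>x. \<bar>g x * p \<kappa> x\<bar> \<partial>\<mu>)"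
    unfolding fourier_def by (rule integral_abs_bound)
  also have "\<dots> \<le> (\<integral>x. B * psup \<kappa> \<partial>\<mu>)"
  proof (rule integral_mono)
    show "integrable \<mu> (\<lambda>x. \<bar>g x * p \<kappa> x\<bar>)" using i by simp
    fix x assume "x \<in> space \<mu>"
    thus "\<bar>g x * p \<kappa> x\<bar> \<le> B * psup \<kappa>"
      unfolding abs_mult using B p_le_psup \<open>0 \<le> B\<close> by (intro mult_mono) auto
  qed simp
  finally show ?thesis by (simp add: mult_ac)
qed

text \<open>An upper bound, by absolute values, for the trace of the semigroup.\<close>

definition heat_trace :: "real \<Rightarrow> real" where
  "heat_trace s = measure \<mu> cube * (\<Sum>\<^sub>\<infinity>\<kappa>. exp (- ev \<kappa> * s) * (psup \<kappa>)\<^sup>2)"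

lemma heat_trace_nonneg: "0 \<le> heat_trace s"
  unfolding heat_trace_def by (intro mult_nonneg_nonneg infsum_nonneg) auto

lemma heat_term_bound:
  assumes g: "continuous_on cube g" and B: "\<And>x. x \<in> cube \<Longrightarrow> \<bar>g x\<bar> \<le> B" and x: "x \<in> cube"
  shows "\<bar>exp (- ev \<kappa> * s) * (fourier g \<kappa> * p \<kappa> x)\<bar> \<le> B * measure \<mu> cube * (exp (- ev \<kappa> * s) * (psup \<kappa>)\<^sup>2)"
proof -
  have "\<bar>fourier g \<kappa>\<bar> * \<bar>p \<kappa> x\<bar> \<le> (B * measure \<mu> cube * psup \<kappa>) * psup \<kappa>"
    using fourier_bound[OF g B] p_le_psup[OF x] by (intro mult_mono) (auto intro: order_trans[OF abs_ge_zero])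
  hence "exp (- ev \<kappa> * s) * (\<bar>fourier g \<kappa>\<bar> * \<bar>p \<kappa> x\<bar>) \<le> exp (- ev \<kappa> * s) * ((B * measure \<mu> cube * psup \<kappa>) * psup \<kappa>)"
    by (rule mult_left_mono) simp
  thus ?thesis by (simp add: abs_mult power2_eq_square mult_ac)
qed

lemma heat_abs_summable:
  assumes g: "continuous_on cube g" and x: "x \<in> cube" and s: "s > 0"
  shows "(\<lambda>\<kappa>. \<bar>exp (- ev \<kappa> * s) * (fourier g \<kappa> * p \<kappa> x)\<bar>) summable_on UNIV"
proof -
  obtain B where B: "\<And>x. x \<in> cube \<Longrightarrow> \<bar>g x\<bar> \<le> B" using continuous_on_cube_bounded[OF g] by blast
  show ?thesis
    using heat_term_bound[OF g B x]
    by (intro summable_on_comparison_test[OF summable_on_cmult_right[OF summable_heat[OF s]]]) auto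
qed

text \<open>Integrating the kernel series term by term. The kernel is defined as an unordered sum, so the terms
  are enumerated by a bijection in order to apply dominated convergence.\<close>

lemma heat_has_sum:
  assumes g: "continuous_on cube g" and x: "x \<in> cube" and s: "s > 0"
  shows "((\<lambda>\<kappa>. exp (- ev \<kappa> * s) * (fourier g \<kappa> * p \<kappa> x)) has_sum heat s g x) UNIV"
proof -
  obtain B where B: "B > 0" "\<And>x. x \<in> cube \<Longrightarrow> \<bar>g x\<bar> \<le> B" using continuous_on_cube_bounded[OF g] by blast
  obtain e :: "nat \<Rightarrow> nat^'d" where e: "bij e" using ex_bij_nat_vec by blast
  define K where "K = (\<lambda>\<kappa> y. exp (- ev \<kappa> * s) * p \<kappa> x * p \<kappa> y)"
  define W where "W = (\<lambda>\<kappa>. exp (- ev \<kappa> * s) * (psup \<kappa>)\<^sup>2)"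
  have KW: "\<bar>K \<kappa> y\<bar> \<le> W \<kappa>" if "y \<in> cube" for \<kappa> y
  proof -
    have "\<bar>p \<kappa> x\<bar> * \<bar>p \<kappa> y\<bar> \<le> psup \<kappa> * psup \<kappa>"
      using p_le_psup[OF x] p_le_psup[OF that] psup_nonneg by (intro mult_mono) auto
    thus ?thesis by (simp add: K_def W_def abs_mult power2_eq_square mult.assoc)
  qed
  have smW: "summable (\<lambda>n. W (e n))"
  proof (rule summable_on_imp_summable)
    show "(\<lambda>n. W (e n)) summable_on UNIV"
      using summable_heat[OF s] unfolding summable_on_reindex_bij_betw[OF e, of W] by (simp add: W_def)
  qed
  have ker: "jacobi_kernel \<alpha> \<beta> s x y = (\<Sum>n. K (e n) y)" if "y \<in> cube" for y
  proof -
    have "summable (\<lambda>n. norm (K (e n) y))"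
      by (rule summable_comparison_test'[OF smW, of 0]) (use KW[OF that] in auto)
    hence "(\<lambda>n. K (e n) y) summable_on UNIV" by (rule norm_summable_imp_summable_on)
    hence "(\<lambda>n. K (e n) y) sums (\<Sum>\<^sub>\<infinity>n. K (e n) y)" by (intro has_sum_imp_sums has_sum_infsum)
    moreover have "(\<Sum>\<^sub>\<infinity>n. K (e n) y) = jacobi_kernel \<alpha> \<beta> s x y"
      unfolding jacobi_kernel_def K_def by (rule infsum_reindex_bij_betw[OF e])
    ultimately show ?thesis by (simp add: sums_iff)
  qed
  have cK: "continuous_on cube (\<lambda>y. g y * K \<kappa> y)" for \<kappa>
    unfolding K_def by (intro continuous_intros g)
  have int: "(\<integral>y. g y * K \<kappa> y \<partial>\<mu>) = exp (- ev \<kappa> * s) * (fourier g \<kappa> * p \<kappa> x)" for \<kappa>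
  proof -
    have "(\<integral>y. g y * K \<kappa> y \<partial>\<mu>) = (\<integral>y. (exp (- ev \<kappa> * s) * p \<kappa> x) * (g y * p \<kappa> y) \<partial>\<mu>)"
      by (simp add: K_def mult_ac)
    thus ?thesis unfolding fourier_def integral_mult_right_zero by (simp add: mult_ac)
  qed
  have gK: "norm (g y * K \<kappa> y) \<le> B * W \<kappa>" if "y \<in> cube" for \<kappa> y
    using B(2)[OF that] KW[OF that] B(1) by (simp add: abs_mult mult_mono)
  have "(\<lambda>n. \<integral>y. g y * K (e n) y \<partial>\<mu>) sums (\<integral>y. (\<Sum>n. g y * K (e n) y) \<partial>\<mu>)"
  proof (rule sums_integral)
    show "integrable \<mu> (\<lambda>y. g y * K (e n) y)" for n by (rule integrable_\<mu>_continuous[OF cK])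
    show "AE y in \<mu>. summable (\<lambda>n. norm (g y * K (e n) y))"
      by (intro AE_I2 summable_comparison_test'[OF summable_mult[OF smW], of 0 _ B]) (use gK in auto)
    show "summable (\<lambda>n. \<integral>y. norm (g y * K (e n) y) \<partial>\<mu>)"
    proof (rule summable_comparison_test'[OF summable_mult[OF smW], of 0 _ "B * measure \<mu> cube"])
      fix n
      have "(\<integral>y. norm (g y * K (e n) y) \<partial>\<mu>) \<le> (\<integral>y. B * W (e n) \<partial>\<mu>)"
        using gK by (intro integral_mono) (auto intro: integrable_\<mu>_continuous[OF cK])
      thus "norm (\<integral>y. norm (g y * K (e n) y) \<partial>\<mu>) \<le> B * measure \<mu> cube * W (e n)" by (simp add: mult_ac)
    qed
  qed
  also have "(\<integral>y. (\<Sum>n. g y * K (e n) y) \<partial>\<mu>) = heat s g x"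
    unfolding jacobi_semigroup_def
  proof (intro Bochner_Integration.integral_cong refl)
    fix y assume "y \<in> space \<mu>"
    hence y: "y \<in> cube" by simp
    have "summable (\<lambda>n. K (e n) y)"
      by (rule summable_comparison_test'[OF smW, of 0]) (use KW[OF y] in auto)
    thus "(\<Sum>n. g y * K (e n) y) = g y * jacobi_kernel \<alpha> \<beta> s x y"
      unfolding ker[OF y] by (rule suminf_mult)
  qed
  finally have sums: "(\<lambda>n. exp (- ev (e n) * s) * (fourier g (e n) * p (e n) x)) sums heat s g x"
    unfolding int .
  have "(\<lambda>\<kappa>. exp (- ev \<kappa> * s) * (fourier g \<kappa> * p \<kappa> x)) summable_on UNIV"
    using heat_abs_summable[OF g x s] unfolding real_norm_def[symmetric] by (rule abs_summable_summable)
  hence S: "((\<lambda>\<kappa>. exp (- ev \<kappa> * s) * (fourier g \<kappa> * p \<kappa> x)) has_sum (\<Sum>\<^sub>\<infinity>\<kappa>. exp (- ev \<kappa> * s) * (fourier g \<kappa> * p \<kappa> x))) UNIV" (is "(?t has_sum ?S) UNIV")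
    by (rule has_sum_infsum)
  have "(\<lambda>n. ?t (e n)) sums ?S"
    by (rule has_sum_imp_sums[OF has_sum_reindex_bij_betw[OF e, THEN iffD2, OF S]])
  hence "?S = heat s g x" using sums by (rule sums_unique2)
  with S show ?thesis by simp
qed

lemma heat_crude_bound:
  assumes g: "continuous_on cube g" and B: "\<And>x. x \<in> cube \<Longrightarrow> \<bar>g x\<bar> \<le> B" and x: "x \<in> cube" and s: "s > 0"
  shows "\<bar>heat s g x\<bar> \<le> B * heat_trace s"
proof -
  have "((\<lambda>\<kappa>. B * measure \<mu> cube * (exp (- ev \<kappa> * s) * (psup \<kappa>)\<^sup>2)) has_sum
      (B * measure \<mu> cube * (\<Sum>\<^sub>\<infinity>\<kappa>. exp (- ev \<kappa> * s) * (psup \<kappa>)\<^sup>2))) UNIV"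
    by (intro has_sum_cmult_right has_sum_infsum summable_heat s)
  from norm_infsum_le[OF heat_has_sum[OF g x s] this] heat_term_bound[OF g B x]
  show ?thesis by (simp add: heat_trace_def mult.assoc)
qed

text \<open>The derivative is the series with coefficients \<open>- \<lambda>\<^sub>\<kappa> \<langle>g, p\<^sub>\<kappa>\<rangle>\<close>. It exists for every continuous \<open>g\<close>,
  whence continuity in time; when these numbers are the Fourier coefficients of a continuous \<open>h\<close>, it
  is the semigroup applied to \<open>h\<close>.\<close>

lemma heat_derivative:
  assumes g: "continuous_on cube g" and x: "x \<in> cube" and s: "s > 0"
  shows "\<exists>D. ((\<lambda>s. heat s g x) has_real_derivative D) (at s) \<and>
     (\<forall>h. continuous_on cube h \<longrightarrow> (\<forall>\<kappa>. fourier h \<kappa> = - ev \<kappa> * fourier g \<kappa>) \<longrightarrow> D = heat s h x)"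
proof -
  obtain e :: "nat \<Rightarrow> nat^'d" where e: "bij e" using ex_bij_nat_vec by blast
  have sums: "(\<lambda>n. exp (- ev (e n) * s) * (fourier g (e n) * p (e n) x)) sums heat s g x"
    if "s > 0" "continuous_on cube g" for s g
    using has_sum_imp_sums[OF has_sum_reindex_bij_betw[OF e, THEN iffD2, OF heat_has_sum[OF that(2) x that(1)]]] .
  let ?D = "\<Sum>n. exp (- ev (e n) * s) * (- ev (e n) * (fourier g (e n) * p (e n) x))"
  have "((\<lambda>s. \<Sum>n. exp (- ev (e n) * s) * (fourier g (e n) * p (e n) x)) has_real_derivative ?D) (at s)"
  proof (rule exp_series_DERIV[OF ev_nonneg _ s])
    fix s :: real assume "s > 0"
    have "(\<lambda>n. \<bar>exp (- ev (e n) * s) * (fourier g (e n) * p (e n) x)\<bar>) summable_on UNIV"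
      using heat_abs_summable[OF g x \<open>s > 0\<close>] by (subst summable_on_reindex_bij_betw[OF e])
    thus "summable (\<lambda>n. exp (- ev (e n) * s) * \<bar>fourier g (e n) * p (e n) x\<bar>)"
      by (intro summable_on_imp_summable) (simp add: abs_mult)
  qed
  hence "((\<lambda>s. heat s g x) has_real_derivative ?D) (at s)"
    by (rule has_field_derivative_transform_within_open[of _ _ _ "{0<..}"])
       (use s sums g in \<open>auto simp: sums_iff\<close>)
  moreover have "?D = heat s h x" if "continuous_on cube h" "\<And>\<kappa>. fourier h \<kappa> = - ev \<kappa> * fourier g \<kappa>" for h
    using sums[OF s that(1)] by (simp add: that(2) sums_iff mult_ac)
  ultimately show ?thesis by blast
qed

text \<open>The semigroup on polynomials, given by a finite sum. Unlike the kernel it makes sense at time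
  zero, which the maximum principle needs.\<close>

definition evolve :: "(nat^'d) set \<Rightarrow> (nat^'d \<Rightarrow> real) \<Rightarrow> real \<Rightarrow> real^'d \<Rightarrow> real" where
  "evolve S c s x = (\<Sum>\<kappa>\<in>S. exp (- ev \<kappa> * s) * (c \<kappa> * p \<kappa> x))"

text \<open>The left-hand side is the Jacobi operator applied to \<open>evolve S c s\<close>. In each coordinate the
  function is a polynomial with a maximum at \<open>x\<^sub>i\<close>.\<close>

lemma generator_evolve_nonpos_at_max:
  assumes x: "x \<in> cube" and max: "\<And>y. y \<in> cube \<Longrightarrow> evolve S c s y \<le> evolve S c s x"
  shows "(\<Sum>\<kappa>\<in>S. - ev \<kappa> * (exp (- ev \<kappa> * s) * (c \<kappa> * p \<kappa> x))) \<le> 0"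
proof -
  define d where "d = (\<lambda>\<kappa>. exp (- ev \<kappa> * s) * c \<kappa>)"
  define r where "r = (\<lambda>i \<kappa>. \<Prod>j\<in>UNIV - {i}. poly (p1 j (\<kappa> $ j)) (x $ j))"
  define Q where "Q = (\<lambda>i. \<Sum>\<kappa>\<in>S. smult (d \<kappa> * r i \<kappa>) (p1 i (\<kappa> $ i)))"
  have Q: "poly (Q i) z = evolve S c s (slice x i z)" for i z
    by (simp add: Q_def evolve_def poly_sum p_slice d_def r_def mult_ac)
  have "poly (jstep (\<alpha> $ i) (\<beta> $ i) (pderiv (Q i))) (x $ i) \<le> 0" for i
  proof (rule jstep_pderiv_nonpos_at_max[OF \<alpha> \<beta>])
    show "x $ i \<in> {-1..1}" using x by (simp add: mem_cube)
    show "poly (Q i) y \<le> poly (Q i) (x $ i)" if "y \<in> {-1..1}" for y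
      unfolding Q by (simp add: max slice_in_cube[OF x that])
  qed
  hence "(\<Sum>i\<in>UNIV. poly (jstep (\<alpha> $ i) (\<beta> $ i) (pderiv (Q i))) (x $ i)) \<le> 0"
    by (intro sum_nonpos)
  moreover have "poly (jstep (\<alpha> $ i) (\<beta> $ i) (pderiv (Q i))) (x $ i) =
      (\<Sum>\<kappa>\<in>S. - jeigenvalue (\<alpha> $ i) (\<beta> $ i) (\<kappa> $ i) * (d \<kappa> * p \<kappa> x))" for i
  proof -
    have "p \<kappa> x = poly (p1 i (\<kappa> $ i)) (x $ i) * r i \<kappa>" for \<kappa>
      using p_slice[of \<kappa> x i "x $ i"] by (simp add: r_def)
    thus ?thesis
      by (simp add: Q_def jstep_pderiv_sum jacobi_poly_eigen[OF \<alpha> \<beta>] poly_sum mult_ac)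
  qed
  moreover have "(\<Sum>i\<in>UNIV. \<Sum>\<kappa>\<in>S. - jeigenvalue (\<alpha> $ i) (\<beta> $ i) (\<kappa> $ i) * (d \<kappa> * p \<kappa> x)) =
      (\<Sum>\<kappa>\<in>S. \<Sum>i\<in>UNIV. - jeigenvalue (\<alpha> $ i) (\<beta> $ i) (\<kappa> $ i) * (d \<kappa> * p \<kappa> x))"
    by (rule sum.swap)
  moreover have "(\<Sum>\<kappa>\<in>S. \<Sum>i\<in>UNIV. - jeigenvalue (\<alpha> $ i) (\<beta> $ i) (\<kappa> $ i) * (d \<kappa> * p \<kappa> x))
      = (\<Sum>\<kappa>\<in>S. - ev \<kappa> * (exp (- ev \<kappa> * s) * (c \<kappa> * p \<kappa> x)))"
    unfolding ev_eq sum_negf[symmetric] sum_distrib_right[symmetric]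
    by (simp add: d_def ev_eq sum_negf mult_ac)
  ultimately show ?thesis by simp
qed

text \<open>Subtracting \<open>\<epsilon> s\<close> makes the function strictly subcaloric. Its maximum over \<open>[0, t] \<times> cube\<close> can
  then not be attained at a positive time, since the time derivative would be negative there and
  the value would be larger a moment before.\<close>

lemma evolve_maximum_principle:
  assumes B: "\<And>x. x \<in> cube \<Longrightarrow> evolve S c 0 x \<le> B" and t: "t \<ge> 0" and x: "x \<in> cube"
  shows "evolve S c t x \<le> B"
proof (rule ccontr)
  assume "\<not> evolve S c t x \<le> B"
  hence gt: "evolve S c t x > B" by simp
  hence "t \<noteq> 0" using B[OF x] by auto
  hence t0: "t > 0" using t by simp
  \<comment> \<open>half of what the penalty may cost if the value at \<open>(t, x)\<close> is to stay above \<open>B\<close>\<close>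
  define \<epsilon> where "\<epsilon> = (evolve S c t x - B) / (2 * t)"
  have \<epsilon>: "\<epsilon> > 0" "evolve S c t x - \<epsilon> * t > B" using gt t0 by (auto simp: \<epsilon>_def field_simps)
  define v where "v = (\<lambda>(s, y). evolve S c s y - \<epsilon> * s)"
  have "continuous_on ({0..t} \<times> cube) v"
    unfolding v_def evolve_def case_prod_beta
    by (intro continuous_intros continuous_on_compose2[OF continuous_p]) auto
  moreover have "compact ({0..t} \<times> (cube :: (real^'d) set))" by (intro compact_Times compact_cube) simp
  moreover have "(t, x) \<in> {0..t} \<times> cube" using t x by auto
  ultimately obtain m where m: "m \<in> {0..t} \<times> cube" "\<And>y. y \<in> {0..t} \<times> cube \<Longrightarrow> v y \<le> v m"
    using continuous_attains_sup[of "{0..t} \<times> cube" v] by blast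
  obtain s y where sy: "m = (s, y)" by (cases m)
  have s: "0 \<le> s" "s \<le> t" and y: "y \<in> cube" using m(1) sy by auto
  have max: "evolve S c s' y' - \<epsilon> * s' \<le> evolve S c s y - \<epsilon> * s" if "0 \<le> s'" "s' \<le> t" "y' \<in> cube" for s' y'
    using m(2)[of "(s', y')"] that by (simp add: v_def sy)
  have "s \<noteq> 0"
    using max[of t x] \<epsilon>(2) t x B[OF y] by auto
  hence s0: "s > 0" using s by simp
  let ?D = "(\<Sum>\<kappa>\<in>S. - ev \<kappa> * (exp (- ev \<kappa> * s) * (c \<kappa> * p \<kappa> y))) - \<epsilon>"
  have "((\<lambda>s. evolve S c s y - \<epsilon> * s) has_real_derivative ?D) (at s)"
    unfolding evolve_def by (auto intro!: derivative_eq_intros sum.cong simp: mult_ac)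
  moreover have "?D < 0"
    using generator_evolve_nonpos_at_max[OF y, of S c s] max[of s] s \<epsilon>(1) by fastforce
  ultimately obtain d where d: "d > 0" "\<And>h. 0 < h \<Longrightarrow> h < d \<Longrightarrow> evolve S c s y - \<epsilon> * s < evolve S c (s - h) y - \<epsilon> * (s - h)"
    using DERIV_neg_dec_left by blast
  define h where "h = min (d / 2) s"
  have "0 < h" "h < d" "0 \<le> s - h" "s - h \<le> t" using d(1) s0 s by (auto simp: h_def)
  thus False using d(2)[of h] max[of "s - h" y] y by auto
qed

lemma fourier_sum_p:
  assumes "finite S"
  shows "fourier (\<lambda>x. \<Sum>\<kappa>\<in>S. c \<kappa> * p \<kappa> x) \<iota> = (if \<iota> \<in> S then c \<iota> else 0)"
proof -
  have "fourier (\<lambda>x. \<Sum>\<kappa>\<in>S. c \<kappa> * p \<kappa> x) \<iota> = (\<integral>x. (\<Sum>\<kappa>\<in>S. c \<kappa> * (p \<kappa> x * p \<iota> x)) \<partial>\<mu>)"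
    by (simp add: fourier_def sum_distrib_right mult.assoc)
  also have "\<dots> = (\<Sum>\<kappa>\<in>S. \<integral>x. c \<kappa> * (p \<kappa> x * p \<iota> x) \<partial>\<mu>)"
    by (rule Bochner_Integration.integral_sum) (intro integrable_\<mu>_continuous continuous_intros)
  also have "\<dots> = (\<Sum>\<kappa>\<in>S. c \<kappa> * (if \<kappa> = \<iota> then 1 else 0))"
    by (simp add: p_orthonormal)
  finally show ?thesis using assms by (simp add: if_distrib sum.delta cong: if_cong)
qed

lemma heat_sum_p:
  assumes S: "finite S" and x: "x \<in> cube" and s: "s > 0"
  shows "heat s (\<lambda>x. \<Sum>\<kappa>\<in>S. c \<kappa> * p \<kappa> x) x = evolve S c s x"
proof -
  let ?q = "\<lambda>x. \<Sum>\<kappa>\<in>S. c \<kappa> * p \<kappa> x"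
  have "continuous_on cube ?q" by (intro continuous_intros)
  from heat_has_sum[OF this x s]
  have "((\<lambda>\<kappa>. exp (- ev \<kappa> * s) * (fourier ?q \<kappa> * p \<kappa> x)) has_sum heat s ?q x) UNIV" .
  moreover have "((\<lambda>\<kappa>. exp (- ev \<kappa> * s) * (fourier ?q \<kappa> * p \<kappa> x)) has_sum evolve S c s x) UNIV"
    by (rule has_sum_finite_neutralI[OF S]) (auto simp: fourier_sum_p[OF S] evolve_def)
  ultimately show ?thesis by (rule has_sum_unique)
qed

lemma heat_diff:
  assumes g: "continuous_on cube g" and h: "continuous_on cube h" and x: "x \<in> cube" and s: "s > 0"
  shows "heat s (\<lambda>x. g x - h x) x = heat s g x - heat s h x"
proof -
  have gh: "continuous_on cube (\<lambda>x. g x - h x)" by (intro continuous_intros g h)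
  have "fourier (\<lambda>x. g x - h x) \<kappa> = fourier g \<kappa> - fourier h \<kappa>" for \<kappa>
    unfolding fourier_def left_diff_distrib
    by (rule Bochner_Integration.integral_diff) (intro integrable_\<mu>_continuous continuous_intros g h)+
  hence "((\<lambda>\<kappa>. exp (- ev \<kappa> * s) * (fourier g \<kappa> * p \<kappa> x) - exp (- ev \<kappa> * s) * (fourier h \<kappa> * p \<kappa> x))
      has_sum heat s (\<lambda>x. g x - h x) x) UNIV"
    using heat_has_sum[OF gh x s] by (simp add: left_diff_distrib right_diff_distrib)
  moreover have "((\<lambda>\<kappa>. exp (- ev \<kappa> * s) * (fourier g \<kappa> * p \<kappa> x) - exp (- ev \<kappa> * s) * (fourier h \<kappa> * p \<kappa> x))
      has_sum (heat s g x - heat s h x)) UNIV"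
    using has_sum_add[OF heat_has_sum[OF g x s] has_sum_cmult_right[OF heat_has_sum[OF h x s], of "-1"]] by simp
  ultimately show ?thesis by (rule has_sum_unique)
qed

text \<open>For polynomials this is the maximum principle, applied to the polynomial and its negative. A
  continuous function is a uniform limit of polynomials, and at a fixed time the error is controlled
  by \<open>heat_crude_bound\<close>.\<close>

lemma heat_contraction:
  assumes g: "continuous_on cube g" and B: "\<And>x. x \<in> cube \<Longrightarrow> \<bar>g x\<bar> \<le> B" and x: "x \<in> cube" and s: "s > 0"
  shows "\<bar>heat s g x\<bar> \<le> B"
proof (rule field_le_epsilon)
  fix \<eta> :: real assume \<eta>: "\<eta> > 0"
  \<comment> \<open>the approximation error enters twice, once through the sup norm of \<open>q\<close> and once through \<open>heat_trace s\<close>\<close>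
  define e where "e = \<eta> / (1 + heat_trace s)"
  have e: "e > 0" "e * (1 + heat_trace s) = \<eta>"
    using \<eta> heat_trace_nonneg[of s] by (auto simp: e_def field_simps add_nonneg_pos)
  obtain q where q: "q \<in> p_span" "\<And>x. x \<in> cube \<Longrightarrow> \<bar>g x - q x\<bar> < e"
    using p_span_approx[OF g e(1)] by blast
  then obtain S c where S: "finite S" "q = (\<lambda>x. \<Sum>\<kappa>\<in>S. c \<kappa> * p \<kappa> x)" unfolding p_span_def by blast
  have cq: "continuous_on cube q" unfolding S by (intro continuous_intros)
  have "\<bar>q y\<bar> \<le> B + e" if "y \<in> cube" for y
    using B[OF that] q(2)[OF that] by linarith
  hence 1: "evolve S c 0 y \<le> B + e" "evolve S (\<lambda>\<kappa>. - c \<kappa>) 0 y \<le> B + e" if "y \<in> cube" for y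
    using that by (fastforce simp: evolve_def S(2) sum_negf abs_le_iff)+
  have "evolve S (\<lambda>\<kappa>. - c \<kappa>) s x = - evolve S c s x" by (simp add: evolve_def sum_negf)
  hence "\<bar>evolve S c s x\<bar> \<le> B + e"
    using evolve_maximum_principle[OF 1(1) _ x, of s] evolve_maximum_principle[OF 1(2) _ x, of s] s
    by (simp add: abs_le_iff)
  hence "\<bar>heat s q x\<bar> \<le> B + e"
    unfolding S(2) heat_sum_p[OF S(1) x s] .
  moreover have "\<bar>heat s (\<lambda>x. g x - q x) x\<bar> \<le> e * heat_trace s"
    by (intro heat_crude_bound x s continuous_intros g cq less_imp_le q(2))
  ultimately have "\<bar>heat s g x\<bar> \<le> B + e + e * heat_trace s"
    unfolding heat_diff[OF g cq x s] by linarith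
  thus "\<bar>heat s g x\<bar> \<le> B + \<eta>" using e(2) by (simp add: algebra_simps)
qed

text \<open>For \<open>s \<ge> 1\<close> one splits off \<open>e\<^bsup>-\<lambda>\<^sub>\<kappa> (s-1)\<^esup> \<le> e\<^bsup>-d(s-1)\<^esup>\<close> and sums the rest at time one; the term \<open>\<kappa> = 0\<close>
  vanishes by assumption. For \<open>s \<le> 1\<close> the contraction property is enough.\<close>

lemma heat_decay:
  assumes g: "continuous_on cube g" and 0: "fourier g 0 = 0"
  obtains K where "K \<ge> 0"
    "\<And>s x. s > 0 \<Longrightarrow> x \<in> cube \<Longrightarrow> \<bar>heat s g x\<bar> \<le> K * exp (- gap * s)"
proof -
  let ?d = "gap"
  obtain B where B: "B > 0" "\<And>x. x \<in> cube \<Longrightarrow> \<bar>g x\<bar> \<le> B" using continuous_on_cube_bounded[OF g] by blast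
  define K where "K = B * exp ?d * (1 + heat_trace 1)"
  have "\<bar>heat s g x\<bar> \<le> K * exp (- ?d * s)" if s: "s > 0" and x: "x \<in> cube" for s x
  proof (cases "s \<le> 1")
    case True
    have "\<bar>heat s g x\<bar> \<le> B" by (rule heat_contraction[OF g B(2) x s])
    also have "B \<le> B * exp (?d * (1 - s))"
      using True B(1) min_eigenvalue_pos by simp
    also have "\<dots> = B * exp ?d * exp (- ?d * s)" by (simp add: exp_add[symmetric] algebra_simps)
    also have "\<dots> \<le> K * exp (- ?d * s)"
      unfolding K_def using heat_trace_nonneg[of 1] B(1) by (intro mult_right_mono) (auto simp: algebra_simps)
    finally show ?thesis .
  next
    case False
    define C where "C = exp (- ?d * (s - 1)) * (B * measure \<mu> cube)"
    have "((\<lambda>\<kappa>. C * (exp (- ev \<kappa> * 1) * (psup \<kappa>)\<^sup>2)) has_sum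
        (C * (\<Sum>\<^sub>\<infinity>\<kappa>. exp (- ev \<kappa> * 1) * (psup \<kappa>)\<^sup>2))) UNIV"
      by (intro has_sum_cmult_right has_sum_infsum summable_heat) simp
    moreover have "norm (exp (- ev \<kappa> * s) * (fourier g \<kappa> * p \<kappa> x)) \<le> C * (exp (- ev \<kappa> * 1) * (psup \<kappa>)\<^sup>2)" for \<kappa>
    proof (cases "\<kappa> = 0")
      case True
      thus ?thesis using 0 B(1) by (simp add: C_def)
    next
      case False
      have "\<bar>exp (- ev \<kappa> * 1) * (fourier g \<kappa> * p \<kappa> x)\<bar> \<le> B * measure \<mu> cube * (exp (- ev \<kappa> * 1) * (psup \<kappa>)\<^sup>2)"
        by (rule heat_term_bound[OF g B(2) x])
      moreover have "exp (- ev \<kappa> * (s - 1)) \<le> exp (- ?d * (s - 1))"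
        using min_eigenvalue_le_ev[OF False] \<open>\<not> s \<le> 1\<close> by simp
      ultimately have "exp (- ev \<kappa> * (s - 1)) * \<bar>exp (- ev \<kappa> * 1) * (fourier g \<kappa> * p \<kappa> x)\<bar> \<le>
          exp (- ?d * (s - 1)) * (B * measure \<mu> cube * (exp (- ev \<kappa> * 1) * (psup \<kappa>)\<^sup>2))"
        by (intro mult_mono) auto
      moreover have "exp (- ev \<kappa> * s) = exp (- ev \<kappa> * (s - 1)) * exp (- ev \<kappa> * 1)"
        by (simp add: exp_add[symmetric] algebra_simps)
      ultimately show ?thesis by (simp add: C_def abs_mult mult_ac)
    qed
    ultimately have "\<bar>heat s g x\<bar> \<le> C * (\<Sum>\<^sub>\<infinity>\<kappa>. exp (- ev \<kappa> * 1) * (psup \<kappa>)\<^sup>2)"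
      using norm_infsum_le[OF heat_has_sum[OF g x s]] by fastforce
    also have "\<dots> = B * (exp (- ?d * (s - 1)) * heat_trace 1)"
      by (simp add: C_def heat_trace_def mult_ac)
    also have "exp (- ?d * (s - 1)) = exp ?d * exp (- ?d * s)" by (simp add: exp_add[symmetric] algebra_simps)
    also have "B * (exp ?d * exp (- ?d * s) * heat_trace 1) \<le> K * exp (- ?d * s)"
      using B(1) by (simp add: K_def algebra_simps)
    finally show ?thesis .
  qed
  moreover have "K \<ge> 0" using B(1) heat_trace_nonneg[of 1] by (simp add: K_def)
  ultimately show thesis using that by blast
qed

end

section \<open>Subordination and the Poisson semigroup\<close>

text \<open>Difference quotients are dominated by \<open>w\<close> through the mean value inequality.\<close>

lemma DERIV_lebesgue_integral:
  fixes f f' :: "real \<Rightarrow> 'a \<Rightarrow> real"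
  assumes t0: "t0 \<in> {a<..<b}"
    and int: "\<And>t. t \<in> {a<..<b} \<Longrightarrow> integrable M (f t)"
    and d: "\<And>t u. t \<in> {a<..<b} \<Longrightarrow> u \<in> space M \<Longrightarrow> ((\<lambda>t. f t u) has_real_derivative f' t u) (at t)"
    and w: "integrable M w" "\<And>t u. t \<in> {a<..<b} \<Longrightarrow> u \<in> space M \<Longrightarrow> \<bar>f' t u\<bar> \<le> w u"
  shows "((\<lambda>t. \<integral>u. f t u \<partial>M) has_real_derivative (\<integral>u. f' t0 u \<partial>M)) (at t0)"
  unfolding has_field_derivative_iff LIMSEQ_SEQ_conv[symmetric]
proof (intro allI impI, elim conjE)
  fix S :: "nat \<Rightarrow> real" assume S: "\<forall>n. S n \<noteq> t0" "S \<longlonglongrightarrow> t0"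
  have "eventually (\<lambda>n. S n \<in> {a<..<b}) sequentially"
    using S(2) t0 by (intro topological_tendstoD) auto
  then obtain N where N: "\<And>n. n \<ge> N \<Longrightarrow> S n \<in> {a<..<b}" unfolding eventually_sequentially by blast
  define r where "r = (\<lambda>n. S (n + N))"
  have r: "r n \<in> {a<..<b}" "r n \<noteq> t0" for n using N S(1) by (auto simp: r_def)
  have rlim: "r \<longlonglongrightarrow> t0" unfolding r_def using S(2) by (rule LIMSEQ_ignore_initial_segment)
  define q where "q = (\<lambda>n u. (f (r n) u - f t0 u) / (r n - t0))"
  have qint: "integrable M (q n)" for n unfolding q_def using int r t0 by auto
  have qlim: "(\<lambda>n. q n u) \<longlonglongrightarrow> f' t0 u" if "u \<in> space M" for u
  proof -
    have "(\<lambda>n. (f (S n) u - f t0 u) / (S n - t0)) \<longlonglongrightarrow> f' t0 u"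
      using d[OF t0 that] S unfolding has_field_derivative_iff LIMSEQ_SEQ_conv[symmetric] by blast
    thus ?thesis unfolding q_def r_def by (rule LIMSEQ_ignore_initial_segment)
  qed
  have qb: "norm (q n u) \<le> w u" if u: "u \<in> space M" for n u
  proof -
    have "norm (f (r n) u - f t0 u) \<le> w u * norm (r n - t0)"
    proof (rule field_differentiable_bound)
      show "convex {a<..<b}" by (rule convex_real_interval)
      show "((\<lambda>t. f t u) has_field_derivative f' t u) (at t within {a<..<b})" if "t \<in> {a<..<b}" for t
        using d[OF that u] by (rule has_field_derivative_at_within)
    qed (use w(2) u r t0 in auto)
    thus ?thesis using r(2)[of n] by (simp add: q_def field_simps)
  qed
  have "(\<lambda>n. \<integral>u. q n u \<partial>M) \<longlonglongrightarrow> (\<integral>u. f' t0 u \<partial>M)"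
  proof (rule integral_dominated_convergence)
    show "f' t0 \<in> borel_measurable M"
      by (rule borel_measurable_LIMSEQ_real[of M q, OF qlim]) (use qint in auto)
  qed (use qint qlim qb w(1) in auto)
  also have "(\<lambda>n. \<integral>u. q n u \<partial>M) = (\<lambda>n. ((\<integral>u. f (r n) u \<partial>M) - (\<integral>u. f t0 u \<partial>M)) / (r n - t0))"
    unfolding q_def using int r t0 by (simp add: Bochner_Integration.integral_diff)
  finally show "(\<lambda>n. ((\<integral>u. f (S n) u \<partial>M) - (\<integral>u. f t0 u \<partial>M)) / (S n - t0)) \<longlonglongrightarrow> (\<integral>u. f' t0 u \<partial>M)"
    unfolding r_def by (rule LIMSEQ_offset)
qed

text \<open>A common majorant for the integrands of \<open>P\<^sub>t\<close> and \<open>\<partial>\<^sub>t P\<^sub>t\<close> when \<open>T\<^sub>s\<close> is replaced by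
  \<open>e\<^bsup>-ds\<^esup>\<close> and \<open>c = \<surd>d t / 2\<close>: the summand \<open>1\<close> in the first factor accounts for \<open>P\<^sub>t\<close> and \<open>c / u\<close> for
  its derivative.\<close>

definition sub_majorant :: "real \<Rightarrow> real \<Rightarrow> real" where
  "sub_majorant c u = (1 + c / u) * (exp (-u) / sqrt u * exp (- (c\<^sup>2 / u)))"

text \<open>Put \<open>z = \<surd>u - c / \<surd>u\<close>. Then \<open>u + c\<^sup>2 / u = 2 c + z\<^sup>2\<close>, and \<open>(1 + c / u) / (2 \<surd>u)\<close> is the derivative
  of \<open>z\<close>, so the integrand is \<open>2 e\<^bsup>-2c\<^esup> e\<^bsup>-z\<^sup>2\<^esup> dz/du\<close>. Bounding \<open>e\<^bsup>-z\<^sup>2\<^esup>\<close> by \<open>1 / (1 + z\<^sup>2)\<close> gives an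
  explicit antiderivative, at the cost of a constant only.\<close>

lemma sub_majorant_integral:
  assumes c: "c > 0"
  shows "set_integrable lborel {0<..} (sub_majorant c)"
    and "(LINT u:{0<..}|lborel. sub_majorant c u) \<le> 2 * pi * exp (- 2 * c)"
proof -
  define z where "z = (\<lambda>u. sqrt u - c / sqrt u)"
  define D where "D = (\<lambda>u. inverse (1 + (z u)\<^sup>2) * ((1 + c / u) / (2 * sqrt u)))"
  have z2: "(z u)\<^sup>2 = u + c\<^sup>2 / u - 2 * c" if "u > 0" for u
    using that by (simp add: z_def power2_diff power_divide)
  have zd: "(z has_real_derivative (1 + c / u) / (2 * sqrt u)) (at u)" if "u > 0" for u
    unfolding z_def using that
    by (auto intro!: derivative_eq_intros simp: field_simps power2_eq_square)
  have d: "((\<lambda>u. arctan (z u)) has_real_derivative D u) (at u)" if "u > 0" for u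
    unfolding D_def by (rule DERIV_chain'[OF zd[OF that] DERIV_arctan])
  have pos: "(1 + (z u)\<^sup>2) \<noteq> 0" for u by (metis add_pos_nonneg less_irrefl zero_le_power2 zero_less_one)
  have cont: "isCont D u" if "u > 0" for u
    unfolding D_def z_def using that pos[of u] c by (auto intro!: continuous_intros simp: z_def)
  have nn: "D u \<ge> 0" if "u > 0" for u unfolding D_def using that c by simp
  have "filterlim z at_bot (at_right 0)" unfolding z_def using c by real_asymp
  hence l0: "((\<lambda>u. arctan (z u)) \<longlongrightarrow> - (pi / 2)) (at_right 0)"
    by (rule filterlim_compose[OF tendsto_arctan_at_bot])
  have "filterlim z at_top at_top" unfolding z_def using c by real_asymp
  hence l1: "((\<lambda>u. arctan (z u)) \<longlongrightarrow> pi / 2) at_top"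
    by (rule filterlim_compose[OF tendsto_arctan_at_top])
  have ein: "einterval 0 \<infinity> = {0<..}" by (auto simp: einterval_def zero_ereal_def)
  have e0: "(((arctan \<circ> z) \<circ> real_of_ereal) \<longlongrightarrow> - (pi / 2)) (at_right 0)"
    using l0 unfolding zero_ereal_def ereal_tendsto_simps by (simp add: comp_def)
  have e1: "(((arctan \<circ> z) \<circ> real_of_ereal) \<longlongrightarrow> pi / 2) (at_left \<infinity>)"
    using l1 unfolding ereal_tendsto_simps by (simp add: comp_def)
  have d': "((arctan \<circ> z) has_real_derivative D u) (at u)" if "0 < ereal u" "ereal u < \<infinity>" for u
    using d[of u] that by (simp add: comp_def)
  have cont': "isCont D u" if "0 < ereal u" "ereal u < \<infinity>" for u
    using cont[of u] that by simp
  have nn': "AE u in lborel. 0 < ereal u \<longrightarrow> ereal u < \<infinity> \<longrightarrow> 0 \<le> D u"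
    using nn by (intro AE_I2) simp
  note FTC = interval_integral_FTC_nonneg[OF _ d' cont' nn' e0 e1]
  have iD: "set_integrable lborel {0<..} D" using FTC(1) by (simp add: ein)
  have LD: "(LINT u:{0<..}|lborel. D u) = pi"
    using FTC(2) by (simp add: interval_lebesgue_integral_def ein)
  have le: "sub_majorant c u \<le> 2 * exp (- 2 * c) * D u" if u: "u > 0" for u
  proof -
    have "exp (-u) * exp (- (c\<^sup>2 / u)) = exp (- 2 * c) * exp (- (z u)\<^sup>2)"
      unfolding z2[OF u] by (simp add: exp_add[symmetric])
    also have "exp (- (z u)\<^sup>2) \<le> inverse (1 + (z u)\<^sup>2)"
      using exp_ge_add_one_self[of "(z u)\<^sup>2"] by (simp add: exp_minus add_pos_nonneg le_imp_inverse_le)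
    finally have *: "exp (-u) * exp (- (c\<^sup>2 / u)) \<le> exp (- 2 * c) * inverse (1 + (z u)\<^sup>2)" by simp
    have "sub_majorant c u = ((1 + c / u) / sqrt u) * (exp (-u) * exp (- (c\<^sup>2 / u)))" by (simp add: sub_majorant_def)
    also have "\<dots> \<le> ((1 + c / u) / sqrt u) * (exp (- 2 * c) * inverse (1 + (z u)\<^sup>2))"
      using u c by (intro mult_left_mono *) auto
    also have "\<dots> = 2 * exp (- 2 * c) * D u" by (simp add: D_def)
    finally show ?thesis .
  qed
  have nnw: "sub_majorant c u \<ge> 0" if "u > 0" for u unfolding sub_majorant_def using that c by simp
  have iD2: "set_integrable lborel {0<..} (\<lambda>u. 2 * exp (- 2 * c) * D u)"
    using iD by (simp add: set_integrable_mult_right)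
  show i: "set_integrable lborel {0<..} (sub_majorant c)"
  proof (rule set_integrable_bound[OF iD2])
    show "set_borel_measurable lborel {0<..} (sub_majorant c)"
      unfolding set_borel_measurable_def sub_majorant_def by measurable
    show "AE u in lborel. u \<in> {0<..} \<longrightarrow> norm (sub_majorant c u) \<le> norm (2 * exp (- 2 * c) * D u)"
      using le nn nnw by (intro AE_I2) (auto intro: order_trans[OF _ abs_ge_self])
  qed
  have "(LINT u:{0<..}|lborel. sub_majorant c u) \<le> (LINT u:{0<..}|lborel. 2 * exp (- 2 * c) * D u)"
    by (rule set_integral_mono[OF i iD2]) (use le in auto)
  also have "\<dots> = 2 * pi * exp (- 2 * c)" by (simp add: LD)
  finally show "(LINT u:{0<..}|lborel. sub_majorant c u) \<le> 2 * pi * exp (- 2 * c)" .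
qed

definition subordinate :: "(real \<Rightarrow> real) \<Rightarrow> real \<Rightarrow> real" where
  "subordinate \<phi> t = 1 / sqrt pi * (LINT u:{0<..}|lborel. exp (-u) / sqrt u * \<phi> (t\<^sup>2 / (4 * u)))"

lemma set_lborel_bound:
  fixes h w :: "real \<Rightarrow> real"
  assumes h: "continuous_on {0<..} h" and w: "set_integrable lborel {0<..} w"
    and b: "\<And>u. u > 0 \<Longrightarrow> \<bar>h u\<bar> \<le> C * w u"
  shows "set_integrable lborel {0<..} h"
    and "\<bar>LINT u:{0<..}|lborel. h u\<bar> \<le> C * (LINT u:{0<..}|lborel. w u)"
proof -
  have Cw: "set_integrable lborel {0<..} (\<lambda>u. C * w u)" using w by (simp add: set_integrable_mult_right)
  have m: "set_borel_measurable lborel {0<..} h"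
    unfolding set_borel_measurable_def using borel_measurable_continuous_on_indicator[OF _ h] by simp
  show i: "set_integrable lborel {0<..} h"
    by (rule set_integrable_bound[OF Cw m]) (use b in \<open>auto intro!: AE_I2 order_trans[OF _ abs_ge_self]\<close>)
  have "\<bar>LINT u:{0<..}|lborel. h u\<bar> \<le> (LINT u:{0<..}|lborel. \<bar>h u\<bar>)"
    unfolding set_lebesgue_integral_def using integral_abs_bound[of lborel "\<lambda>u. indicator {0<..} u *\<^sub>R h u"]
    by (simp add: abs_mult)
  also have "\<dots> \<le> (LINT u:{0<..}|lborel. C * w u)"
    by (rule set_integral_mono[OF set_integrable_abs[OF i] Cw]) (use b in auto)
  finally show "\<bar>LINT u:{0<..}|lborel. h u\<bar> \<le> C * (LINT u:{0<..}|lborel. w u)" by simp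
qed

text \<open>With \<open>c = \<surd>d t / 2\<close> one has \<open>d t\<^sup>2 / (4 u) = c\<^sup>2 / u\<close>.\<close>

lemma subordinate_integrand_bound:
  fixes d t u K y :: real
  assumes d: "d > 0" and t: "t > 0" and u: "u > 0" and y: "\<bar>y\<bar> \<le> K * exp (- d * (t\<^sup>2 / (4 * u)))" and K: "K \<ge> 0"
  shows "\<bar>exp (-u) / sqrt u * y\<bar> \<le> K * sub_majorant (sqrt d * t / 2) u"
    and "\<bar>exp (-u) / sqrt u * (t / (2 * u) * y)\<bar> \<le> K / sqrt d * sub_majorant (sqrt d * t / 2) u"
proof -
  let ?c = "sqrt d * t / 2"
  have c: "?c > 0" "?c\<^sup>2 = d * t\<^sup>2 / 4" using d t by (auto simp: power_divide power_mult_distrib)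
  define E where "E = exp (-u) / sqrt u * exp (- (?c\<^sup>2 / u))"
  have E: "E \<ge> 0" using u by (simp add: E_def)
  have "- d * (t\<^sup>2 / (4 * u)) = - (?c\<^sup>2 / u)" unfolding c(2) by simp
  hence "exp (-u) / sqrt u * \<bar>y\<bar> \<le> exp (-u) / sqrt u * (K * exp (- (?c\<^sup>2 / u)))"
    using y u by (intro mult_left_mono) auto
  hence yE: "exp (-u) / sqrt u * \<bar>y\<bar> \<le> K * E" by (simp add: E_def mult_ac)
  have W: "sub_majorant ?c u = E + ?c / u * E" by (simp only: sub_majorant_def E_def distrib_right mult_1_left)
  have "\<bar>exp (-u) / sqrt u * y\<bar> = exp (-u) / sqrt u * \<bar>y\<bar>" using u by (simp add: abs_mult)
  also have "\<dots> \<le> K * E" by (rule yE)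
  also have "\<dots> \<le> K * sub_majorant ?c u" unfolding W using K E c u by (intro mult_left_mono) auto
  finally show "\<bar>exp (-u) / sqrt u * y\<bar> \<le> K * sub_majorant ?c u" .
  have "\<bar>exp (-u) / sqrt u * (t / (2 * u) * y)\<bar> = t / (2 * u) * (exp (-u) / sqrt u * \<bar>y\<bar>)"
    using u t by (simp add: abs_mult mult_ac)
  also have "\<dots> \<le> t / (2 * u) * (K * E)" using u t by (intro mult_left_mono yE) auto
  also have "\<dots> = K / sqrt d * (?c / u * E)" using d u by (simp add: field_simps)
  also have "\<dots> \<le> K / sqrt d * sub_majorant ?c u" unfolding W using K E d by (intro mult_left_mono) auto
  finally show "\<bar>exp (-u) / sqrt u * (t / (2 * u) * y)\<bar> \<le> K / sqrt d * sub_majorant ?c u" .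
qed

lemma continuous_on_subordinate_integrand:
  fixes \<phi> :: "real \<Rightarrow> real"
  assumes "continuous_on {0<..} \<phi>" "t > 0"
  shows "continuous_on {0<..} (\<lambda>u. \<phi> (t\<^sup>2 / (4 * u)))"
  by (rule continuous_on_compose2[OF assms(1)]) (use assms(2) in \<open>auto intro!: continuous_intros\<close>)

lemma subordinate_decay:
  fixes \<phi> :: "real \<Rightarrow> real"
  assumes d: "d > 0" and K: "K \<ge> 0" and \<phi>: "continuous_on {0<..} \<phi>"
    and b: "\<And>s. s > 0 \<Longrightarrow> \<bar>\<phi> s\<bar> \<le> K * exp (- d * s)" and t: "t > 0"
  shows "\<bar>subordinate \<phi> t\<bar> \<le> 2 * sqrt pi * K * exp (- sqrt d * t)"
    and "set_integrable lborel {0<..} (\<lambda>u. exp (-u) / sqrt u * \<phi> (t\<^sup>2 / (4 * u)))"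
proof -
  let ?c = "sqrt d * t / 2"
  have c: "?c > 0" using d t by simp
  have cont: "continuous_on {0<..} (\<lambda>u. exp (-u) / sqrt u * \<phi> (t\<^sup>2 / (4 * u)))"
    using continuous_on_subordinate_integrand[OF \<phi> t] by (intro continuous_intros) auto
  have bd: "\<bar>exp (-u) / sqrt u * \<phi> (t\<^sup>2 / (4 * u))\<bar> \<le> K * sub_majorant ?c u" if "u > 0" for u
    using that t by (intro subordinate_integrand_bound(1)[OF d t that _ K] b) auto
  show "set_integrable lborel {0<..} (\<lambda>u. exp (-u) / sqrt u * \<phi> (t\<^sup>2 / (4 * u)))"
    by (rule set_lborel_bound(1)[OF cont sub_majorant_integral(1)[OF c] bd])
  have "\<bar>subordinate \<phi> t\<bar> = 1 / sqrt pi * \<bar>LINT u:{0<..}|lborel. exp (-u) / sqrt u * \<phi> (t\<^sup>2 / (4 * u))\<bar>"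
    by (simp add: subordinate_def abs_mult)
  also have "\<dots> \<le> 1 / sqrt pi * (K * (2 * pi * exp (- 2 * ?c)))"
    using set_lborel_bound(2)[OF cont sub_majorant_integral(1)[OF c] bd]
      mult_left_mono[OF sub_majorant_integral(2)[OF c] K] by (intro mult_left_mono) auto
  also have "\<dots> = 2 * (pi / sqrt pi) * K * exp (- sqrt d * t)" by simp
  also have "pi / sqrt pi = sqrt pi" by (simp add: real_div_sqrt)
  finally show "\<bar>subordinate \<phi> t\<bar> \<le> 2 * sqrt pi * K * exp (- sqrt d * t)" .
qed

text \<open>Differentiation under the integral on \<open>(t/2, 2t)\<close>; there the integrand of the derivative is at
  most four times its majorant at time \<open>t/2\<close>.\<close>

lemma subordinate_DERIV:
  fixes \<phi> \<psi> :: "real \<Rightarrow> real"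
  assumes d: "d > 0" and K: "K \<ge> 0" and L: "L \<ge> 0" and \<psi>: "continuous_on {0<..} \<psi>"
    and D: "\<And>s. s > 0 \<Longrightarrow> (\<phi> has_real_derivative \<psi> s) (at s)"
    and b\<phi>: "\<And>s. s > 0 \<Longrightarrow> \<bar>\<phi> s\<bar> \<le> K * exp (- d * s)"
    and b\<psi>: "\<And>s. s > 0 \<Longrightarrow> \<bar>\<psi> s\<bar> \<le> L * exp (- d * s)" and t: "t > 0"
  obtains y where "(subordinate \<phi> has_real_derivative y) (at t)"
    "\<bar>y\<bar> \<le> 2 * sqrt pi * L / sqrt d * exp (- sqrt d * t)"
proof -
  let ?c = "sqrt d * t / 2"
  have c: "?c > 0" using d t by simp
  have \<phi>: "continuous_on {0<..} \<phi>"
    using D by (auto intro!: continuous_at_imp_continuous_on DERIV_isCont)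
  define g where "g = (\<lambda>t u. exp (-u) / sqrt u * (t / (2 * u) * \<psi> (t\<^sup>2 / (4 * u))))"
  have cg: "continuous_on {0<..} (g t)"
    unfolding g_def using continuous_on_subordinate_integrand[OF \<psi> t] by (intro continuous_intros) auto
  have bg: "\<bar>g t u\<bar> \<le> L / sqrt d * sub_majorant (sqrt d * t / 2) u" if "u > 0" "t > 0" for t u
    unfolding g_def using that by (intro subordinate_integrand_bound(2)[OF d that(2) that(1) _ L] b\<psi>) auto
  let ?w = "\<lambda>u. indicator {0<..} u * (4 * L / sqrt d * sub_majorant (sqrt d * (t / 2) / 2) u)"
  have "((\<lambda>t. \<integral>u. indicator {0<..} u * (exp (-u) / sqrt u * \<phi> (t\<^sup>2 / (4 * u))) \<partial>lborel) has_real_derivative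
     (\<integral>u. indicator {0<..} u * g t u \<partial>lborel)) (at t)"
  proof (rule DERIV_lebesgue_integral[where a = "t / 2" and b = "2 * t" and w = ?w])
    show "t \<in> {t / 2<..<2 * t}" using t by auto
    show "integrable lborel (\<lambda>u. indicator {0<..} u * (exp (-u) / sqrt u * \<phi> (s\<^sup>2 / (4 * u))))" if "s \<in> {t / 2<..<2 * t}" for s
      using subordinate_decay(2)[OF d K \<phi> b\<phi>, of s] that t by (simp add: set_integrable_def)
    show "((\<lambda>s. indicator {0<..} u * (exp (-u) / sqrt u * \<phi> (s\<^sup>2 / (4 * u)))) has_real_derivative indicator {0<..} u * g s u) (at s)"
      if s: "s \<in> {t / 2<..<2 * t}" for s u
    proof (cases "u > 0")
      case True
      have s0: "s > 0" using s t by auto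
      have "((\<lambda>s. s\<^sup>2 / (4 * u)) has_real_derivative s / (2 * u)) (at s)"
        using True by (auto intro!: derivative_eq_intros simp: field_simps)
      from DERIV_chain2[OF D this] have "((\<lambda>s. \<phi> (s\<^sup>2 / (4 * u))) has_real_derivative \<psi> (s\<^sup>2 / (4 * u)) * (s / (2 * u))) (at s)"
        using True s0 by simp
      from DERIV_cmult[OF this, of "exp (-u) / sqrt u"] show ?thesis
        using True by (simp add: g_def mult_ac)
    qed simp
    have "t / 2 > 0" using t by simp
    hence "sqrt d * (t / 2) / 2 > 0" using d by simp
    from set_integrable_mult_right[OF sub_majorant_integral(1)[OF this], of "4 * L / sqrt d"]
    show "integrable lborel ?w" by (simp add: set_integrable_def)
    show "\<bar>indicator {0<..} u * g s u\<bar> \<le> ?w u" if s: "s \<in> {t / 2<..<2 * t}" for s u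
    proof (cases "u > 0")
      case True
      have s': "0 < s" "t / 2 \<le> s" "s \<le> 4 * (t / 2)" using s t by auto
      let ?E = "L * exp (- d * ((t / 2)\<^sup>2 / (4 * u)))"
      have "\<bar>\<psi> (s\<^sup>2 / (4 * u))\<bar> \<le> L * exp (- d * (s\<^sup>2 / (4 * u)))"
        using True s' by (intro b\<psi>) auto
      also have "\<dots> \<le> ?E"
      proof -
        have "(t / 2)\<^sup>2 \<le> s\<^sup>2" using s' t by (intro power_mono) auto
        hence "d * ((t / 2)\<^sup>2 / (4 * u)) \<le> d * (s\<^sup>2 / (4 * u))"
          using d True by (intro mult_left_mono divide_right_mono) auto
        thus ?thesis using L by (intro mult_left_mono) auto
      qed
      finally have "\<bar>exp (-u) / sqrt u * (t / 2 / (2 * u) * \<psi> (s\<^sup>2 / (4 * u)))\<bar> \<le>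
          L / sqrt d * sub_majorant (sqrt d * (t / 2) / 2) u"
        using t by (intro subordinate_integrand_bound(2)[OF d _ True _ L]) auto
      hence "4 * \<bar>exp (-u) / sqrt u * (t / 2 / (2 * u) * \<psi> (s\<^sup>2 / (4 * u)))\<bar> \<le>
          4 * (L / sqrt d * sub_majorant (sqrt d * (t / 2) / 2) u)" by simp
      moreover have "\<bar>g s u\<bar> \<le> 4 * \<bar>exp (-u) / sqrt u * (t / 2 / (2 * u) * \<psi> (s\<^sup>2 / (4 * u)))\<bar>"
      proof -
        have "\<bar>g s u\<bar> = s * (exp (-u) / sqrt u / (2 * u) * \<bar>\<psi> (s\<^sup>2 / (4 * u))\<bar>)"
          using True s' by (simp add: g_def abs_mult)
        also have "\<dots> \<le> 4 * (t / 2) * (exp (-u) / sqrt u / (2 * u) * \<bar>\<psi> (s\<^sup>2 / (4 * u))\<bar>)"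
          using s' True by (intro mult_right_mono) auto
        also have "\<dots> = 4 * \<bar>exp (-u) / sqrt u * (t / 2 / (2 * u) * \<psi> (s\<^sup>2 / (4 * u)))\<bar>"
          using True t by (simp add: abs_mult)
        finally show ?thesis .
      qed
      ultimately show ?thesis using True by simp
    qed simp
  qed
  from DERIV_cmult[OF this, of "1 / sqrt pi"]
  have DD: "(subordinate \<phi> has_real_derivative 1 / sqrt pi * (LINT u:{0<..}|lborel. g t u)) (at t)"
    by (simp add: subordinate_def[abs_def] set_lebesgue_integral_def)
  have "\<bar>1 / sqrt pi * (LINT u:{0<..}|lborel. g t u)\<bar> = 1 / sqrt pi * \<bar>LINT u:{0<..}|lborel. g t u\<bar>"
    by (simp add: abs_mult)
  also have "\<dots> \<le> 1 / sqrt pi * (L / sqrt d * (2 * pi * exp (- 2 * ?c)))"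
  proof (intro mult_left_mono)
    have "\<bar>LINT u:{0<..}|lborel. g t u\<bar> \<le> L / sqrt d * (LINT u:{0<..}|lborel. sub_majorant ?c u)"
      by (rule set_lborel_bound(2)[OF cg sub_majorant_integral(1)[OF c]]) (use bg t in blast)
    also have "\<dots> \<le> L / sqrt d * (2 * pi * exp (- 2 * ?c))"
      using L d by (intro mult_left_mono sub_majorant_integral(2)[OF c]) auto
    finally show "\<bar>LINT u:{0<..}|lborel. g t u\<bar> \<le> L / sqrt d * (2 * pi * exp (- 2 * ?c))" .
  qed simp
  also have "\<dots> = 2 * (pi / sqrt pi) * L / sqrt d * exp (- sqrt d * t)" by simp
  also have "pi / sqrt pi = sqrt pi" by (simp add: real_div_sqrt)
  finally show thesis using that[OF DD] by simp
qed

context jacobi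
begin

lemma p_0_const: "p 0 x = p 0 0"
proof -
  have "poly (p1 i 0) z = poly (p1 i 0) 0" for i z
    using degree_jacobi_poly[OF \<alpha> \<beta>, of 0 i i] by (auto elim!: degree_eq_zeroE)
  thus ?thesis unfolding jacobi_multi_def by (intro prod.cong refl) simp
qed

lemma fourier_0: "fourier f 0 = p 0 0 * (\<integral>x. f x \<partial>\<mu>)"
proof -
  have "fourier f 0 = (\<integral>x. f x * p 0 0 \<partial>\<mu>)" unfolding fourier_def by (subst p_0_const) (rule refl)
  thus ?thesis by (simp add: mult.commute)
qed

lemma poisson_jacobi_eq: "poisson t f x = subordinate (\<lambda>s. heat s f x) t"
  by (simp add: poisson_jacobi_def subordinate_def)

text \<open>Subordination applied to the decay of \<open>T\<^sub>s f\<close> and \<open>T\<^sub>s \<L>f\<close>. Both have mean zero: \<open>f\<close> by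
  assumption, \<open>\<L>f\<close> because \<open>\<lambda>\<^sub>0 = 0\<close>.\<close>

theorem poisson_jacobi_decay:
  assumes f: "C2_on cube f" and 0: "(\<integral>x. f x \<partial>\<mu>) = 0"
  obtains C where "C \<ge> 0"
    "\<And>x t. x \<in> cube \<Longrightarrow> t > 0 \<Longrightarrow> (\<lambda>s. poisson s f x) differentiable (at t) \<and>
      \<bar>deriv (\<lambda>s. poisson s f x) t\<bar> \<le> C * exp (- sqrt (gap) * t) \<and>
      \<bar>poisson t f x\<bar> \<le> C * exp (- sqrt (gap) * t)"
proof -
  let ?d = "gap"
  note d = min_eigenvalue_pos
  obtain G H where f': "\<And>x. x \<in> cube \<Longrightarrow> (f has_derivative (\<lambda>h. G x \<bullet> h)) (at x within cube)"
    "\<And>x. x \<in> cube \<Longrightarrow> (G has_derivative (\<lambda>h. H x *v h)) (at x within cube)" "continuous_on cube H"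
    using f unfolding C2_on_def by blast
  let ?g = "generator G H"
  have fg: "\<And>\<kappa>. fourier ?g \<kappa> = - ev \<kappa> * fourier f \<kappa>" and cg: "continuous_on cube ?g" and cf: "continuous_on cube f"
    using fourier_generator[OF f'] by auto
  obtain K where K: "K \<ge> 0" "\<And>s x. s > 0 \<Longrightarrow> x \<in> cube \<Longrightarrow> \<bar>heat s f x\<bar> \<le> K * exp (- ?d * s)"
    using heat_decay[OF cf] 0 by (auto simp: fourier_0)
  obtain L where L: "L \<ge> 0" "\<And>s x. s > 0 \<Longrightarrow> x \<in> cube \<Longrightarrow> \<bar>heat s ?g x\<bar> \<le> L * exp (- ?d * s)"
    using heat_decay[OF cg] by (auto simp: fg ev_0)
  define C where "C = 2 * sqrt pi * K + 2 * sqrt pi * L / sqrt ?d"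
  have nn: "0 \<le> 2 * sqrt pi * K" "0 \<le> 2 * sqrt pi * L / sqrt ?d" using K(1) L(1) d by auto
  show thesis
  proof (rule that[of C])
    show "C \<ge> 0" using nn by (simp add: C_def)
    fix x :: "real^'d" and t :: real assume x: "x \<in> cube" and t: "t > 0"
    let ?\<phi> = "\<lambda>s. heat s f x" and ?\<psi> = "\<lambda>s. heat s ?g x"
    have D: "(?\<phi> has_real_derivative ?\<psi> s) (at s)" if "s > 0" for s
      using heat_derivative[OF cf x that] cg fg by blast
    have c\<psi>: "continuous_on {0<..} ?\<psi>"
      using heat_derivative[OF cg x] by (auto intro!: continuous_at_imp_continuous_on dest!: DERIV_isCont)
    have c\<phi>: "continuous_on {0<..} ?\<phi>"
      using D by (auto intro!: continuous_at_imp_continuous_on DERIV_isCont)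
    obtain y where y: "(subordinate ?\<phi> has_real_derivative y) (at t)" "\<bar>y\<bar> \<le> 2 * sqrt pi * L / sqrt ?d * exp (- sqrt ?d * t)"
      by (rule subordinate_DERIV[OF d K(1) L(1) c\<psi> D K(2)[OF _ x] L(2)[OF _ x] t])
    have E: "a \<le> C * exp (- sqrt ?d * t)" if "a \<le> b * exp (- sqrt ?d * t)" "b \<le> C" for a b
      using that by (meson exp_ge_zero mult_right_mono order_trans)
    have P: "(\<lambda>s. poisson s f x) = subordinate ?\<phi>" by (simp add: fun_eq_iff poisson_jacobi_eq)
    have "\<bar>y\<bar> \<le> C * exp (- sqrt ?d * t)" using E[OF y(2)] nn(1) by (simp add: C_def)
    moreover have "\<bar>subordinate ?\<phi> t\<bar> \<le> C * exp (- sqrt ?d * t)"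
      using E[OF subordinate_decay(1)[OF d K(1) c\<phi> K(2)[OF _ x] t]] nn(2) by (simp add: C_def)
    ultimately show "(\<lambda>s. poisson s f x) differentiable (at t) \<and>
      \<bar>deriv (\<lambda>s. poisson s f x) t\<bar> \<le> C * exp (- sqrt ?d * t) \<and>
      \<bar>poisson t f x\<bar> \<le> C * exp (- sqrt ?d * t)"
      unfolding P poisson_jacobi_eq[of t] using y(1) DERIV_imp_deriv[OF y(1)] by (auto simp: real_differentiable_def)
  qed
qed

end

section \<open>Decomposition of the Hilbert space into chaoses\<close>

lemma L2_mult_integrable:
  assumes "f \<in> L2_space M" "g \<in> L2_space M"
  shows "integrable M (\<lambda>x. f x * g x)"
proof (rule Bochner_Integration.integrable_bound)
  show "integrable M (\<lambda>x. (f x)\<^sup>2 + (g x)\<^sup>2)" using assms by (auto simp: L2_space_def)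
  show "(\<lambda>x. f x * g x) \<in> borel_measurable M" using assms by (auto simp: L2_space_def)
  have "\<bar>a * b\<bar> \<le> a\<^sup>2 + b\<^sup>2" for a b :: real
  proof -
    have "0 \<le> (\<bar>a\<bar> - \<bar>b\<bar>)\<^sup>2" "0 \<le> \<bar>a * b\<bar>" by auto
    thus ?thesis unfolding power2_diff abs_mult power2_abs by linarith
  qed
  thus "AE x in M. norm (f x * g x) \<le> norm ((f x)\<^sup>2 + (g x)\<^sup>2)"
    by (intro AE_I2) (simp add: order_trans[OF _ abs_ge_self])
qed

lemma L2_add:
  assumes "f \<in> L2_space M" "g \<in> L2_space M"
  shows "(\<lambda>x. f x + g x) \<in> L2_space M"
proof -
  have "integrable M (\<lambda>x. (f x)\<^sup>2 + (g x)\<^sup>2 + 2 * (f x * g x))"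
    using assms L2_mult_integrable[OF assms]
    by (intro Bochner_Integration.integrable_add integrable_mult_right) (auto simp: L2_space_def)
  also have "(\<lambda>x. (f x)\<^sup>2 + (g x)\<^sup>2 + 2 * (f x * g x)) = (\<lambda>x. (f x + g x)\<^sup>2)"
    by (simp add: power2_sum mult.assoc)
  finally show ?thesis using assms by (auto simp: L2_space_def)
qed

lemma L2_cmult: "f \<in> L2_space M \<Longrightarrow> (\<lambda>x. c * f x) \<in> L2_space M"
  by (auto simp: L2_space_def power_mult_distrib)

lemma L2_diff:
  assumes "f \<in> L2_space M" "g \<in> L2_space M"
  shows "(\<lambda>x. f x - g x) \<in> L2_space M"
  using L2_add[OF assms(1) L2_cmult[OF assms(2), of "-1"]] by simp

lemma L2_sum: "(\<And>i. i \<in> I \<Longrightarrow> f i \<in> L2_space M) \<Longrightarrow> (\<lambda>x. \<Sum>i\<in>I. f i x) \<in> L2_space M"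
proof (induction I rule: infinite_finite_induct)
  case (insert i I)
  have "(\<lambda>x. f i x + (\<Sum>i\<in>I. f i x)) \<in> L2_space M" using insert by (intro L2_add) auto
  thus ?case using insert by simp
qed (auto simp: L2_space_def)

text \<open>The quadratic polynomial \<open>t \<mapsto> \<integral> (t f + g)\<^sup>2\<close> is nonnegative.\<close>

lemma L2_Cauchy_Schwarz:
  assumes f: "f \<in> L2_space M" and g: "g \<in> L2_space M"
  shows "\<bar>\<integral>x. f x * g x \<partial>M\<bar> \<le> L2_norm M f * L2_norm M g"
proof -
  define A where "A = (\<integral>x. (f x)\<^sup>2 \<partial>M)"
  define B where "B = (\<integral>x. (g x)\<^sup>2 \<partial>M)"
  define C where "C = (\<integral>x. f x * g x \<partial>M)"
  have i: "integrable M (\<lambda>x. (f x)\<^sup>2)" "integrable M (\<lambda>x. (g x)\<^sup>2)" "integrable M (\<lambda>x. f x * g x)"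
    using f g L2_mult_integrable[OF f g] by (auto simp: L2_space_def)
  have A0: "A \<ge> 0" and B0: "B \<ge> 0" by (auto simp: A_def B_def intro!: integral_nonneg_AE)
  have quad: "0 \<le> t\<^sup>2 * A + 2 * t * C + B" for t
  proof -
    have "0 \<le> (\<integral>x. (t * f x + g x)\<^sup>2 \<partial>M)" by (intro integral_nonneg_AE) auto
    also have "(\<lambda>x. (t * f x + g x)\<^sup>2) = (\<lambda>x. t\<^sup>2 * (f x)\<^sup>2 + (2 * t) * (f x * g x) + (g x)\<^sup>2)"
      by (simp add: power2_sum power_mult_distrib algebra_simps)
    also have "(\<integral>x. t\<^sup>2 * (f x)\<^sup>2 + (2 * t) * (f x * g x) + (g x)\<^sup>2 \<partial>M) = t\<^sup>2 * A + (2 * t) * C + B"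
      unfolding A_def B_def C_def using i
      by (simp add: Bochner_Integration.integral_add)
    finally show ?thesis .
  qed
  have "C\<^sup>2 \<le> A * B"
  proof (cases "A = 0")
    case True
    have "C = 0"
    proof (rule ccontr)
      assume "C \<noteq> 0"
      thus False using quad[of "- (B + 1) / (2 * C)"] True by (simp add: field_simps)
    qed
    thus ?thesis using True by simp
  next
    case False
    hence A: "A > 0" using A0 by simp
    have "0 \<le> (- C / A)\<^sup>2 * A + 2 * (- C / A) * C + B" by (rule quad)
    also have "\<dots> = B - C\<^sup>2 / A" using A by (simp add: field_simps power2_eq_square)
    finally show ?thesis using A by (simp add: field_simps)
  qed
  hence "sqrt (C\<^sup>2) \<le> sqrt (A * B)" by (rule real_sqrt_le_mono)
  thus ?thesis by (simp add: L2_norm_def A_def B_def C_def real_sqrt_mult)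
qed

lemma L2_closed_span_orthogonal:
  assumes g: "g \<in> L2_space M" and B: "B \<subseteq> L2_space M" and orth: "\<And>b. b \<in> B \<Longrightarrow> (\<integral>x. b x * g x \<partial>M) = 0"
    and f: "f \<in> L2_closed_span M B"
  shows "(\<integral>x. f x * g x \<partial>M) = 0"
proof -
  have fL: "f \<in> L2_space M" using f by (simp add: L2_closed_span_def)
  have "\<bar>\<integral>x. f x * g x \<partial>M\<bar> \<le> 0 + e" if e: "e > 0" for e
  proof -
    have ng: "L2_norm M g \<ge> 0" by (simp add: L2_norm_def integral_nonneg_AE)
    define \<epsilon> where "\<epsilon> = e / (L2_norm M g + 1)"
    have \<epsilon>: "\<epsilon> > 0" "\<epsilon> * L2_norm M g \<le> e" using e ng by (auto simp: \<epsilon>_def field_simps add_nonneg_pos)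
    obtain F c where F: "finite F" "F \<subseteq> B" "L2_norm M (\<lambda>x. f x - (\<Sum>b\<in>F. c b * b x)) < \<epsilon>"
      using f \<epsilon>(1) unfolding L2_closed_span_def by blast
    have h: "(\<lambda>x. \<Sum>b\<in>F. c b * b x) \<in> L2_space M" using F(2) B by (intro L2_sum L2_cmult) auto
    have r: "(\<lambda>x. f x - (\<Sum>b\<in>F. c b * b x)) \<in> L2_space M" by (rule L2_diff[OF fL h])
    have "(\<integral>x. (\<Sum>b\<in>F. c b * b x) * g x \<partial>M) = (\<integral>x. (\<Sum>b\<in>F. c b * (b x * g x)) \<partial>M)"
      by (simp add: sum_distrib_right mult.assoc)
    also have "\<dots> = (\<Sum>b\<in>F. c b * (\<integral>x. b x * g x \<partial>M))"
      using F(2) B by (subst Bochner_Integration.integral_sum) (auto intro!: L2_mult_integrable g)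
    also have "\<dots> = 0" using orth F(2) by (intro sum.neutral) auto
    finally have "(\<integral>x. f x * g x \<partial>M) = (\<integral>x. (f x - (\<Sum>b\<in>F. c b * b x)) * g x \<partial>M)"
      using L2_mult_integrable[OF fL g] L2_mult_integrable[OF h g] by (simp add: left_diff_distrib)
    hence "\<bar>\<integral>x. f x * g x \<partial>M\<bar> \<le> L2_norm M (\<lambda>x. f x - (\<Sum>b\<in>F. c b * b x)) * L2_norm M g"
      using L2_Cauchy_Schwarz[OF r g] by simp
    also have "\<dots> \<le> \<epsilon> * L2_norm M g" using F(3) ng by (intro mult_right_mono) auto
    finally show ?thesis using \<epsilon>(2) by simp
  qed
  hence "\<bar>\<integral>x. f x * g x \<partial>M\<bar> \<le> 0" by (rule field_le_epsilon)
  thus ?thesis by simp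
qed

context jacobi
begin

lemma L2_continuous:
  assumes "continuous_on cube f"
  shows "f \<in> L2_space \<mu>"
  using assms unfolding L2_space_def
  by (auto intro!: borel_measurable_\<mu>_continuous integrable_\<mu>_continuous continuous_intros)

text \<open>Regularity of the measure encloses \<open>A\<close> between a compact and an open set of almost the same
  measure; a Urysohn function between them differs from the indicator only on the gap.\<close>

lemma indicator_L1_approx:
  assumes A: "A \<in> sets \<mu>" and e: "e > 0"
  obtains g :: "real^'d \<Rightarrow> real" where "continuous_on UNIV g" "(\<integral>x. \<bar>indicator A x - g x\<bar> \<partial>\<mu>) < e"
proof -
  have A': "A \<in> sets borel" "A \<subseteq> cube"
    using A unfolding jacobi_measure_eq_restrict by (auto simp: sets_restrict_space_iff)
  note [measurable] = A'(1)
  have fin: "emeasure extended_measure (space extended_measure) \<noteq> \<infinity>" by simp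
  let ?m = "measure extended_measure"
  have "\<exists>K. K \<subseteq> A \<and> compact K \<and> ?m A - e / 2 < ?m K"
  proof (cases "?m A = 0")
    case True
    thus ?thesis using e by (intro exI[of _ "{}"]) auto
  next
    case False
    hence "0 < ?m A" by (simp add: zero_less_measure_iff)
    hence "ennreal (?m A - e / 2) < ennreal (?m A)" using e by (intro ennreal_lessI) auto
    also have "ennreal (?m A) = (SUP K \<in> {K. K \<subseteq> A \<and> compact K}. emeasure extended_measure K)"
      using inner_regular[OF sets_extended_measure fin A'(1)] by (simp add: E.emeasure_eq_measure)
    finally obtain K where K: "K \<subseteq> A" "compact K" "ennreal (?m A - e / 2) < ennreal (?m K)"
      unfolding less_SUP_iff by (auto simp: E.emeasure_eq_measure)
    have "?m A - e / 2 < ?m K"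
    proof (rule ccontr)
      assume "\<not> ?m A - e / 2 < ?m K"
      hence "ennreal (?m K) \<le> ennreal (?m A - e / 2)" by (intro ennreal_leI) simp
      thus False using K(3) by simp
    qed
    thus ?thesis using K by blast
  qed
  then obtain K where K: "K \<subseteq> A" "compact K" "?m A - e / 2 < ?m K" by blast
  have "ennreal (?m A) < ennreal (?m A + e / 2)" using e by (intro ennreal_lessI) (auto simp: add_nonneg_pos)
  moreover have "ennreal (?m A) = (INF U \<in> {U. A \<subseteq> U \<and> open U}. emeasure extended_measure U)"
    using outer_regular[OF sets_extended_measure fin A'(1)] by (simp add: E.emeasure_eq_measure)
  ultimately obtain U where U: "A \<subseteq> U" "open U" "ennreal (?m U) < ennreal (?m A + e / 2)"
    unfolding INF_less_iff by (auto simp: INF_less_iff E.emeasure_eq_measure)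
  have U': "?m U < ?m A + e / 2" using U(3) by (subst (asm) ennreal_less_iff) auto
  have [measurable]: "K \<in> sets borel" "U \<in> sets borel" using K(2) U(2) by (auto intro: compact_imp_closed borel_closed)
  obtain g :: "real^'d \<Rightarrow> real" where g: "continuous_on UNIV g" "\<And>x. g x \<in> closed_segment 1 0"
      "\<And>x. x \<in> K \<Longrightarrow> g x = 1" "\<And>x. x \<in> - U \<Longrightarrow> g x = 0"
    by (rule Urysohn[of K "- U" 1 0]) (use K U in \<open>auto intro: compact_imp_closed simp: closed_Compl\<close>)
  have g01: "0 \<le> g x" "g x \<le> 1" for x using g(2)[of x] by (auto simp: closed_segment_eq_real_ivl)
  have [measurable]: "g \<in> borel_measurable borel" using g(1) by (rule borel_measurable_continuous_onI)
  have le: "\<bar>indicator A x - g x\<bar> \<le> indicator (U - K) x" for x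
    using g01[of x] g(3,4)[of x] K(1) U(1) by (auto simp: indicator_def)
  have "(\<integral>x. \<bar>indicator A x - g x\<bar> \<partial>\<mu>) \<le> (\<integral>x. indicator (U - K) x \<partial>extended_measure)"
    unfolding integral_\<mu>
  proof (rule integral_mono')
    show "integrable extended_measure (indicat_real (U - K))" by (intro integrable_real_indicator) (auto simp: less_top[symmetric])
    show "indicator cube x * \<bar>indicator A x - g x\<bar> \<le> indicat_real (U - K) x" for x
      using le[of x] by (auto simp: indicator_def)
  qed simp
  also have "\<dots> = ?m (U - K)" by simp
  also have "\<dots> = ?m U - ?m K" using K(1) U(1) by (intro E.finite_measure_Diff) auto
  also have "\<dots> < e" using K(3) U' by simp
  finally show thesis using that g(1) by blast
qed

lemma integrable_\<mu>_continuous_UNIV: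
  "continuous_on UNIV g \<Longrightarrow> integrable \<mu> (g :: real^'d \<Rightarrow> real)"
  by (rule integrable_\<mu>_continuous) (rule continuous_on_subset[OF _ subset_UNIV])

lemma integrable_\<mu>_abs_diff:
  "integrable \<mu> f \<Longrightarrow> continuous_on UNIV g \<Longrightarrow> integrable \<mu> (\<lambda>x. \<bar>f x - g x\<bar>)" for f g :: "real^'d \<Rightarrow> real"
  by (rule integrable_abs, rule Bochner_Integration.integrable_diff, assumption, rule integrable_\<mu>_continuous_UNIV)

lemma L1_approx:
  assumes "integrable \<mu> f" "e > 0"
  shows "\<exists>g :: real^'d \<Rightarrow> real. continuous_on UNIV g \<and> (\<integral>x. \<bar>f x - g x\<bar> \<partial>\<mu>) < e"
  using assms
proof (induction f arbitrary: e rule: integrable_induct)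
  case (base A c)
  have "e / (\<bar>c\<bar> + 1) > 0" using base by simp
  from indicator_L1_approx[OF base(1) this] obtain g :: "real^'d \<Rightarrow> real"
    where g: "continuous_on UNIV g" "(\<integral>x. \<bar>indicator A x - g x\<bar> \<partial>\<mu>) < e / (\<bar>c\<bar> + 1)" by blast
  have "(\<integral>x. \<bar>indicator A x *\<^sub>R c - c * g x\<bar> \<partial>\<mu>) = (\<integral>x. \<bar>c\<bar> * \<bar>indicator A x - g x\<bar> \<partial>\<mu>)"
    by (intro Bochner_Integration.integral_cong refl) (simp add: abs_mult[symmetric] algebra_simps)
  also have "\<dots> = \<bar>c\<bar> * (\<integral>x. \<bar>indicator A x - g x\<bar> \<partial>\<mu>)" by simp
  also have "\<dots> \<le> (\<bar>c\<bar> + 1) * (\<integral>x. \<bar>indicator A x - g x\<bar> \<partial>\<mu>)"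
    by (intro mult_right_mono integral_nonneg_AE) auto
  also have "\<dots> < e" using g(2) by (simp add: pos_less_divide_eq mult.commute)
  finally show ?case using g(1) by (intro exI[of _ "\<lambda>x. c * g x"]) (auto intro!: continuous_intros)
next
  case (add f1 f2)
  have e: "e / 2 > 0" using add.prems by simp
  obtain g1 where g1: "continuous_on UNIV g1" "(\<integral>x. \<bar>f1 x - g1 x\<bar> \<partial>\<mu>) < e / 2" using add.IH(1)[OF e] by blast
  obtain g2 where g2: "continuous_on UNIV g2" "(\<integral>x. \<bar>f2 x - g2 x\<bar> \<partial>\<mu>) < e / 2" using add.IH(2)[OF e] by blast
  have i: "integrable \<mu> (\<lambda>x. \<bar>f1 x - g1 x\<bar>)" "integrable \<mu> (\<lambda>x. \<bar>f2 x - g2 x\<bar>)"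
    using add.hyps g1(1) g2(1) by (auto intro: integrable_\<mu>_abs_diff)
  have "(\<integral>x. \<bar>f1 x + f2 x - (g1 x + g2 x)\<bar> \<partial>\<mu>) \<le> (\<integral>x. \<bar>f1 x - g1 x\<bar> + \<bar>f2 x - g2 x\<bar> \<partial>\<mu>)"
    by (rule integral_mono') (use i in auto)
  also have "\<dots> < e" using i g1(2) g2(2) by simp
  finally show ?case using g1(1) g2(1) by (intro exI[of _ "\<lambda>x. g1 x + g2 x"]) (auto intro!: continuous_intros)
next
  case (lim f s)
  have "(\<lambda>i. \<integral>x. \<bar>f x - s i x\<bar> \<partial>\<mu>) \<longlonglongrightarrow> (\<integral>x. 0 \<partial>\<mu>)"
  proof (rule integral_dominated_convergence[where w = "\<lambda>x. 3 * \<bar>f x\<bar>"])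
    show "AE x in \<mu>. (\<lambda>i. \<bar>f x - s i x\<bar>) \<longlonglongrightarrow> 0"
    proof (intro AE_I2)
      fix x assume "x \<in> space \<mu>"
      from tendsto_diff[OF tendsto_const[of "f x"] lim.hyps(2)[OF this]] show "(\<lambda>i. \<bar>f x - s i x\<bar>) \<longlonglongrightarrow> 0"
        by (simp add: tendsto_rabs_zero)
    qed
    show "AE x in \<mu>. norm \<bar>f x - s i x\<bar> \<le> 3 * \<bar>f x\<bar>" for i
    proof (intro AE_I2)
      fix x assume "x \<in> space \<mu>"
      from lim.hyps(3)[OF this, of i] show "norm \<bar>f x - s i x\<bar> \<le> 3 * \<bar>f x\<bar>" by simp
    qed
  qed (use lim.hyps in auto)
  hence "(\<lambda>i. \<integral>x. \<bar>f x - s i x\<bar> \<partial>\<mu>) \<longlonglongrightarrow> 0" by simp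
  moreover have e: "e / 2 > 0" using lim.prems by simp
  ultimately have "eventually (\<lambda>i. (\<integral>x. \<bar>f x - s i x\<bar> \<partial>\<mu>) < e / 2) sequentially" by (rule order_tendstoD)
  then obtain i where i: "(\<integral>x. \<bar>f x - s i x\<bar> \<partial>\<mu>) < e / 2"
    by (auto simp: eventually_sequentially)
  obtain g where g: "continuous_on UNIV g" "(\<integral>x. \<bar>s i x - g x\<bar> \<partial>\<mu>) < e / 2" using lim.IH[OF e] by blast
  have j: "integrable \<mu> (\<lambda>x. \<bar>f x - s i x\<bar>)" "integrable \<mu> (\<lambda>x. \<bar>s i x - g x\<bar>)"
    using lim.hyps g(1) by (auto intro: integrable_\<mu>_abs_diff)
  have "(\<integral>x. \<bar>f x - g x\<bar> \<partial>\<mu>) \<le> (\<integral>x. \<bar>f x - s i x\<bar> + \<bar>s i x - g x\<bar> \<partial>\<mu>)"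
    by (rule integral_mono') (use j in auto)
  also have "\<dots> < e" using j i g(2) by simp
  finally show ?case using g(1) by blast
qed

text \<open>Truncate \<open>f\<close>, approximate the truncation in \<open>L\<^sup>1\<close> by a continuous function, clamp that function at
  the same level so that \<open>L\<^sup>1\<close> closeness becomes \<open>L\<^sup>2\<close> closeness, and apply Weierstrass.\<close>

lemma L2_approx:
  assumes f: "f \<in> L2_space \<mu>" and e: "e > 0"
  obtains q where "q \<in> p_span" "(\<integral>x. (f x - q x)\<^sup>2 \<partial>\<mu>) < e"
proof -
  have fm [measurable]: "f \<in> borel_measurable \<mu>" and f2: "integrable \<mu> (\<lambda>x. (f x)\<^sup>2)"
    using f by (auto simp: L2_space_def)
  \<comment> \<open>three approximations follow, each with squared error at most \<open>e / 9\<close>; they combine by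
    \<open>(a + b + c)\<^sup>2 \<le> 3 (a\<^sup>2 + b\<^sup>2 + c\<^sup>2)\<close>\<close>
  define T where "T = (\<lambda>n x. max (- real n) (min (real n) (f x)))"
  have "(\<lambda>n. \<integral>x. (f x - T n x)\<^sup>2 \<partial>\<mu>) \<longlonglongrightarrow> (\<integral>x. 0 \<partial>\<mu>)"
  proof (rule integral_dominated_convergence[OF _ _ f2])
    show "AE x in \<mu>. (\<lambda>n. (f x - T n x)\<^sup>2) \<longlonglongrightarrow> 0"
    proof (intro AE_I2)
      fix x
      have "eventually (\<lambda>n. (f x - T n x)\<^sup>2 = 0) sequentially"
        using eventually_ge_at_top[of "nat \<lceil>\<bar>f x\<bar>\<rceil>"]
      proof eventually_elim
        case (elim n)
        hence "\<bar>f x\<bar> \<le> real n" by linarith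
        thus ?case by (simp add: T_def max_def min_def abs_le_iff)
      qed
      thus "(\<lambda>n. (f x - T n x)\<^sup>2) \<longlonglongrightarrow> 0" by (rule tendsto_eventually)
    qed
    show "AE x in \<mu>. norm ((f x - T n x)\<^sup>2) \<le> (f x)\<^sup>2" for n
    proof (intro AE_I2)
      fix x
      have "\<bar>f x - T n x\<bar> \<le> \<bar>f x\<bar>" by (auto simp: T_def max_def min_def)
      thus "norm ((f x - T n x)\<^sup>2) \<le> (f x)\<^sup>2" by (simp add: abs_le_square_iff)
    qed
  qed (auto simp: T_def)
  hence "(\<lambda>n. \<integral>x. (f x - T n x)\<^sup>2 \<partial>\<mu>) \<longlonglongrightarrow> 0" by simp
  hence "eventually (\<lambda>n. (\<integral>x. (f x - T n x)\<^sup>2 \<partial>\<mu>) < e / 9) sequentially"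
    using e by (intro order_tendstoD) auto
  then obtain n where n: "(\<integral>x. (f x - T n x)\<^sup>2 \<partial>\<mu>) < e / 9"
    by (auto simp: eventually_sequentially)
  have [measurable]: "T n \<in> borel_measurable \<mu>" unfolding T_def by measurable
  have Tb: "\<bar>T n x\<bar> \<le> real n" for x by (auto simp: T_def)
  have iT: "integrable \<mu> (T n)"
    by (rule M.integrable_const_bound[where B = "real n"]) (use Tb in auto)
  define e1 where "e1 = e / (9 * (2 * real n + 1))"
  have e1: "e1 > 0" "(2 * real n) * e1 \<le> e / 9" using e by (auto simp: e1_def field_simps)
  obtain g where g: "continuous_on UNIV g" "(\<integral>x. \<bar>T n x - g x\<bar> \<partial>\<mu>) < e1" using L1_approx[OF iT e1(1)] by blast
  define h where "h = (\<lambda>x. max (- real n) (min (real n) (g x)))"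
  have hc: "continuous_on cube h"
    unfolding h_def by (intro continuous_intros continuous_on_subset[OF g(1)]) auto
  have hb: "\<bar>T n x - h x\<bar> \<le> \<bar>T n x - g x\<bar>" "\<bar>T n x - h x\<bar> \<le> 2 * real n" for x
    using Tb[of x] by (auto simp: h_def max_def min_def abs_if split: if_splits)
  have igT: "integrable \<mu> (\<lambda>x. \<bar>T n x - g x\<bar>)" using iT g(1) by (rule integrable_\<mu>_abs_diff)
  have "(\<integral>x. (T n x - h x)\<^sup>2 \<partial>\<mu>) \<le> (\<integral>x. (2 * real n) * \<bar>T n x - g x\<bar> \<partial>\<mu>)"
  proof (rule integral_mono')
    show "integrable \<mu> (\<lambda>x. (2 * real n) * \<bar>T n x - g x\<bar>)" using igT by simp
    show "(T n x - h x)\<^sup>2 \<le> (2 * real n) * \<bar>T n x - g x\<bar>" for x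
      using mult_mono[OF hb(2)[of x] hb(1)[of x]] by (simp add: power2_eq_square abs_mult[symmetric])
  qed simp
  also have "\<dots> = (2 * real n) * (\<integral>x. \<bar>T n x - g x\<bar> \<partial>\<mu>)" by simp
  also have "\<dots> \<le> (2 * real n) * e1" using g(2) by (intro mult_left_mono) auto
  finally have 2: "(\<integral>x. (T n x - h x)\<^sup>2 \<partial>\<mu>) \<le> e / 9" using e1(2) by simp
  define e2 where "e2 = sqrt (e / (9 * (measure \<mu> cube + 1)))"
  have e2: "e2 > 0" "e2\<^sup>2 * measure \<mu> cube \<le> e / 9"
  proof -
    have m: "measure \<mu> cube + 1 > 0" by (simp add: add_nonneg_pos)
    show "e2 > 0" using e m by (simp add: e2_def)
    have "e2\<^sup>2 = e / (9 * (measure \<mu> cube + 1))" using e m by (simp add: e2_def)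
    also have "\<dots> * measure \<mu> cube \<le> e / 9" using e m by (simp add: field_simps)
    finally show "e2\<^sup>2 * measure \<mu> cube \<le> e / 9" .
  qed
  obtain q where q: "q \<in> p_span" "\<And>x. x \<in> cube \<Longrightarrow> \<bar>h x - q x\<bar> < e2" using p_span_approx[OF hc e2(1)] by blast
  have qc: "continuous_on cube q" using q(1) by (auto simp: p_span_def intro!: continuous_intros)
  have "(\<integral>x. (h x - q x)\<^sup>2 \<partial>\<mu>) \<le> (\<integral>x. e2\<^sup>2 \<partial>\<mu>)"
  proof (rule integral_mono')
    show "(h x - q x)\<^sup>2 \<le> e2\<^sup>2" if "x \<in> space \<mu>" for x
    proof -
      have "\<bar>h x - q x\<bar> \<le> \<bar>e2\<bar>" using q(2)[of x] that e2(1) by simp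
      thus ?thesis by (simp add: abs_le_square_iff)
    qed
  qed auto
  also have "\<dots> \<le> e / 9" using e2(2) by (simp add: mult.commute)
  finally have 3: "(\<integral>x. (h x - q x)\<^sup>2 \<partial>\<mu>) \<le> e / 9" .
  have L: "T n \<in> L2_space \<mu>" "h \<in> L2_space \<mu>" "q \<in> L2_space \<mu>"
  proof -
    have "integrable \<mu> (\<lambda>x. (T n x)\<^sup>2)"
      by (rule M.integrable_const_bound[where B = "(real n)\<^sup>2"])
         (use Tb in \<open>auto simp: abs_le_square_iff[symmetric]\<close>)
    thus "T n \<in> L2_space \<mu>" by (simp add: L2_space_def)
  qed (auto intro: L2_continuous hc qc)
  have i: "integrable \<mu> (\<lambda>x. (f x - T n x)\<^sup>2)" "integrable \<mu> (\<lambda>x. (T n x - h x)\<^sup>2)" "integrable \<mu> (\<lambda>x. (h x - q x)\<^sup>2)"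
    using L2_diff[OF f L(1)] L2_diff[OF L(1,2)] L2_diff[OF L(2,3)] by (auto simp: L2_space_def)
  have sq: "(a + b + c)\<^sup>2 \<le> 3 * (a\<^sup>2 + b\<^sup>2 + c\<^sup>2)" for a b c :: real
  proof -
    have "0 \<le> (a - b)\<^sup>2 + (b - c)\<^sup>2 + (a - c)\<^sup>2" by simp
    thus ?thesis by (simp add: power2_eq_square algebra_simps)
  qed
  have "(\<integral>x. (f x - q x)\<^sup>2 \<partial>\<mu>) \<le> (\<integral>x. 3 * ((f x - T n x)\<^sup>2 + (T n x - h x)\<^sup>2 + (h x - q x)\<^sup>2) \<partial>\<mu>)"
  proof (rule integral_mono')
    show "(f x - q x)\<^sup>2 \<le> 3 * ((f x - T n x)\<^sup>2 + (T n x - h x)\<^sup>2 + (h x - q x)\<^sup>2)" for x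
      using sq[of "f x - T n x" "T n x - h x" "h x - q x"] by simp
  qed (use i in auto)
  also have "\<dots> = 3 * ((\<integral>x. (f x - T n x)\<^sup>2 \<partial>\<mu>) + (\<integral>x. (T n x - h x)\<^sup>2 \<partial>\<mu>) + (\<integral>x. (h x - q x)\<^sup>2 \<partial>\<mu>))"
    using i by simp
  also have "\<dots> < e" using n 2 3 by simp
  finally show thesis using that[OF q(1)] by blast
qed

lemma p_L2: "p \<kappa> \<in> L2_space \<mu>"
  by (rule L2_continuous) (intro continuous_intros)

lemma chaos_subset_L2: "chaos n \<subseteq> L2_space \<mu>"
  by (auto simp: jacobi_chaos_def L2_closed_span_def)

text \<open>The closed span is formed over a set of functions; distinct indices give distinct functions by
  orthonormality, so a sum over indices can be rewritten as one over functions.\<close>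

lemma sum_in_chaos:
  assumes S: "finite S" "\<And>\<kappa>. \<kappa> \<in> S \<Longrightarrow> (\<Sum>i\<in>UNIV. \<kappa> $ i) = n"
  shows "(\<lambda>x. \<Sum>\<kappa>\<in>S. c \<kappa> * p \<kappa> x) \<in> chaos n"
proof -
  have inj: "inj_on p S"
  proof
    fix \<kappa> \<iota> assume "p \<kappa> = p \<iota>"
    thus "\<kappa> = \<iota>" using p_orthonormal[of \<kappa> \<iota>] p_orthonormal[of \<iota> \<iota>] by (simp split: if_splits)
  qed
  define c' where "c' = (\<lambda>b. c (the_inv_into S p b))"
  have "(\<Sum>\<kappa>\<in>S. c \<kappa> * p \<kappa> x) = (\<Sum>b\<in>p ` S. c' b * b x)" for x
    by (subst sum.reindex[OF inj]) (auto simp: c'_def the_inv_into_f_f[OF inj] intro!: sum.cong)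
  hence "L2_norm \<mu> (\<lambda>x. (\<Sum>\<kappa>\<in>S. c \<kappa> * p \<kappa> x) - (\<Sum>b\<in>p ` S. c' b * b x)) = 0"
    by (simp add: L2_norm_def)
  moreover have "finite (p ` S)" "p ` S \<subseteq> {p \<kappa> | \<kappa>. (\<Sum>i\<in>UNIV. \<kappa> $ i) = n}" using S by auto
  moreover have "(\<lambda>x. \<Sum>\<kappa>\<in>S. c \<kappa> * p \<kappa> x) \<in> L2_space \<mu>" by (intro L2_sum L2_cmult p_L2)
  ultimately show ?thesis unfolding jacobi_chaos_def L2_closed_span_def
    by (intro CollectI conjI allI impI exI[of _ "p ` S"] exI[of _ c']) simp_all
qed

lemma p_in_chaos: "p \<kappa> \<in> chaos (\<Sum>i\<in>UNIV. \<kappa> $ i)"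
  using sum_in_chaos[of "{\<kappa>}" "\<Sum>i\<in>UNIV. \<kappa> $ i" "\<lambda>_. 1"] by simp

lemma chaos_orthogonal:
  assumes "m \<noteq> n" and f: "f \<in> chaos m" and g: "g \<in> chaos n"
  shows "(\<integral>x. f x * g x \<partial>\<mu>) = 0"
proof -
  have sub: "{p \<kappa> | \<kappa>. (\<Sum>i\<in>UNIV. \<kappa> $ i) = n} \<subseteq> L2_space \<mu>" for n using p_L2 by auto
  have "(\<integral>x. p \<kappa> x * g x \<partial>\<mu>) = 0" if \<kappa>: "(\<Sum>i\<in>UNIV. \<kappa> $ i) = m" for \<kappa>
  proof -
    have "(\<integral>x. g x * p \<kappa> x \<partial>\<mu>) = 0"
    proof (rule L2_closed_span_orthogonal[OF p_L2 sub _ g[unfolded jacobi_chaos_def]])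
      fix b assume "b \<in> {p \<kappa> | \<kappa>. (\<Sum>i\<in>UNIV. \<kappa> $ i) = n}"
      then obtain \<iota> where "b = p \<iota>" "(\<Sum>i\<in>UNIV. \<iota> $ i) = n" by blast
      thus "(\<integral>x. b x * p \<kappa> x \<partial>\<mu>) = 0" using \<kappa> assms(1) by (auto simp: p_orthonormal)
    qed
    thus ?thesis by (simp add: mult.commute)
  qed
  thus ?thesis using chaos_subset_L2 g
    by (intro L2_closed_span_orthogonal[OF _ sub _ f[unfolded jacobi_chaos_def]]) auto
qed

text \<open>Pythagoras: the error of the Fourier sum is orthogonal to the span of the \<open>p\<^sub>\<kappa>\<close>, \<open>\<kappa> \<in> S\<close>.\<close>

lemma fourier_best_approx:
  assumes f: "f \<in> L2_space \<mu>" and S: "finite S"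
  shows "(\<integral>x. (f x - (\<Sum>\<kappa>\<in>S. fourier f \<kappa> * p \<kappa> x))\<^sup>2 \<partial>\<mu>) \<le> (\<integral>x. (f x - (\<Sum>\<kappa>\<in>S. c \<kappa> * p \<kappa> x))\<^sup>2 \<partial>\<mu>)"
proof -
  define r where "r = (\<lambda>x. f x - (\<Sum>\<kappa>\<in>S. fourier f \<kappa> * p \<kappa> x))"
  define h where "h = (\<lambda>x. \<Sum>\<kappa>\<in>S. (fourier f \<kappa> - c \<kappa>) * p \<kappa> x)"
  have sumL: "(\<lambda>x. \<Sum>\<kappa>\<in>S. a \<kappa> * p \<kappa> x) \<in> L2_space \<mu>" for a by (intro L2_sum L2_cmult p_L2)
  have rL: "r \<in> L2_space \<mu>" unfolding r_def by (rule L2_diff[OF f sumL])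
  have hL: "h \<in> L2_space \<mu>" unfolding h_def by (rule sumL)
  have rp: "(\<integral>x. r x * p \<iota> x \<partial>\<mu>) = 0" if "\<iota> \<in> S" for \<iota>
  proof -
    have "(\<integral>x. r x * p \<iota> x \<partial>\<mu>) = (\<integral>x. f x * p \<iota> x \<partial>\<mu>) - (\<integral>x. (\<Sum>\<kappa>\<in>S. fourier f \<kappa> * p \<kappa> x) * p \<iota> x \<partial>\<mu>)"
      unfolding r_def left_diff_distrib
      by (rule Bochner_Integration.integral_diff) (intro L2_mult_integrable f sumL p_L2)+
    thus ?thesis using fourier_sum_p[OF S, of "fourier f" \<iota>] that by (simp add: fourier_def)
  qed
  have "(\<integral>x. r x * h x \<partial>\<mu>) = (\<integral>x. (\<Sum>\<kappa>\<in>S. (fourier f \<kappa> - c \<kappa>) * (r x * p \<kappa> x)) \<partial>\<mu>)"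
    by (simp add: h_def sum_distrib_left mult_ac)
  also have "\<dots> = (\<Sum>\<kappa>\<in>S. (fourier f \<kappa> - c \<kappa>) * (\<integral>x. r x * p \<kappa> x \<partial>\<mu>))"
    by (subst Bochner_Integration.integral_sum) (auto intro!: L2_mult_integrable rL p_L2)
  also have "\<dots> = 0" by (simp add: rp)
  finally have rh: "(\<integral>x. r x * h x \<partial>\<mu>) = 0" .
  have i: "integrable \<mu> (\<lambda>x. (r x)\<^sup>2)" "integrable \<mu> (\<lambda>x. (h x)\<^sup>2)" "integrable \<mu> (\<lambda>x. r x * h x)"
    using rL hL L2_mult_integrable[OF rL hL] by (auto simp: L2_space_def)
  have "(\<integral>x. (f x - (\<Sum>\<kappa>\<in>S. c \<kappa> * p \<kappa> x))\<^sup>2 \<partial>\<mu>) = (\<integral>x. (r x)\<^sup>2 + (h x)\<^sup>2 + 2 * (r x * h x) \<partial>\<mu>)"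
  proof (intro Bochner_Integration.integral_cong refl)
    fix x
    have "f x - (\<Sum>\<kappa>\<in>S. c \<kappa> * p \<kappa> x) = r x + h x"
      by (simp add: r_def h_def left_diff_distrib sum_subtractf)
    thus "(f x - (\<Sum>\<kappa>\<in>S. c \<kappa> * p \<kappa> x))\<^sup>2 = (r x)\<^sup>2 + (h x)\<^sup>2 + 2 * (r x * h x)"
      by (simp add: power2_sum mult.assoc)
  qed
  also have "\<dots> = (\<integral>x. (r x)\<^sup>2 \<partial>\<mu>) + (\<integral>x. (h x)\<^sup>2 \<partial>\<mu>) + 2 * (\<integral>x. r x * h x \<partial>\<mu>)"
    using i by simp
  also have "\<dots> \<ge> (\<integral>x. (r x)\<^sup>2 \<partial>\<mu>)" by (simp add: rh integral_nonneg_AE)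
  finally show ?thesis by (simp add: r_def)
qed

definition level :: "nat \<Rightarrow> (nat^'d) set" where
  "level n = {\<kappa>. (\<Sum>i\<in>UNIV. \<kappa> $ i) = n}"

lemma finite_level: "finite (level n)"
proof (rule finite_subset)
  show "level n \<subseteq> {\<kappa>. \<forall>i. \<kappa> $ i \<in> {..n}}"
  proof
    fix \<kappa> :: "nat^'d" assume "\<kappa> \<in> level n"
    hence "\<kappa> $ i \<le> n" for i unfolding level_def using member_le_sum[of i UNIV "\<lambda>i. \<kappa> $ i"] by auto
    thus "\<kappa> \<in> {\<kappa>. \<forall>i. \<kappa> $ i \<in> {..n}}" by simp
  qed
  show "finite {\<kappa>::nat^'d. \<forall>i. \<kappa> $ i \<in> {..n}}" by (rule prod_sum_vec(2)) simp
qed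

lemma level_0: "level 0 = {0}"
  by (auto simp: level_def vec_eq_iff)

lemma sum_levels:
  fixes a :: "nat^'d \<Rightarrow> real"
  assumes "a 0 = 0"
  shows "(\<Sum>n<N. \<Sum>\<kappa>\<in>level (Suc n). a \<kappa>) = (\<Sum>\<kappa>\<in>(\<Union>n\<le>N. level n). a \<kappa>)"
proof (induction N)
  case 0
  thus ?case using assms by (simp add: level_0)
next
  case (Suc N)
  have U: "(\<Union>n\<le>Suc N. level n) = (\<Union>n\<le>N. level n) \<union> level (Suc N)"
    by (simp add: atMost_Suc Un_commute)
  have "(\<Union>n\<le>N. level n) \<inter> level (Suc N) = {}" by (auto simp: level_def)
  hence "(\<Sum>\<kappa>\<in>(\<Union>n\<le>Suc N. level n). a \<kappa>) = (\<Sum>\<kappa>\<in>(\<Union>n\<le>N. level n). a \<kappa>) + (\<Sum>\<kappa>\<in>level (Suc N). a \<kappa>)"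
    unfolding U by (intro sum.union_disjoint) (auto simp: finite_level)
  thus ?case using Suc by simp
qed

text \<open>The components of \<open>f\<close> are its Fourier sums over the levels \<open>\<bar>\<kappa>\<bar> = n + 1\<close>; level zero contributes
  nothing as \<open>f\<close> is orthogonal to it. Convergence only needs polynomials close to \<open>f\<close>, by best
  approximation.\<close>

theorem chaos_decomposition:
  "is_hilbert_sum \<mu> (L2_complement \<mu> (chaos 0)) (\<lambda>n. chaos (Suc n))"
  unfolding is_hilbert_sum_def
proof (intro conjI allI impI)
  fix m n :: nat assume "m \<noteq> n"
  thus "chaos (Suc m) \<subseteq> L2_complement \<mu> (chaos (Suc n))"
    using chaos_subset_L2 chaos_orthogonal[of "Suc m" "Suc n"] by (auto simp: L2_complement_def)
next
  show "L2_complement \<mu> (chaos 0) = {f \<in> L2_space \<mu>. \<exists>g. (\<forall>n. g n \<in> chaos (Suc n)) \<and>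
            (\<lambda>N. L2_norm \<mu> (\<lambda>x. f x - (\<Sum>n<N. g n x))) \<longlonglongrightarrow> 0}" (is "_ = ?R")
  proof (intro equalityI subsetI)
    fix f assume "f \<in> L2_complement \<mu> (chaos 0)"
    hence f: "f \<in> L2_space \<mu>" and f0: "\<And>g. g \<in> chaos 0 \<Longrightarrow> (\<integral>x. f x * g x \<partial>\<mu>) = 0"
      by (auto simp: L2_complement_def)
    have "fourier f 0 = 0" unfolding fourier_def using p_in_chaos[of 0] by (intro f0) simp
    define g where "g = (\<lambda>n x. \<Sum>\<kappa>\<in>level (Suc n). fourier f \<kappa> * p \<kappa> x)"
    have gc: "g n \<in> chaos (Suc n)" for n
      unfolding g_def by (rule sum_in_chaos[OF finite_level]) (simp add: level_def)
    have gs: "(\<Sum>n<N. g n x) = (\<Sum>\<kappa>\<in>(\<Union>n\<le>N. level n). fourier f \<kappa> * p \<kappa> x)" for N x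
      unfolding g_def by (rule sum_levels) (simp add: \<open>fourier f 0 = 0\<close>)
    have "(\<lambda>N. L2_norm \<mu> (\<lambda>x. f x - (\<Sum>n<N. g n x))) \<longlonglongrightarrow> 0"
    proof (rule LIMSEQ_I)
      fix e :: real assume e: "e > 0"
      obtain q where q: "q \<in> p_span" "(\<integral>x. (f x - q x)\<^sup>2 \<partial>\<mu>) < e\<^sup>2" using L2_approx[OF f, of "e\<^sup>2"] e by auto
      then obtain S c where S: "finite S" "q = (\<lambda>x. \<Sum>\<kappa>\<in>S. c \<kappa> * p \<kappa> x)" unfolding p_span_def by blast
      have "finite ((\<lambda>\<kappa>. \<Sum>i\<in>UNIV. \<kappa> $ i) ` S)" using S(1) by simp
      then obtain N0 where N0: "\<forall>m\<in>(\<lambda>\<kappa>. \<Sum>i\<in>UNIV. \<kappa> $ i) ` S. m \<le> N0"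
        unfolding finite_nat_set_iff_bounded_le by blast
      have "norm (L2_norm \<mu> (\<lambda>x. f x - (\<Sum>n<N. g n x)) - 0) < e" if N: "N \<ge> N0" for N
      proof -
        let ?T = "\<Union>n\<le>N. level n"
        have fin: "finite ?T" by (simp add: finite_level)
        have "S \<subseteq> ?T" using N0 N by (force simp: level_def)
        hence qT: "q x = (\<Sum>\<kappa>\<in>?T. (if \<kappa> \<in> S then c \<kappa> else 0) * p \<kappa> x)" for x
          unfolding S(2) using fin by (intro sum.mono_neutral_cong_left) auto
        have "(\<integral>x. (f x - (\<Sum>n<N. g n x))\<^sup>2 \<partial>\<mu>) \<le> (\<integral>x. (f x - q x)\<^sup>2 \<partial>\<mu>)"
          unfolding gs qT by (rule fourier_best_approx[OF f fin])
        hence "sqrt (\<integral>x. (f x - (\<Sum>n<N. g n x))\<^sup>2 \<partial>\<mu>) < sqrt (e\<^sup>2)" using q(2) by (intro real_sqrt_less_mono) simp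
        moreover have "0 \<le> sqrt (\<integral>x. (f x - (\<Sum>n<N. g n x))\<^sup>2 \<partial>\<mu>)" by (simp add: integral_nonneg_AE)
        ultimately show ?thesis using e by (simp add: L2_norm_def)
      qed
      thus "\<exists>N0. \<forall>N\<ge>N0. norm (L2_norm \<mu> (\<lambda>x. f x - (\<Sum>n<N. g n x)) - 0) < e" by blast
    qed
    thus "f \<in> ?R" using f gc by blast
  next
    fix f assume "f \<in> ?R"
    then obtain g where f: "f \<in> L2_space \<mu>" and g: "\<And>n. g n \<in> chaos (Suc n)"
      and lim: "(\<lambda>N. L2_norm \<mu> (\<lambda>x. f x - (\<Sum>n<N. g n x))) \<longlonglongrightarrow> 0" by blast
    have gL: "g n \<in> L2_space \<mu>" for n using g chaos_subset_L2 by blast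
    have "(\<integral>x. f x * h x \<partial>\<mu>) = 0" if h: "h \<in> chaos 0" for h
    proof -
      have hL: "h \<in> L2_space \<mu>" using h chaos_subset_L2 by blast
      have sL: "(\<lambda>x. \<Sum>n<N. g n x) \<in> L2_space \<mu>" for N by (intro L2_sum gL)
      have rL: "(\<lambda>x. f x - (\<Sum>n<N. g n x)) \<in> L2_space \<mu>" for N by (rule L2_diff[OF f sL])
      have "(\<integral>x. (\<Sum>n<N. g n x) * h x \<partial>\<mu>) = (\<Sum>n<N. \<integral>x. g n x * h x \<partial>\<mu>)" for N
        unfolding sum_distrib_right by (rule Bochner_Integration.integral_sum) (intro L2_mult_integrable gL hL)
      also have "(\<Sum>n<N. \<integral>x. g n x * h x \<partial>\<mu>) = 0" for N
        by (intro sum.neutral ballI chaos_orthogonal[OF _ g h]) simp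
      finally have "(\<integral>x. f x * h x \<partial>\<mu>) = (\<integral>x. (f x - (\<Sum>n<N. g n x)) * h x \<partial>\<mu>)" for N
        using L2_mult_integrable[OF f hL] L2_mult_integrable[OF sL hL] by (simp add: left_diff_distrib)
      hence b: "\<bar>\<integral>x. f x * h x \<partial>\<mu>\<bar> \<le> L2_norm \<mu> (\<lambda>x. f x - (\<Sum>n<N. g n x)) * L2_norm \<mu> h" for N
        using L2_Cauchy_Schwarz[OF rL hL] by simp
      have "(\<lambda>N. L2_norm \<mu> (\<lambda>x. f x - (\<Sum>n<N. g n x)) * L2_norm \<mu> h) \<longlonglongrightarrow> 0 * L2_norm \<mu> h"
        by (intro tendsto_intros lim)
      hence "\<bar>\<integral>x. f x * h x \<partial>\<mu>\<bar> \<le> 0 * L2_norm \<mu> h"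
        by (rule LIMSEQ_le_const) (use b in blast)
      thus ?thesis by simp
    qed
    thus "f \<in> L2_complement \<mu> (chaos 0)" using f by (simp add: L2_complement_def)
  qed
qed

end

theorem lemma3p7:
  fixes \<alpha> \<beta> :: "real^'d"
  assumes "\<And>i. \<alpha> $ i > -1/2" and "\<And>i. \<beta> $ i > -1/2"
  shows "(\<forall>f. C2_on cube f \<and> (\<integral>y. f y \<partial>jacobi_measure \<alpha> \<beta>) = 0 \<longrightarrow>
           (\<exists>C. \<forall>x\<in>cube. \<forall>t>0.
              (\<lambda>s. poisson_jacobi \<alpha> \<beta> s f x) differentiable (at t) \<and>
              \<bar>deriv (\<lambda>s. poisson_jacobi \<alpha> \<beta> s f x) t\<bar>
                \<le> C * (1 + norm x) * exp (- sqrt (min_eigenvalue \<alpha> \<beta>) * t))) \<and>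
         is_hilbert_sum (jacobi_measure \<alpha> \<beta>)
           (L2_complement (jacobi_measure \<alpha> \<beta>) (jacobi_chaos \<alpha> \<beta> 0))
           (\<lambda>n. jacobi_chaos \<alpha> \<beta> (Suc n)) \<and>
         (\<forall>f. C2_on cube f \<and> (\<integral>y. f y \<partial>jacobi_measure \<alpha> \<beta>) = 0 \<longrightarrow>
           (\<exists>C. \<forall>x\<in>cube. \<forall>t>0.
              \<bar>poisson_jacobi \<alpha> \<beta> t f x\<bar>
                \<le> C * (1 + norm x) * exp (- sqrt (min_eigenvalue \<alpha> \<beta>) * t)))"
proof -
  interpret jacobi \<alpha> \<beta>
  proof
    show "\<alpha> $ i > -1" "\<beta> $ i > -1" for i using assms(1)[of i] assms(2)[of i] by auto
  qed
  have decay: "\<exists>C. \<forall>x\<in>cube. \<forall>t>0. (\<lambda>s. poisson_jacobi \<alpha> \<beta> s f x) differentiable (at t) \<and>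
      \<bar>deriv (\<lambda>s. poisson_jacobi \<alpha> \<beta> s f x) t\<bar> \<le> C * (1 + norm x) * exp (- sqrt (min_eigenvalue \<alpha> \<beta>) * t) \<and>
      \<bar>poisson_jacobi \<alpha> \<beta> t f x\<bar> \<le> C * (1 + norm x) * exp (- sqrt (min_eigenvalue \<alpha> \<beta>) * t)"
    if f: "C2_on cube f" "(\<integral>y. f y \<partial>jacobi_measure \<alpha> \<beta>) = 0" for f :: "real^'d \<Rightarrow> real"
  proof -
    obtain C where C: "C \<ge> 0"
      "\<And>x t. x \<in> cube \<Longrightarrow> t > 0 \<Longrightarrow> (\<lambda>s. poisson_jacobi \<alpha> \<beta> s f x) differentiable (at t) \<and>
      \<bar>deriv (\<lambda>s. poisson_jacobi \<alpha> \<beta> s f x) t\<bar> \<le> C * exp (- sqrt (min_eigenvalue \<alpha> \<beta>) * t) \<and>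
      \<bar>poisson_jacobi \<alpha> \<beta> t f x\<bar> \<le> C * exp (- sqrt (min_eigenvalue \<alpha> \<beta>) * t)"
      by (rule poisson_jacobi_decay[OF f]) blast
    have "C * E \<le> C * (1 + norm x) * E" if "E \<ge> 0" for E and x :: "real^'d"
      using C(1) that by (intro mult_right_mono) (auto simp: distrib_left)
    thus ?thesis using C(2) by (intro exI[of _ C]) (meson exp_ge_zero order_trans)
  qed
  show ?thesis using decay chaos_decomposition by blast
qed

end
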